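(* Let $n\in\mathbb N$. If $f\in h^2(\mathbb U^n)$, then the restriction of $f$ to the unit ball $\mathbb B_n\subset\mathbb U^n$ satisfies $$\|f\|_{h^{2n}(\mathbb B_n)}\le D_n\,\|f\|_{h^2(\mathbb U^n)},\qquad\text{where } D_n=\sqrt2\cos\left(\frac{\pi}{4n}\right).$$
   Context: $\mathbb U$ is the open unit disc in $\mathbb C$, $\mathbb T$ the unit circle, $\mathbb U^n$ the unit polydisc, and $dm_n$ is normalized Haar measure on $\mathbb T^n$. $\mathbb B_n$ is the open Euclidean unit ball of $\mathbb C^n$ and $d\sigma_n$ is normalized surface measure on $\partial\mathbb B_n$ ($\sigma_n(\partial\mathbb B_n)=1$). A complex-valued $C^2$ function $f$ is pluriharmonic if $\partial^2 f/\partial z_j\partial\overline z_k=0$ for all $1\le j,k\le n$. $h^2(\mathbb U^n)$ is the set of complex-valued pluriharmonic $f$ on $\mathbb U^n$ with $$\|f\|_{h^2(\mathbb U^n)}=\sup_{0<r<1}\Big(\int_{\mathbb T^n}|f(r\omega)|^2\,dm_n(\omega)\Big)^{1/2}<\infty.$$ For pluriharmonic $f$ on $\mathbb B_n$ and $0<p<\infty$, $$\|f\|_{h^p(\mathbb B_n)}=\sup_{0<r<1}\Big(\int_{\partial\mathbb B_n}|f(r\zeta)|^p\,d\sigma_n(\zeta)\Big)^{1/p}.$$ *)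

theory Defs
  imports "HOL-Probability.Probability"
begin

text \<open>
  Points of $\mathbb{C}^n$ are elements of \<^typ>\<open>complex ^ 'n\<close> with $n$ the cardinality of the index type.
  Derivatives are real Frechet derivatives throughout.
\<close>

definition C2_on :: "'a::real_normed_vector set \<Rightarrow> ('a \<Rightarrow> 'b::real_normed_vector) \<Rightarrow> bool" where
  "C2_on S f \<longleftrightarrow>
    (\<exists>f' :: 'a \<Rightarrow> 'a \<Rightarrow>\<^sub>L 'b. \<exists>f'' :: 'a \<Rightarrow> 'a \<Rightarrow>\<^sub>L ('a \<Rightarrow>\<^sub>L 'b).
      (\<forall>x\<in>S. (f has_derivative blinfun_apply (f' x)) (at x)) \<and>
      (\<forall>x\<in>S. (f' has_derivative blinfun_apply (f'' x)) (at x)) \<and>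
      continuous_on S f'')"

text \<open>The Wirtinger operators: with $z_j = x_j + i y_j$, the vector \<^term>\<open>axis j 1\<close> is the direction
  of $x_j$ and \<^term>\<open>axis j \<i>\<close> that of $y_j$.\<close>

definition wirtinger_d :: "'n::finite \<Rightarrow> (complex ^ 'n \<Rightarrow> complex) \<Rightarrow> complex ^ 'n \<Rightarrow> complex" where
  "wirtinger_d j f z =
    (frechet_derivative f (at z) (axis j 1) - \<i> * frechet_derivative f (at z) (axis j \<i>)) / 2"

definition wirtinger_dbar :: "'n::finite \<Rightarrow> (complex ^ 'n \<Rightarrow> complex) \<Rightarrow> complex ^ 'n \<Rightarrow> complex" where
  "wirtinger_dbar k f z =
    (frechet_derivative f (at z) (axis k 1) + \<i> * frechet_derivative f (at z) (axis k \<i>)) / 2"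

text \<open>Intended for open \<^term>\<open>S\<close>, where values of \<^term>\<open>f\<close> outside \<^term>\<open>S\<close> are irrelevant.\<close>

definition pluriharmonic_on :: "(complex ^ 'n::finite) set \<Rightarrow> (complex ^ 'n \<Rightarrow> complex) \<Rightarrow> bool" where
  "pluriharmonic_on S f \<longleftrightarrow>
    C2_on S f \<and> (\<forall>j k. \<forall>z\<in>S. wirtinger_d j (wirtinger_dbar k f) z = 0)"

definition unit_polydisc :: "(complex ^ 'n::finite) set" where
  "unit_polydisc = {z. \<forall>j. z $ j \<in> ball 0 1}"

definition unit_torus :: "(complex ^ 'n::finite) set" where
  "unit_torus = {\<omega>. \<forall>j. \<omega> $ j \<in> sphere 0 1}"

definition circle_measure :: "complex measure" where
  "circle_measure = distr (uniform_measure lborel {0..2 * pi}) borel cis"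

text \<open>Normalized Haar measure of the torus, as a Borel measure on the ambient space concentrated on
  \<^term>\<open>unit_torus\<close>: the product of the normalized arc length measures.\<close>

definition torus_measure :: "(complex ^ 'n::finite) measure" where
  "torus_measure = distr (\<Pi>\<^sub>M j\<in>UNIV. circle_measure) borel vec_lambda"

text \<open>Normalized surface measure of the unit sphere, as a Borel measure on the ambient space
  concentrated on the sphere: the measure of a set is the normalized volume of the cone over it
  (polar coordinates).\<close>

definition sphere_measure :: "'a::euclidean_space measure" where
  "sphere_measure = distr (uniform_measure lborel (ball 0 1)) borel sgn"

text \<open>The norms take values in \<^typ>\<open>ennreal\<close>, so that an infinite supremum is not collapsed to a
  real number. The set integrals make the values of \<^term>\<open>f\<close> outside the domain irrelevant, also
  for measurability.\<close>

definition h2_norm_polydisc :: "(complex ^ 'n::finite \<Rightarrow> complex) \<Rightarrow> ennreal" where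
  "h2_norm_polydisc f =
    (SUP r\<in>{0<..<1}. ennreal (sqrt (LINT \<omega>:unit_torus|torus_measure. (norm (f (r *\<^sub>R \<omega>)))\<^sup>2)))"

definition h2_polydisc :: "(complex ^ 'n::finite \<Rightarrow> complex) set" where
  "h2_polydisc = {f. pluriharmonic_on unit_polydisc f \<and> h2_norm_polydisc f < \<infinity>}"

definition hp_norm_ball :: "real \<Rightarrow> (complex ^ 'n::finite \<Rightarrow> complex) \<Rightarrow> ennreal" where
  "hp_norm_ball p f =
    (SUP r\<in>{0<..<1}.
      ennreal ((LINT \<zeta>:sphere 0 1|sphere_measure. norm (f (r *\<^sub>R \<zeta>)) powr p) powr (1 / p)))"

lemma unit_ball_subset_unit_polydisc: "ball 0 1 \<subseteq> (unit_polydisc :: (complex ^ 'n::finite) set)"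
  by (auto simp: unit_polydisc_def intro: le_less_trans[OF Finite_Cartesian_Product.norm_nth_le])

lemma pluriharmonic_on_subset:
  "pluriharmonic_on S f \<Longrightarrow> T \<subseteq> S \<Longrightarrow> pluriharmonic_on T f"
  unfolding pluriharmonic_on_def C2_on_def by (blast intro: continuous_on_subset)

lemma measurable_cis [measurable]: "cis \<in> borel_measurable borel"
  by (intro borel_measurable_continuous_onI continuous_intros)

lemma prob_space_circle_measure: "prob_space circle_measure"
  unfolding circle_measure_def
  by (intro prob_space.prob_space_distr prob_space_uniform_measure) auto

lemma sets_circle_measure [simp, measurable_cong]: "sets circle_measure = sets borel"
  by (simp add: circle_measure_def)

lemma measurable_vec_lambda_circle:
  "vec_lambda \<in> (\<Pi>\<^sub>M j\<in>(UNIV :: 'n::finite set). circle_measure) \<rightarrow>\<^sub>M (borel :: (complex ^ 'n) measure)"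
proof (subst borel_measurable_euclidean_space, safe)
  fix b :: "complex ^ 'n"
  assume "b \<in> Basis"
  then obtain i c where b: "b = axis i c"
    by (auto simp: Basis_vec_def)
  have [measurable]: "(\<lambda>x. x i) \<in> (\<Pi>\<^sub>M j\<in>(UNIV :: 'n set). circle_measure) \<rightarrow>\<^sub>M borel"
    using measurable_component_singleton[of i UNIV "\<lambda>_. circle_measure"]
    by (simp add: measurable_cong_sets[OF refl sets_circle_measure])
  show "(\<lambda>x. vec_lambda x \<bullet> b) \<in> borel_measurable (\<Pi>\<^sub>M j\<in>(UNIV :: 'n set). circle_measure)"
    by (simp add: b inner_axis)
qed

lemma prob_space_torus_measure: "prob_space (torus_measure :: (complex ^ 'n::finite) measure)"
proof -
  interpret product_prob_space "\<lambda>_. circle_measure" "UNIV :: 'n set"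
    by (simp add: product_prob_space_def product_sigma_finite_def product_prob_space_axioms_def
        prob_space_circle_measure prob_space_imp_sigma_finite)
  show ?thesis
    unfolding torus_measure_def by (rule prob_space_distr[OF measurable_vec_lambda_circle])
qed

lemma AE_torus_measure: "AE \<omega> in torus_measure. \<omega> \<in> (unit_torus :: (complex ^ 'n::finite) set)"
proof -
  have c: "AE z in circle_measure. z \<in> sphere 0 1"
    unfolding circle_measure_def
    by (subst AE_distr_iff) auto
  interpret product_prob_space "\<lambda>_. circle_measure" "UNIV :: 'n set"
    by (simp add: product_prob_space_def product_sigma_finite_def product_prob_space_axioms_def
        prob_space_circle_measure prob_space_imp_sigma_finite)
  have "AE x in (\<Pi>\<^sub>M j\<in>(UNIV :: 'n set). circle_measure). x j \<in> sphere 0 1" for j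
    using AE_component[OF _ c, of j] by simp
  then have "AE x in (\<Pi>\<^sub>M j\<in>(UNIV :: 'n set). circle_measure). \<forall>j. x j \<in> sphere 0 1"
    by (subst AE_all_countable) auto
  moreover have "closed (unit_torus :: (complex ^ 'n) set)"
    unfolding unit_torus_def mem_sphere dist_norm
    by (intro closed_Collect_all closed_Collect_eq continuous_intros)
  ultimately show ?thesis
    unfolding torus_measure_def
    by (subst AE_distr_iff[OF measurable_vec_lambda_circle]) (auto simp: unit_torus_def)
qed

lemma prob_space_sphere_measure: "prob_space (sphere_measure :: 'a::euclidean_space measure)"
proof -
  have "emeasure lborel (ball 0 1 :: 'a set) \<noteq> 0"
    by (metis emeasure_lborel_ball_finite order_less_irrefl emeasure_ball ennreal_eq_0_iff
        content_ball_pos measure_def enn2real_eq_0_iff zero_less_one)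
  moreover have "emeasure lborel (ball 0 1 :: 'a set) \<noteq> \<infinity>"
    using emeasure_lborel_ball_finite[of "0::'a" 1] by auto
  ultimately show ?thesis
    unfolding sphere_measure_def
    by (intro prob_space.prob_space_distr prob_space_uniform_measure) auto
qed

lemma emeasure_sphere_measure:
  fixes A :: "'a::euclidean_space set"
  assumes "A \<in> sets borel" "A \<subseteq> sphere 0 1"
  shows "emeasure sphere_measure A =
    emeasure lborel {t *\<^sub>R \<zeta> | t \<zeta>. \<zeta> \<in> A \<and> 0 < t \<and> t < 1} / emeasure lborel (ball 0 1 :: 'a set)"
proof -
  have eq: "ball 0 1 \<inter> sgn -` A = {t *\<^sub>R \<zeta> | t \<zeta>. \<zeta> \<in> A \<and> 0 < t \<and> t < 1}" (is "?L = ?R")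
  proof (intro equalityI subsetI)
    fix x assume x: "x \<in> ?L"
    then have "x \<noteq> 0"
      using assms(2) by auto
    moreover from this have "x = norm x *\<^sub>R sgn x"
      by (simp add: sgn_div_norm)
    ultimately show "x \<in> ?R"
      using x by (force simp: dist_norm)
  next
    fix x assume "x \<in> ?R"
    then obtain t \<zeta> where x: "x = t *\<^sub>R \<zeta>" "\<zeta> \<in> A" "0 < t" "t < 1"
      by auto
    moreover have "norm \<zeta> = 1"
      using x assms(2) by auto
    ultimately show "x \<in> ?L"
      by (simp add: sgn_div_norm)
  qed
  have m: "(sgn :: 'a \<Rightarrow> 'a) \<in> borel_measurable borel"
    by measurable
  have "sgn -` A \<in> sets borel"
    using measurable_sets[OF m assms(1)] by simp
  then show ?thesis
    unfolding sphere_measure_def using assms(1) m eq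
    by (simp add: emeasure_distr)
qed

end

theory Submission
  imports Defs "HOL-Complex_Analysis.Complex_Analysis"
begin

text \<open>
  On smaller polydiscs, \<open>f\<close> is the limit of the partial sums of its Fourier series on a torus, which have
  the form \<open>g + cnj h\<close> with polynomials \<open>g\<close>, \<open>h\<close> and \<open>h 0 = 0\<close>: the mixed Fourier coefficients vanish. For such
  sums one integrates over the sphere a pointwise inequality
  \<open>|z + cnj w|^(2n) \<le> D_n^(2n) (|z|^2 + |w|^2)^n + c Re ((z w)^n)\<close>.
  The last term is harmless because \<open>(g h)^n\<close> is a polynomial vanishing at \<open>0\<close>. After binomial expansion the
  first term is handled by \<open>\<integral> |g_1 \<cdots> g_n|^2 d\<sigma> \<le> \<Prod> \<parallel>g_i\<parallel>^2\<close>, with the norms of \<open>H^2\<close> of the polydisc: the square norm of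
  \<open>z^\<beta>\<close> on the sphere is at most the reciprocal of the number of ways of writing \<open>\<beta>\<close> as a sum of \<open>n\<close> multi-indices.
  Finally \<open>\<parallel>g\<parallel>^2 + \<parallel>h\<parallel>^2\<close> is bounded by Bessel's inequality.
\<close>

section \<open>A pointwise inequality\<close>

text \<open>Origin of \<open>D_n\<close>: let \<open>z * w\<close> have argument \<theta> and put x
  = \<theta>/2. In the extremal case |z| = |w| the pointwise inequality compares cos(x)^(2n) with a
  constant plus a multiple of cos(2nx), the latter coming from the harmless term. The constant is
  the value of cos^(2n) at the first zero pi/(4n) of cos(2nx), and c is the multiple for which both
  sides are tangent there. The factor sqrt 2 stems from 1 + cos \<theta> = 2 cos(x)^2. The exponent
  2n is tied to the dimension: every term of the binomial expansion is a product of exactly n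
  polynomials, and n is the number of factors for which moments on the sphere of C^n balance the
  count of decompositions. No global splitting of \<open>f\<close> into a holomorphic and an
  antiholomorphic part is constructed. Only slices in one variable are split, with the help of a
  primitive on the disc; this suffices both for Poisson's formula, one coordinate at a time, and for
  the vanishing of mixed coefficients. The expansion on the torus of radius r is used only on
  polydiscs of radius \<rho> < r, so a sphere of radius \<rho> is compared with a torus of larger
  radius; the supremum over r in the torus norm absorbs the gap.\<close>

text \<open>This is k tan x <= tan (k x) with denominators cleared, which stays true when k x passes
  pi/2. The difference vanishes at 0 and has derivative (k^2 - 1) sin x sin (k x).\<close>

lemma mult_sin_cos_le_cos_sin:
  fixes k x :: real
  assumes "1 \<le> k" "0 \<le> x" "k * x \<le> pi"
  shows "k * sin x * cos (k * x) \<le> cos x * sin (k * x)"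
proof -
  define H where "H = (\<lambda>x. cos x * sin (k * x) - k * sin x * cos (k * x))"
  have "H 0 \<le> H x"
  proof (rule DERIV_nonneg_imp_nondecreasing[OF assms(2)])
    fix y assume y: "0 \<le> y" "y \<le> x"
    have "(H has_real_derivative (k\<^sup>2 - 1) * (sin y * sin (k * y))) (at y)"
      unfolding H_def by (auto intro!: derivative_eq_intros simp: algebra_simps power2_eq_square)
    moreover have "k * y \<le> k * x" "y \<le> k * y"
      using y assms(1) mult_right_mono[of 1 k y] by (auto intro: mult_left_mono)
    then have "y \<le> pi" "k * y \<le> pi" using assms(3) by linarith+
    then have "0 \<le> sin y" "0 \<le> sin (k * y)"
      using y assms(1) by (auto intro!: sin_ge_zero)
    moreover have "0 \<le> k\<^sup>2 - 1"
      using assms(1) by (simp add: power2_eq_square mult_le_cancel_left1 one_le_mult_iff mult_ge1_I)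
    ultimately show "\<exists>d. (H has_real_derivative d) (at y) \<and> 0 \<le> d"
      by (intro exI[of _ "(k\<^sup>2 - 1) * (sin y * sin (k * y))"] conjI mult_nonneg_nonneg)
  qed
  then show ?thesis by (simp add: H_def)
qed

text \<open>Up to common factors, numerator and denominator are the derivatives of cos^m x and cos
  (m x). Monotonicity of their ratio means that a combination of these two functions has a
  derivative with at most one change of sign.\<close>

lemma cos_power_sin_mono_ratio:
  fixes m :: nat and x y :: real
  assumes "2 \<le> m" "0 < x" "x \<le> y" "real m * y < pi"
  shows "cos x ^ (m - 1) * sin x / sin (m * x) \<le> cos y ^ (m - 1) * sin y / sin (m * y)"
proof (rule DERIV_nonneg_imp_nondecreasing[OF assms(3)])
  fix t assume t: "x \<le> t" "t \<le> y"
  obtain k where k: "m = k + 2" using assms(1) by (metis add.commute le_Suc_ex)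
  have mt: "0 < real m * t" "real m * t < pi"
    using t assms by (auto intro: le_less_trans[OF mult_left_mono[of t y "real m"]] )
  have t0: "0 < t" "2 * t < pi"
  proof -
    show "0 < t" using t assms by simp
    then have "2 * t \<le> real m * t" using assms(1) by (intro mult_right_mono) auto
    then show "2 * t < pi" using mt by simp
  qed
  have c: "0 < cos t" using t0 by (intro cos_gt_zero) auto
  have s: "0 < sin (m * t)" using mt by (intro sin_gt_zero) auto
  \<comment> \<open>Writing \<open>m * t\<close> as \<open>K * t + t\<close>, the addition formulas
    turn the numerator of the quotient rule, after a power of cos t is taken out, into the
    difference treated by \<open>mult_sin_cos_le_cos_sin\<close> with factor
    \<open>K\<close>.\<close>
  define K where "K = real m - 1"
  have mK: "real m = K + 1" by (simp add: K_def)
  have Kt: "K * t \<le> pi"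
    using mt t0 by (simp add: K_def left_diff_distrib)
  have e: "sin (m * t) = sin (K * t) * cos t + cos (K * t) * sin t"
    unfolding mK by (simp add: distrib_right sin_add)
  have e2: "cos (m * t) = cos (K * t) * cos t - sin (K * t) * sin t"
    unfolding mK by (simp add: distrib_right cos_add)
  have num: "cos t * sin (m * t) * cos t - (real m - 1) * sin t * sin t * sin (m * t) - real m * cos t * sin t * cos (m * t)
      = cos t * sin (K * t) - K * sin t * cos (K * t)"
  proof -
    have alg: "c * (S * c + C * s) * c - K * s * s * (S * c + C * s) - (K + 1) * c * s * (C * c - S * s)
      = (c * S - K * s * C) * (c * c + s * s)" for c s S C :: real
      by algebra
    have "cos t * cos t + sin t * sin t = 1"
      using sin_cos_squared_add2[of t] by (simp add: power2_eq_square)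
    then show ?thesis
      unfolding e e2 unfolding mK using alg[of "cos t" "sin (K * t)" "cos (K * t)" "sin t"] by simp
  qed
  have nn: "0 \<le> cos t * sin (K * t) - K * sin t * cos (K * t)"
    using mult_sin_cos_le_cos_sin[of K t] t0 Kt assms(1) by (simp add: K_def)
  let ?d = "cos t ^ k * (cos t * sin (K * t) - K * sin t * cos (K * t)) / (sin (m * t))\<^sup>2"
  have d1: "((\<lambda>t. cos t ^ Suc k) has_real_derivative real (Suc k) * (cos t ^ k * - sin t)) (at t)"
    using DERIV_power[OF DERIV_cos[of t], where n = "Suc k"] by (simp add: mult_ac)
  have d2: "((\<lambda>t. sin (m * t)) has_real_derivative cos (m * t) * m) (at t)"
    by (auto intro!: derivative_eq_intros)
  have "((\<lambda>t. cos t ^ (m - 1) * sin t / sin (m * t)) has_real_derivative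
     ((cos t ^ (m-1) * cos t + (real (m-1) * (cos t ^ (m-2) * - sin t)) * sin t) * sin (m * t) - cos t ^ (m-1) * sin t * (cos (m * t) * m)) / (sin (m * t) * sin (m * t))) (at t)"
    using DERIV_divide[OF DERIV_mult[OF d1 DERIV_sin] d2] s by (simp add: k algebra_simps)
  also have "((cos t ^ (m-1) * cos t + (real (m-1) * (cos t ^ (m-2) * - sin t)) * sin t) * sin (m * t) - cos t ^ (m-1) * sin t * (cos (m * t) * m)) / (sin (m * t) * sin (m * t))
    = cos t ^ k * (cos t * sin (m * t) * cos t - (real m - 1) * sin t * sin t * sin (m * t) - real m * cos t * sin t * cos (m * t)) / (sin (m * t))\<^sup>2"
    unfolding k by (simp add: power2_eq_square algebra_simps)
  also have "\<dots> = ?d" unfolding num ..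
  finally show "\<exists>d. ((\<lambda>t. cos t ^ (m - 1) * sin t / sin (m * t)) has_real_derivative d) (at t) \<and> 0 \<le> d"
    using nn c by (intro exI[of _ ?d] conjI) auto
qed

text \<open>Both sides agree at \<open>a\<close>, where cos (2 n a) = 0, and the coefficient makes
  them tangent there. The monotone ratio lets the difference \<open>F\<close> decrease up to
  \<open>a\<close> and increase from \<open>a\<close> to \<open>2 * a\<close>, so that its minimum
  on this range is \<open>F a = 0\<close>.\<close>

lemma cos_power_le_cos_multiple:
  fixes n :: nat and x :: real
  assumes n: "1 \<le> n" and x: "0 \<le> x" "x \<le> pi / 2"
  defines "a \<equiv> pi / (4 * real n)"
  shows "cos x ^ (2 * n) \<le> cos a ^ (2 * n) + cos a ^ (2 * n - 1) * sin a * cos (2 * real n * x)"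
proof -
  define B where "B = cos a ^ (2 * n - 1) * sin a"
  define F where "F = (\<lambda>x. cos a ^ (2 * n) + B * cos (2 * real n * x) - cos x ^ (2 * n))"
  define G where "G = (\<lambda>x. cos x ^ (2 * n - 1) * sin x / sin (real (2 * n) * x))"
  have a: "0 < a" "2 * real n * a = pi / 2" "a \<le> pi / 4" "2 * real n * (2 * a) = pi"
    using n by (auto simp: a_def field_simps)
  have F': "(F has_real_derivative (2 * real n * (cos x ^ (2 * n - 1) * sin x - B * sin (2 * real n * x)))) (at x)" for x
    unfolding F_def by (auto intro!: derivative_eq_intros simp: algebra_simps)
  have Ga: "G a = B" unfolding G_def B_def of_nat_mult of_nat_numeral a(2) by simp
  have Fa: "F a = 0" 
  proof -
    have "cos (2 * real n * a) = 0" unfolding a(2) by simp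
    then show ?thesis by (simp add: F_def)
  qed
  have dec: "0 \<le> F x" if "0 \<le> x" "x \<le> a" for x
  proof -
    have "F a \<le> F x"
    proof (rule DERIV_nonpos_imp_nonincreasing[OF that(2)])
      fix t assume t: "x \<le> t" "t \<le> a"
      have "cos t ^ (2 * n - 1) * sin t - B * sin (2 * real n * t) \<le> 0"
      proof (cases "t = 0")
        case False
        then have t0: "0 < t" using t that by simp
        have "G t \<le> G a" unfolding G_def
          using t0 t a n by (intro cos_power_sin_mono_ratio) (auto simp: mult.assoc)
        moreover have "2 * real n * t \<le> pi / 2"
          using mult_left_mono[OF t(2), of "2 * real n"] a(2) by simp
        then have "0 < sin (2 * real n * t)"
          using t0 n pi_gt_zero by (intro sin_gt_zero) (simp, linarith)
        ultimately show ?thesis unfolding Ga by (simp add: G_def field_simps)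
      qed (simp add: n)
      then show "\<exists>d. (F has_real_derivative d) (at t) \<and> d \<le> 0"
        using F'[of t] by (intro exI conjI) (auto intro: mult_nonneg_nonpos)
    qed
    then show ?thesis using Fa by simp
  qed
  have inc: "0 \<le> F x" if "a \<le> x" "x < 2 * a" for x
  proof -
    have "F a \<le> F x"
    proof (rule DERIV_nonneg_imp_nondecreasing[OF that(1)])
      fix t assume t: "a \<le> t" "t \<le> x"
      have lt: "2 * real n * t < pi"
      proof -
        have "2 * real n * t < 2 * real n * (2 * a)" using t that n by (intro mult_strict_left_mono) auto
        then show ?thesis using a by simp
      qed
      have "G a \<le> G t" unfolding G_def
        using t lt a n by (intro cos_power_sin_mono_ratio) (auto simp: mult.assoc)
      moreover have "0 < sin (2 * real n * t)"
        using a(1) t n lt by (intro sin_gt_zero) auto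
      ultimately have "0 \<le> cos t ^ (2 * n - 1) * sin t - B * sin (2 * real n * t)"
        unfolding Ga by (simp add: G_def field_simps)
      then show "\<exists>d. (F has_real_derivative d) (at t) \<and> 0 \<le> d"
        using F'[of t] by (intro exI conjI) auto
    qed
    then show ?thesis using Fa by simp
  qed
  \<comment> \<open>At \<open>2 * a\<close> the denominator sin (2 n x) of the ratio vanishes, so
    this endpoint is reached by continuity from the left.\<close>
  have F2a: "0 \<le> F (2 * a)"
  proof (rule tendsto_lowerbound)
    have "isCont F (2 * a)" using F' DERIV_isCont by blast
    then show "(F \<longlongrightarrow> F (2 * a)) (at_left (2 * a))"
      by (simp add: isCont_def filterlim_at_split)
    show "\<forall>\<^sub>F x in at_left (2 * a). 0 \<le> F x"
      using eventually_at_left_real[of a "2 * a"] a(1) by (auto elim!: eventually_mono intro: inc)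
  qed simp
  have "0 \<le> B"
    unfolding B_def using a pi_gt_zero by (intro mult_nonneg_nonneg zero_le_power cos_ge_zero sin_ge_zero) auto
  have "0 \<le> F x"
  proof (cases "x < 2 * a")
    case True
    then show ?thesis using dec inc x by (cases "x \<le> a") auto
  next
    \<comment> \<open>Past \<open>2 * a\<close> the right side is never below its value at
      \<open>2 * a\<close>, where the cosine is -1, while the power of the cosine on the left only
      decreases.\<close>
    case False
    have "cos x ^ (2 * n) \<le> cos (2 * a) ^ (2 * n)"
      using False x a by (intro power_mono cos_ge_zero) (auto intro: cos_monotone_0_pi_le)
    moreover have "- B \<le> B * cos (2 * real n * x)"
      using \<open>0 \<le> B\<close> mult_left_mono[OF cos_ge_minus_one, of B] by simp
    moreover have "cos (2 * real n * (2 * a)) = - 1" unfolding a(4) by simp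
    ultimately show ?thesis using F2a by (simp add: F_def)
  qed
  then show ?thesis by (simp add: F_def B_def)
qed

text \<open>In terms of s = |z|^2 + |w|^2 and u = 2|z||w| <= s, the left side is (s + u cos
  \<theta>)^n and the last term is a multiple of u^n cos (n \<theta>), which is independent of s.
  Hence s can be lowered to u, where the inequality is homogeneous and follows from
  \<open>cos_power_le_cos_multiple\<close> at |\<theta>|/2.\<close>

lemma norm_add_cnj_power_le:
  fixes n :: nat and z w :: complex
  assumes n: "1 \<le> n"
  defines "a \<equiv> pi / (4 * real n)"
  shows "norm (z + cnj w) ^ (2 * n) \<le>
    2 ^ n * cos a ^ (2 * n) * ((norm z)\<^sup>2 + (norm w)\<^sup>2) ^ n
    + 4 ^ n * (cos a ^ (2 * n - 1) * sin a) * Re ((z * w) ^ n)"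
proof -
  define B where "B = cos a ^ (2 * n - 1) * sin a"
  define C where "C = cos a ^ (2 * n)"
  define \<theta> where "\<theta> = Arg (z * w)"
  define s where "s = (norm z)\<^sup>2 + (norm w)\<^sup>2"
  define u where "u = 2 * norm z * norm w"
  have zw: "z * w = of_real (norm z * norm w) * cis \<theta>"
    using rcis_cmod_Arg[of "z * w"] by (simp add: \<theta>_def rcis_def norm_mult)
  have u: "0 \<le> u" by (simp add: u_def)
  have us: "u \<le> s"
    using sum_squares_bound[of "norm z" "norm w"] by (simp add: u_def s_def)
  have lhs: "norm (z + cnj w) ^ (2 * n) = (s + u * cos \<theta>) ^ n"
  proof -
    have "(norm (z + cnj w))\<^sup>2 = s + 2 * Re (z * w)"
      unfolding s_def cmod_power2 by (simp add: power2_eq_square algebra_simps)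
    also have "2 * Re (z * w) = u * cos \<theta>"
      unfolding zw by (simp add: u_def)
    finally show ?thesis by (simp add: power_mult)
  qed
  have rhs: "2 ^ n * Re ((z * w) ^ n) = u ^ n * cos (real n * \<theta>)"
  proof -
    have "Re ((z * w) ^ n) = (norm z * norm w) ^ n * Re (cis \<theta> ^ n)"
      unfolding zw power_mult_distrib of_real_power[symmetric] by simp
    also have "Re (cis \<theta> ^ n) = cos (real n * \<theta>)" by (simp only: Complex.DeMoivre cis.sel)
    finally show ?thesis by (simp add: u_def power_mult_distrib)
  qed
  have a: "0 < a" "a \<le> pi / 4" using n by (auto simp: a_def field_simps)
  \<comment> \<open>This makes the gap increase with s: its derivative compares (s + u cos
    \<theta>)^(n-1) <= (2 s)^(n-1) with 2^n C s^(n-1). Equality holds for n = 1; for n >= 2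
    Bernoulli's inequality suffices because pi^2 <= 16 <= 8 n.\<close>
  have C2: "1 / 2 \<le> C"
  proof -
    have "sin a \<le> a" using a by (intro sin_x_le_x) auto
    then have "(sin a)\<^sup>2 \<le> a\<^sup>2" using a pi_gt_zero by (intro power_mono sin_ge_zero) auto
    show ?thesis
    proof (cases "n = 1")
      case True
      then show ?thesis by (simp add: C_def a_def cos_45 power_divide)
    next
      case False
      have "real n * a\<^sup>2 \<le> 1 / 2"
      proof -
        have "pi \<le> 4" using pi_less_4 by simp
        then have "pi * pi \<le> 4 * 4" by (intro mult_mono) auto
        then have "pi * pi \<le> 8 * real n" using False n by simp
        then show ?thesis using n by (simp add: a_def power2_eq_square field_simps)
      qed
      then have "1 / 2 \<le> 1 + real n * (- (sin a)\<^sup>2)"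
        using mult_left_mono[OF \<open>(sin a)\<^sup>2 \<le> a\<^sup>2\<close>, of "real n"] by simp
      also have "\<dots> \<le> (1 + (- (sin a)\<^sup>2)) ^ n"
        by (rule Bernoulli_inequality) (simp add: abs_square_le_1)
      also have "1 + (- (sin a)\<^sup>2) = (cos a)\<^sup>2"
        by (simp add: cos_squared_eq)
      finally show ?thesis by (simp add: C_def power_mult)
    qed
  qed
  have base: "(1 + cos \<theta>) ^ n \<le> 2 ^ n * C + 2 ^ n * (B * cos (real n * \<theta>))"
  proof -
    have "\<bar>\<theta>\<bar> / 2 \<le> pi / 2" using Arg_bounded[of "z * w"] by (auto simp: \<theta>_def)
    then have "cos (\<bar>\<theta>\<bar> / 2) ^ (2 * n) \<le> C + B * cos (2 * real n * (\<bar>\<theta>\<bar> / 2))"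
      unfolding C_def B_def a_def by (intro cos_power_le_cos_multiple n) auto
    moreover have "1 + cos \<theta> = 2 * (cos (\<bar>\<theta>\<bar> / 2))\<^sup>2"
      using cos_double_cos[of "\<bar>\<theta>\<bar> / 2"] by simp
    moreover have "cos (2 * real n * (\<bar>\<theta>\<bar> / 2)) = cos (real n * \<theta>)"
      by (cases "0 \<le> \<theta>") auto
    ultimately show ?thesis
      by (simp add: power_mult power_mult_distrib distrib_left[symmetric])
  qed
  \<comment> \<open>For fixed \<open>u\<close> and \<open>\<theta>\<close> the gap is increasing in \<open>s \<ge> u\<close>, so \<open>s = u\<close>, i.e. \<open>|z| = |w|\<close>, is the worst case.\<close>
  define \<Delta> where "\<Delta> = (\<lambda>s. 2 ^ n * C * s ^ n - (s + u * cos \<theta>) ^ n)"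
  have "\<Delta> u \<le> \<Delta> s"
  proof (rule DERIV_nonneg_imp_nondecreasing[OF us])
    fix t assume t: "u \<le> t" "t \<le> s"
    obtain m where m: "n = Suc m" using n by (cases n) auto
    let ?d = "real n * (2 ^ n * C * t ^ m - (t + u * cos \<theta>) ^ m)"
    have "u * cos \<theta> \<le> u * 1" "u * (-1) \<le> u * cos \<theta>"
      using u by (intro mult_left_mono; simp)+
    then have "(t + u * cos \<theta>) ^ m \<le> (2 * t) ^ m"
      using t u by (intro power_mono) auto
    also have "\<dots> = 2 ^ n * (1 / 2) * t ^ m" by (simp add: m power_mult_distrib)
    also have "\<dots> \<le> 2 ^ n * C * t ^ m"
      using C2 t u by (intro mult_right_mono mult_left_mono) auto
    finally have "0 \<le> ?d" by simp
    moreover have "(\<Delta> has_real_derivative ?d) (at t)"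
      unfolding \<Delta>_def using m by (auto intro!: derivative_eq_intros simp: right_diff_distrib simp del: power_Suc)
    ultimately show "\<exists>d. (\<Delta> has_real_derivative d) (at t) \<and> 0 \<le> d" by blast
  qed
  moreover have "\<Delta> u = u ^ n * (2 ^ n * C - (1 + cos \<theta>) ^ n)"
    using power_mult_distrib[of u "1 + cos \<theta>" n] by (simp add: \<Delta>_def algebra_simps)
  moreover have "u ^ n * (- (2 ^ n * (B * cos (real n * \<theta>)))) \<le> u ^ n * (2 ^ n * C - (1 + cos \<theta>) ^ n)"
    using base u by (intro mult_left_mono) auto
  ultimately have "(s + u * cos \<theta>) ^ n \<le> 2 ^ n * C * s ^ n + 2 ^ n * B * (u ^ n * cos (real n * \<theta>))"
    by (simp add: \<Delta>_def algebra_simps)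
  also have "\<dots> = 2 ^ n * C * s ^ n + 4 ^ n * B * Re ((z * w) ^ n)"
    unfolding rhs[symmetric] by (simp add: power_mult_distrib[symmetric])
  finally show ?thesis unfolding lhs by (simp add: s_def C_def B_def)
qed

section \<open>Moments of the surface measure\<close>

lemma measurable_vec_lambda_lborel:
  "vec_lambda \<in> (\<Pi>\<^sub>M j\<in>(UNIV::'n::finite set). (lborel::'a measure)) \<rightarrow>\<^sub>M (borel :: ('a::euclidean_space ^ 'n) measure)"
proof (subst borel_measurable_euclidean_space, safe)
  fix b :: "'a ^ 'n"
  assume "b \<in> Basis"
  then obtain i c where b: "b = axis i c"
    by (auto simp: Basis_vec_def)
  have [measurable]: "(\<lambda>x. x i) \<in> (\<Pi>\<^sub>M j\<in>(UNIV :: 'n set). (lborel::'a measure)) \<rightarrow>\<^sub>M borel"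
    using measurable_component_singleton[of i UNIV "\<lambda>_. lborel::'a measure"]
    by simp
  show "(\<lambda>x. vec_lambda x \<bullet> b) \<in> borel_measurable (\<Pi>\<^sub>M j\<in>(UNIV :: 'n set). (lborel::'a measure))"
    by (simp add: b inner_axis)
qed

text \<open>Basis vectors are indexed by a coordinate and a basis vector of the factor, so volumes
  of boxes factor over the coordinates. This opens the way to Fubini on
  \<open>complex ^ 'n\<close>.\<close>

lemma lborel_vec_eq:
  "(lborel :: ('a::euclidean_space ^ 'n::finite) measure) =
    distr (\<Pi>\<^sub>M j\<in>UNIV. lborel) borel vec_lambda"
proof (rule lborel_eqI)
  interpret product_sigma_finite "\<lambda>_::'n. lborel :: 'a measure"
    by (simp add: product_sigma_finite_def lborel.sigma_finite_measure_axioms)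
  fix l u :: "'a ^ 'n"
  assume le: "\<And>b. b \<in> Basis \<Longrightarrow> l \<bullet> b \<le> u \<bullet> b"
  have le': "l $ i \<bullet> b \<le> u $ i \<bullet> b" if "b \<in> Basis" for i b
    using le[of "axis i b"] that by (auto simp: inner_axis Basis_vec_def)
  note m = measurable_vec_lambda_lborel
  have "vec_lambda -` box l u = (\<Pi>\<^sub>E j\<in>UNIV. box (l $ j) (u $ j))"
    by (auto simp: box_def Basis_vec_def inner_axis PiE_UNIV_domain)
  then have "emeasure (distr (\<Pi>\<^sub>M j\<in>UNIV. lborel) borel vec_lambda) (box l u)
    = (\<Prod>j\<in>UNIV. emeasure lborel (box (l $ j) (u $ j)))"
    by (subst emeasure_distr[OF m]) (simp_all add: space_PiM emeasure_PiM)
  also have "\<dots> = (\<Prod>j\<in>UNIV. ennreal (\<Prod>b\<in>Basis. (u $ j - l $ j) \<bullet> b))"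
    using le' by (intro prod.cong refl) (simp add: emeasure_lborel_box_eq)
  also have "\<dots> = ennreal (\<Prod>j\<in>UNIV. \<Prod>b\<in>Basis. (u $ j - l $ j) \<bullet> b)"
    using le' by (intro prod_ennreal prod_nonneg) (auto simp: inner_diff_left)
  also have "(\<Prod>j\<in>UNIV. \<Prod>b\<in>Basis. (u $ j - l $ j) \<bullet> b) = (\<Prod>b\<in>Basis. (u - l) \<bullet> b)"
  proof -
    have inj: "inj_on (\<lambda>(i, b). axis i b) (UNIV \<times> Basis :: ('n \<times> 'a) set)"
      by (auto simp: inj_on_def axis_eq_axis)
    have "Basis = (\<lambda>(i, b). axis i b) ` (UNIV \<times> Basis :: ('n \<times> 'a) set)"
      by (auto simp: Basis_vec_def)
    then have "(\<Prod>b\<in>Basis. (u - l) \<bullet> b) = (\<Prod>(i, b)\<in>UNIV \<times> Basis. (u - l) \<bullet> axis i b)"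
      using prod.reindex[OF inj, of "\<lambda>b. (u - l) \<bullet> b"] by (simp add: case_prod_unfold o_def)
    then show ?thesis by (simp add: prod.cartesian_product inner_axis)
  qed
  finally show "emeasure (distr (\<Pi>\<^sub>M j\<in>UNIV. lborel) borel vec_lambda) (box l u)
    = ennreal (\<Prod>b\<in>Basis. (u - l) \<bullet> b)" .
qed simp

text \<open>The plane is identified with \<open>real ^ 2\<close>, where orthogonal maps are known to
  preserve Lebesgue measure; the identification itself preserves boxes.\<close>

lemma distr_lborel_complex_rotation:
  fixes c :: complex
  assumes "norm c = 1"
  shows "distr lborel borel ((*) c) = lborel"
proof -
  define \<phi> where "\<phi> = (\<lambda>v::real^2. Complex (v $ 1) (v $ 2))"
  define \<psi> where "\<psi> = (\<lambda>z::complex. vector [Re z, Im z] :: real^2)"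
  have [simp]: "\<phi> (\<psi> z) = z" "\<psi> (\<phi> v) = v" for z v
    by (auto simp: \<phi>_def \<psi>_def vec_eq_iff forall_2)
  have lin: "linear \<phi>" "linear \<psi>"
    by (auto intro!: linearI simp: \<phi>_def \<psi>_def complex_eq_iff vec_eq_iff forall_2)
  have [measurable]: "\<phi> \<in> borel_measurable borel" "\<psi> \<in> borel_measurable borel"
    using lin by (auto intro!: borel_measurable_continuous_onI linear_continuous_on linear_conv_bounded_linear[THEN iffD1])
  have n\<phi>: "norm (\<phi> v) = norm v" for v
    by (simp add: \<phi>_def norm_vec_def L2_set_def cmod_def sum_2)
  have n\<psi>: "norm (\<psi> z) = norm z" for z
    by (metis n\<phi> \<open>\<And>z. \<phi> (\<psi> z) = z\<close>)
  have B: "Basis = {axis 1 1, axis 2 (1::real)} \<inter> (Basis :: (real^2) set)"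
    by (auto simp: Basis_vec_def) (metis exhaust_2)
  have lb: "lborel = distr lborel borel \<phi>"
  proof (rule lborel_eqI)
    fix l u :: complex
    assume le: "\<And>b. b \<in> Basis \<Longrightarrow> l \<bullet> b \<le> u \<bullet> b"
    have le': "Re l \<le> Re u" "Im l \<le> Im u"
      using le[of 1] le[of \<i>] by (auto simp: Basis_complex_def inner_complex_def)
    have "\<phi> -` box l u = box (\<psi> l) (\<psi> u)"
      by (auto simp: box_def \<phi>_def \<psi>_def Basis_complex_def inner_complex_def Basis_vec_def inner_axis forall_2)
    then show "emeasure (distr lborel borel \<phi>) (box l u) = ennreal (\<Prod>b\<in>Basis. (u - l) \<bullet> b)"
      using le' by (simp add: emeasure_distr emeasure_lborel_box_eq Basis_vec_def inner_axis \<psi>_def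
          Basis_complex_def inner_complex_def UNIV_2 axis_eq_axis forall_2)
  qed simp
  \<comment> \<open>\<open>T\<close> is the rotation in real coordinates and \<open>T'\<close> its
    inverse, given by the conjugate of \<open>c\<close>. The preimage of a box under
    \<open>T\<close> becomes an image under \<open>T'\<close>, to which the invariance for
    orthogonal images applies.\<close>
  define T where "T = (\<lambda>v. \<psi> (c * \<phi> v))"
  define T' where "T' = (\<lambda>v. \<psi> (cnj c * \<phi> v))"
  have cc: "c * cnj c = 1" using assms by (simp add: complex_norm_square[symmetric])
  have TT: "T (T' v) = v" "T' (T v) = v" for v
    using cc by (simp_all add: T_def T'_def mult.assoc[symmetric] mult.commute)
  have [measurable]: "T \<in> borel_measurable borel"
    unfolding T_def by measurable
  have "linear (\<lambda>v. cnj c * \<phi> v)"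
    using lin(1) by (auto intro!: linearI simp: linear_add linear_scale algebra_simps)
  then have linT': "linear T'"
    unfolding T'_def using linear_compose[OF _ lin(2)] by (auto simp: o_def)
  have orth: "orthogonal_transformation T'"
    unfolding orthogonal_transformation using linT' assms
    by (auto simp: T'_def n\<phi> n\<psi> norm_mult)
  have rot: "lborel = distr lborel borel T"
  proof (rule lborel_eqI)
    fix l u :: "real^2"
    assume le: "\<And>b. b \<in> Basis \<Longrightarrow> l \<bullet> b \<le> u \<bullet> b"
    have im: "T -` box l u = T' ` box l u"
      using TT by (auto simp: image_iff) metis
    have m: "T' ` box l u \<in> lmeasurable"
      by (intro measurable_orthogonal_image[OF orth] lmeasurable_box)
    have "T -` box l u \<in> sets borel"
      using measurable_sets[of T borel borel "box l u"] by simp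
    then have "emeasure lborel (T -` box l u) = emeasure lebesgue (T' ` box l u)"
      by (simp add: im)
    also have "\<dots> = measure lebesgue (T' ` box l u)"
      using m by (simp add: emeasure_eq_measure2)
    also have "\<dots> = measure lebesgue (box l u)"
      by (simp add: measure_orthogonal_image[OF orth])
    also have "\<dots> = (\<Prod>b\<in>Basis. (u - l) \<bullet> b)"
      using le by (simp add: measure_lborel_box_eq)
    finally show "emeasure (distr lborel borel T) (box l u) = ennreal (\<Prod>b\<in>Basis. (u - l) \<bullet> b)"
      by (simp add: emeasure_distr)
  qed simp
  have "distr lborel borel ((*) c) = distr (distr lborel borel \<phi>) borel ((*) c)"
    using lb by simp
  also have "\<dots> = distr lborel borel (\<lambda>v. c * \<phi> v)"
    by (subst distr_distr) (auto simp: o_def)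
  also have "\<dots> = distr lborel borel (\<lambda>v. \<phi> (T v))"
    by (simp add: T_def)
  also have "\<dots> = distr (distr lborel borel T) borel \<phi>"
    by (subst distr_distr) (auto simp: o_def)
  finally show ?thesis using lb rot by simp
qed

definition coord_mult :: "('n \<Rightarrow> complex) \<Rightarrow> complex ^ 'n \<Rightarrow> complex ^ 'n::finite" where
  "coord_mult c z = (\<chi> j. c j * z $ j)"

lemma coord_mult_nth [simp]: "coord_mult c z $ j = c j * z $ j"
  by (simp add: coord_mult_def)

lemma measurable_coord_mult [measurable]: "coord_mult c \<in> borel_measurable borel"
  unfolding coord_mult_def by (intro borel_measurable_continuous_onI continuous_intros)

lemma norm_coord_mult: "(\<And>j. norm (c j) = 1) \<Longrightarrow> norm (coord_mult c z) = norm z"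
  by (simp add: norm_vec_def norm_mult)

text \<open>The preimage of a box is a product of rotated planar boxes, each of unchanged
  area.\<close>

lemma distr_lborel_coord_mult:
  assumes c: "\<And>j. norm (c j) = 1"
  shows "distr lborel borel (coord_mult c) = (lborel :: (complex ^ 'n::finite) measure)"
proof (rule lborel_eqI[symmetric])
  interpret product_sigma_finite "\<lambda>_::'n. lborel :: complex measure"
    by (simp add: product_sigma_finite_def lborel.sigma_finite_measure_axioms)
  fix l u :: "complex ^ 'n"
  assume le: "\<And>b. b \<in> Basis \<Longrightarrow> l \<bullet> b \<le> u \<bullet> b"
  note m = measurable_vec_lambda_lborel
  have rot: "emeasure lborel ((*) (c j) -` A) = emeasure lborel A" if "A \<in> sets borel" for A j
    using that arg_cong[OF distr_lborel_complex_rotation[OF c[of j]], of "\<lambda>M. emeasure M A"]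
    by (simp add: emeasure_distr)
  have mr: "(*) (c j) -` A \<in> sets borel" if "A \<in> sets borel" for A j
    using measurable_sets[of "(*) (c j)" borel borel A] that by simp
  have vbox: "vec_lambda -` box l u = (\<Pi>\<^sub>E j\<in>UNIV. box (l $ j) (u $ j))" for l u :: "complex ^ 'n"
    by (auto simp: box_def Basis_vec_def inner_axis PiE_UNIV_domain)
  have vbox': "vec_lambda -` coord_mult c -` box l u = (\<Pi>\<^sub>E j\<in>UNIV. (*) (c j) -` box (l $ j) (u $ j))"
    by (auto simp: box_def Basis_vec_def inner_axis PiE_UNIV_domain)
  have "emeasure (distr lborel borel (coord_mult c)) (box l u) = emeasure lborel (coord_mult c -` box l u)"
    by (simp add: emeasure_distr)
  also have "\<dots> = emeasure (\<Pi>\<^sub>M j\<in>UNIV. lborel) (vec_lambda -` coord_mult c -` box l u)"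
    using measurable_sets[OF measurable_coord_mult, of "box l u"]
    by (subst lborel_vec_eq, subst emeasure_distr[OF m]) (simp_all add: space_PiM)
  also have "\<dots> = (\<Prod>j\<in>UNIV. emeasure lborel (box (l $ j) (u $ j)))"
    unfolding vbox' using mr rot by (simp add: emeasure_PiM)
  also have "\<dots> = emeasure (\<Pi>\<^sub>M j\<in>UNIV. lborel) (vec_lambda -` box l u)"
    unfolding vbox by (simp add: emeasure_PiM)
  also have "\<dots> = emeasure lborel (box l u)"
    by (subst lborel_vec_eq, subst emeasure_distr[OF m]) (simp_all add: space_PiM)
  finally show "emeasure (distr lborel borel (coord_mult c)) (box l u) = ennreal (\<Prod>b\<in>Basis. (u - l) \<bullet> b)"
    using le by (simp add: emeasure_lborel_box_eq)
qed simp

text \<open>The surface measure comes from the ball by \<open>sgn\<close>. Coordinate rotations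
  preserve the ball and its volume and commute with \<open>sgn\<close>.\<close>

lemma distr_sphere_measure_coord_mult:
  assumes c: "\<And>j. norm (c j) = 1"
  shows "distr sphere_measure borel (coord_mult c) = (sphere_measure :: (complex ^ 'n::finite) measure)"
proof (rule measure_eqI)
  fix A :: "(complex ^ 'n) set"
  assume "A \<in> sets (distr sphere_measure borel (coord_mult c))"
  then have A: "A \<in> sets borel" by simp
  let ?B = "ball 0 1 :: (complex ^ 'n) set"
  have sgn_c: "sgn (coord_mult c z) = coord_mult c (sgn z)" for z
    by (simp add: sgn_div_norm norm_coord_mult[OF c] vec_eq_iff)
  have m[measurable]: "(sgn :: complex ^ 'n \<Rightarrow> _) \<in> borel_measurable borel"
    by measurable
  have s: "sets (sphere_measure :: (complex ^ 'n) measure) = sets borel"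
    by (simp add: sphere_measure_def)
  have msgn: "sgn -` A \<in> sets borel" if "A \<in> sets borel" for A :: "(complex ^ 'n) set"
    using measurable_sets[OF m that] by simp
  have mc: "coord_mult c -` A \<in> sets borel" if "A \<in> sets borel" for A :: "(complex ^ 'n) set"
    using measurable_sets[OF measurable_coord_mult that] by simp
  have eq: "emeasure sphere_measure A = emeasure lborel (?B \<inter> sgn -` A) / emeasure lborel ?B"
    if "A \<in> sets borel" for A :: "(complex ^ 'n) set"
    unfolding sphere_measure_def using that msgn by (simp add: emeasure_distr)
  have "emeasure (distr sphere_measure borel (coord_mult c)) A = emeasure sphere_measure (coord_mult c -` A)"
    using A s by (simp add: emeasure_distr sphere_measure_def)
  also have "\<dots> = emeasure lborel (?B \<inter> sgn -` coord_mult c -` A) / emeasure lborel ?B"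
    using A mc by (intro eq)
  also have "?B \<inter> sgn -` coord_mult c -` A = coord_mult c -` (?B \<inter> sgn -` A)"
    by (auto simp: sgn_c norm_coord_mult[OF c])
  also have "emeasure lborel \<dots> = emeasure lborel (?B \<inter> sgn -` A)"
    using A msgn arg_cong[OF distr_lborel_coord_mult[OF c], of "\<lambda>M. emeasure M (?B \<inter> sgn -` A)"]
    by (simp add: emeasure_distr)
  finally show "emeasure (distr sphere_measure borel (coord_mult c)) A = emeasure sphere_measure A"
    using A by (simp add: eq)
qed (simp add: sphere_measure_def)

section \<open>Polar coordinates and Gaussian integrals\<close>

text \<open>Since \<open>q\<close> is homogeneous of degree 0, scaling shows that the ball of radius
  t carries t^N times the \<open>q\<close>-mass of the unit ball, where N is the real dimension.
  This determines the distribution of the norm under the measure with density \<open>q\<close>;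
  finiteness of the mass makes the determination unique.\<close>

lemma nn_integral_polar:
  fixes q :: "'a::euclidean_space \<Rightarrow> ennreal" and h :: "real \<Rightarrow> ennreal"
  assumes q[measurable]: "q \<in> borel_measurable borel" and h[measurable]: "h \<in> borel_measurable borel"
    and hom: "\<And>t x. 0 < t \<Longrightarrow> q (t *\<^sub>R x) = q x"
    and fin: "(\<integral>\<^sup>+x\<in>ball 0 1. q x \<partial>lborel) < \<infinity>"
  shows "(\<integral>\<^sup>+x. h (norm x) * q x \<partial>lborel) = (\<integral>\<^sup>+x\<in>ball 0 1. q x \<partial>lborel) *
    (\<integral>\<^sup>+t\<in>{0..}. h t * ennreal (DIM('a) * t ^ (DIM('a) - 1)) \<partial>lborel)"
proof -
  define K where "K = (\<integral>\<^sup>+x\<in>ball 0 1. q x \<partial>lborel)"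
  define N where "N = DIM('a)"
  have N: "0 < N" by (simp add: N_def)
  \<comment> \<open>\<open>M1\<close> is the actual distribution of the norm, \<open>M2\<close> the
    expected one with density K N t^(N-1). They are compared on open half-lines.\<close>
  define M1 where "M1 = distr (density lborel q) borel norm"
  define M2 where "M2 = density lborel (\<lambda>t. K * (ennreal (N * t ^ (N - 1)) * indicator {0..} t))"
  have [measurable]: "ball (0::'a) t \<in> sets borel" for t by simp
  have scale: "(\<integral>\<^sup>+x\<in>ball 0 t. q x \<partial>lborel) = ennreal (t ^ N) * K" if t: "0 < t" for t
  proof -
    have ind[measurable]: "(\<lambda>x. q x * indicator (ball 0 t) x) \<in> borel_measurable borel"
      by (intro borel_measurable_times_ennreal borel_measurable_indicator q) simp
    have "(\<integral>\<^sup>+x\<in>ball 0 t. q x \<partial>lborel) =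
      (\<integral>\<^sup>+x. q x * indicator (ball 0 t) x \<partial>density (distr lborel borel (\<lambda>x. 0 + t *\<^sub>R x)) (\<lambda>_. \<bar>t\<bar> ^ N))"
      using lborel_affine[of t "0::'a"] t by (simp add: N_def)
    also have "\<dots> = (\<integral>\<^sup>+x. ennreal (t ^ N) * (q x * indicator (ball 0 t) x) \<partial>distr lborel borel (\<lambda>x. 0 + t *\<^sub>R x))"
      using t ind by (subst nn_integral_density) auto
    also have "\<dots> = (\<integral>\<^sup>+x. ennreal (t ^ N) * (q (t *\<^sub>R x) * indicator (ball 0 t) (t *\<^sub>R x)) \<partial>lborel)"
      by (subst nn_integral_distr) auto
    also have "\<dots> = (\<integral>\<^sup>+x. ennreal (t ^ N) * (q x * indicator (ball 0 1) x) \<partial>lborel)"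
      using t by (intro nn_integral_cong) (auto simp: hom indicator_def)
    also have "\<dots> = ennreal (t ^ N) * K"
      unfolding K_def by (rule nn_integral_cmult) measurable
    finally show ?thesis .
  qed
  have M1: "emeasure M1 {..<a} = (if 0 < a then ennreal (a ^ N) * K else 0)" for a
  proof -
    have b: "norm -` {..<a} = ball (0::'a) a" by (auto simp: dist_norm)
    have "emeasure M1 {..<a} = (\<integral>\<^sup>+x. q x * indicator (ball 0 a) x \<partial>lborel)"
      unfolding M1_def by (subst emeasure_distr, simp, simp, subst emeasure_density) (simp_all add: b)
    then show ?thesis by (cases "0 < a") (simp_all add: scale ball_empty)
  qed
  have M2: "emeasure M2 {..<a} = (if 0 < a then ennreal (a ^ N) * K else 0)" for a
  proof -
    have "emeasure M2 {..<a} = (\<integral>\<^sup>+t. K * (ennreal (N * t ^ (N - 1)) * indicator {0..} t) * indicator {..<a} t \<partial>lborel)"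
      unfolding M2_def by (subst emeasure_density) simp_all
    also have "\<dots> = (\<integral>\<^sup>+t. K * (ennreal (N * t ^ (N - 1)) * indicator {0..a} t) \<partial>lborel)"
    proof (rule nn_integral_cong_AE)
      show "AE t in lborel. K * (ennreal (N * t ^ (N - 1)) * indicator {0..} t) * indicator {..<a} t =
          K * (ennreal (N * t ^ (N - 1)) * indicator {0..a} t)"
        using AE_lborel_singleton[of a] by eventually_elim (auto simp: indicator_def)
    qed
    also have "\<dots> = K * (\<integral>\<^sup>+t. ennreal (N * t ^ (N - 1)) * indicator {0..a} t \<partial>lborel)"
      by (rule nn_integral_cmult) measurable
    also have "(\<integral>\<^sup>+t. ennreal (N * t ^ (N - 1)) * indicator {0..a} t \<partial>lborel) = ennreal (if 0 < a then a ^ N else 0)"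
    proof (cases "0 < a")
      case True
      have "(\<integral>\<^sup>+t. ennreal (N * t ^ (N - 1)) * indicator {0..a} t \<partial>lborel) = ennreal (a ^ N - 0 ^ N)"
        using True by (intro nn_integral_FTC_Icc) (auto intro!: derivative_eq_intros)
      then show ?thesis using N True by simp
    next
      case False
      have "(\<integral>\<^sup>+t. ennreal (N * t ^ (N - 1)) * indicator {0..a} t \<partial>lborel) = (\<integral>\<^sup>+(t::real). 0 \<partial>lborel)"
      proof (rule nn_integral_cong_AE)
        show "AE t in lborel. ennreal (N * t ^ (N - 1)) * indicator {0..a} t = 0"
          using AE_lborel_singleton[of a] by eventually_elim (use False in \<open>auto simp: indicator_def\<close>)
      qed
      then show ?thesis using False by simp
    qed
    finally show ?thesis by (simp add: mult.commute)
  qed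
  \<comment> \<open>Half-lines are stable under intersection, generate the Borel sets and exhaust
    the line with finite mass.\<close>
  have "M1 = M2"
  proof (rule measure_eqI_generator_eq[where E = "range lessThan" and \<Omega> = UNIV and A = "\<lambda>i. {..<real i}"])
    show "Int_stable (range lessThan :: real set set)"
      unfolding Int_stable_def
    proof safe
      fix a b :: real
      have "{..<a} \<inter> {..<b} = {..<min a b}" by auto
      then show "{..<a} \<inter> {..<b} \<in> range lessThan" by blast
    qed
    show "sets M1 = sigma_sets UNIV (range lessThan)" "sets M2 = sigma_sets UNIV (range lessThan)"
      by (simp_all add: M1_def M2_def borel_Iio)
    show "(\<Union>i. {..<real i}) = UNIV" using reals_Archimedean2 by auto
    show "emeasure M1 {..<real i} \<noteq> \<infinity>" for i
      using fin by (auto simp: M1 K_def[symmetric] ennreal_mult_eq_top_iff)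
  qed (auto simp: M1 M2)
  have "(\<integral>\<^sup>+x. h (norm x) * q x \<partial>lborel) = (\<integral>\<^sup>+t. h t \<partial>M1)"
    unfolding M1_def by (simp add: nn_integral_distr nn_integral_density mult.commute)
  also have "\<dots> = (\<integral>\<^sup>+t. K * (h t * ennreal (N * t ^ (N - 1)) * indicator {0..} t) \<partial>lborel)"
    unfolding \<open>M1 = M2\<close> M2_def by (simp add: nn_integral_density mult_ac)
  also have "\<dots> = K * (\<integral>\<^sup>+t\<in>{0..}. h t * ennreal (N * t ^ (N - 1)) \<partial>lborel)"
    by (rule nn_integral_cmult) measurable
  finally show ?thesis by (simp add: K_def N_def)
qed

lemma nn_integral_gaussian_power:
  "(\<integral>\<^sup>+t\<in>{0..}. ennreal (exp (- t\<^sup>2) * t ^ (2 * k + 1)) \<partial>lborel) = ennreal (fact k / 2)"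
proof -
  have "(\<integral>\<^sup>+t\<in>{0..}. ennreal (exp (- t\<^sup>2) * t ^ (2 * k + 1)) \<partial>lborel) =
    (\<integral>\<^sup>+t. ennreal (indicator {0..} t *\<^sub>R (exp (- t\<^sup>2) * t ^ (2 * k + 1))) \<partial>lborel)"
    by (intro nn_integral_cong) (auto simp: indicator_def)
  also have "\<dots> = ennreal (fact k / 2)"
    using gaussian_moment_odd_pos[of k] unfolding has_bochner_integral_iff
    by (subst nn_integral_eq_integral) (auto simp: indicator_def)
  finally show ?thesis .
qed

text \<open>Polar coordinates in the plane with constant weight 1: the disc contributes pi and the
  radial density 2t leads to an odd Gaussian moment.\<close>

lemma nn_integral_gaussian_complex:
  "(\<integral>\<^sup>+(z::complex). ennreal (exp (- (norm z)\<^sup>2) * norm z ^ (2 * k)) \<partial>lborel) = ennreal (pi * fact k)"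
proof -
  have K: "(\<integral>\<^sup>+x\<in>ball 0 1. 1 \<partial>(lborel::complex measure)) = ennreal pi"
    by (simp add: emeasure_ball unit_ball_vol_2)
  have "(\<integral>\<^sup>+(z::complex). ennreal (exp (- (norm z)\<^sup>2) * norm z ^ (2 * k)) * 1 \<partial>lborel) =
    (\<integral>\<^sup>+x\<in>ball 0 1. 1 \<partial>(lborel::complex measure)) *
    (\<integral>\<^sup>+t\<in>{0..}. ennreal (exp (- t\<^sup>2) * t ^ (2 * k)) * ennreal (DIM(complex) * t ^ (DIM(complex) - 1)) \<partial>lborel)"
    using K by (intro nn_integral_polar) auto
  also have "(\<integral>\<^sup>+t\<in>{0..}. ennreal (exp (- t\<^sup>2) * t ^ (2 * k)) * ennreal (DIM(complex) * t ^ (DIM(complex) - 1)) \<partial>lborel)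
    = (\<integral>\<^sup>+t. 2 * (ennreal (exp (- t\<^sup>2) * t ^ (2 * k + 1)) * indicator {0..} t) \<partial>lborel)"
    by (intro nn_integral_cong) (auto simp: indicator_def ennreal_mult[symmetric] mult_ac simp flip: ennreal_numeral)
  also have "\<dots> = 2 * ennreal (fact k / 2)"
    unfolding nn_integral_gaussian_power[symmetric] by (rule nn_integral_cmult) measurable
  also have "(\<integral>\<^sup>+x\<in>ball 0 1. 1 \<partial>(lborel::complex measure)) * (2 * ennreal (fact k / 2)) = ennreal pi * (2 * ennreal (fact k / 2))"
    unfolding K ..
  also have "ennreal pi * (2 * ennreal (fact k / 2)) = ennreal (pi * fact k)"
    by (simp add: ennreal_mult[symmetric] flip: ennreal_numeral)
  finally show ?thesis by simp
qed


definition monomial :: "('n::finite \<Rightarrow> nat) \<Rightarrow> complex ^ 'n \<Rightarrow> complex" where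
  "monomial \<alpha> z = (\<Prod>j\<in>UNIV. z $ j ^ \<alpha> j)"

lemma continuous_on_monomial [continuous_intros]: "continuous_on A (monomial \<alpha>)"
  unfolding monomial_def by (intro continuous_intros)

lemma measurable_monomial [measurable]: "monomial \<alpha> \<in> borel_measurable borel"
  by (intro borel_measurable_continuous_onI continuous_intros)

lemma monomial_scaleR: "monomial \<alpha> (r *\<^sub>R z) = of_real (r ^ (\<Sum>j\<in>UNIV. \<alpha> j)) * monomial \<alpha> z"
proof -
  have "(r *\<^sub>R z) $ j = of_real r * z $ j" for j
    by (subst vector_scaleR_component) (rule scaleR_conv_of_real)
  then show ?thesis by (simp add: monomial_def power_mult_distrib prod.distrib power_sum)
qed

lemma monomial_sum: "monomial (\<lambda>j. \<Sum>i\<in>I. s i j) z = (\<Prod>i\<in>I. monomial (s i) z)"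
  by (simp add: monomial_def power_sum prod.swap[of _ I])

lemma monomial_zero [simp]: "monomial (\<lambda>_. 0) z = 1"
  by (simp add: monomial_def)

lemma norm_monomial_le_1: "norm z \<le> 1 \<Longrightarrow> norm (monomial \<alpha> z) \<le> 1"
  unfolding monomial_def prod_norm[symmetric] norm_power
  by (intro prod_le_1) (auto intro!: power_le_one order_trans[OF Finite_Cartesian_Product.norm_nth_le])

lemma nn_integral_gaussian_monomial:
  "(\<integral>\<^sup>+z. ennreal (exp (- (norm z)\<^sup>2) * (norm (monomial \<beta> z))\<^sup>2) \<partial>(lborel :: (complex ^ 'n::finite) measure))
    = ennreal (pi ^ CARD('n) * (\<Prod>j\<in>UNIV. fact (\<beta> j)))"
proof -
  interpret product_sigma_finite "\<lambda>_::'n. lborel :: complex measure"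
    by (simp add: product_sigma_finite_def lborel.sigma_finite_measure_axioms)
  have split: "exp (- (norm z)\<^sup>2) * (norm (monomial \<beta> z))\<^sup>2 =
    (\<Prod>j\<in>UNIV. exp (- (norm (z $ j))\<^sup>2) * norm (z $ j) ^ (2 * \<beta> j))" for z :: "complex ^ 'n"
  proof -
    have "(norm z)\<^sup>2 = (\<Sum>j\<in>UNIV. (norm (z $ j))\<^sup>2)"
      by (simp add: norm_vec_def L2_set_def sum_nonneg)
    then have "exp (- (norm z)\<^sup>2) = (\<Prod>j\<in>UNIV. exp (- (norm (z $ j))\<^sup>2))"
      by (simp add: sum_negf[symmetric] exp_sum)
    moreover have "(norm (monomial \<beta> z))\<^sup>2 = (\<Prod>j\<in>UNIV. norm (z $ j) ^ (2 * \<beta> j))"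
      unfolding monomial_def prod_norm[symmetric] norm_power prod_power_distrib
      by (simp add: power_mult[symmetric] mult.commute)
    ultimately show ?thesis by (simp add: prod.distrib)
  qed
  have "(\<integral>\<^sup>+z. ennreal (exp (- (norm z)\<^sup>2) * (norm (monomial \<beta> z))\<^sup>2) \<partial>(lborel :: (complex ^ 'n::finite) measure))
    = (\<integral>\<^sup>+x. (\<Prod>j\<in>UNIV. ennreal (exp (- (cmod (x j))\<^sup>2) * cmod (x j) ^ (2 * \<beta> j))) \<partial>(\<Pi>\<^sub>M j\<in>UNIV. lborel))"
  proof -
    have "(\<lambda>z::complex ^ 'n. \<Prod>j\<in>UNIV. exp (- (norm (z $ j))\<^sup>2) * norm (z $ j) ^ (2 * \<beta> j)) \<in> borel_measurable borel"
      by (intro borel_measurable_continuous_onI continuous_intros)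
    then show ?thesis
      unfolding split by (subst lborel_vec_eq, subst nn_integral_distr[OF measurable_vec_lambda_lborel])
        (simp_all add: prod_ennreal)
  qed
  also have "\<dots> = (\<Prod>j\<in>UNIV. \<integral>\<^sup>+(z::complex). ennreal (exp (- (norm z)\<^sup>2) * norm z ^ (2 * \<beta> j)) \<partial>lborel)"
    by (rule product_nn_integral_prod) auto
  also have "\<dots> = ennreal (\<Prod>j\<in>UNIV. pi * fact (\<beta> j))"
    by (simp add: nn_integral_gaussian_complex prod_ennreal)
  finally show ?thesis by (simp add: prod.distrib)
qed

text \<open>In polar coordinates the Gaussian integral of \<open>|z^\<beta>|^2\<close> factors into the spherical moment and a Gamma
  integral, while in Cartesian coordinates it is a product.\<close>

lemma nn_integral_ball_monomial_sgn:
  fixes \<beta> :: "'n::finite \<Rightarrow> nat"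
  shows "(\<integral>\<^sup>+x\<in>ball 0 1. ennreal ((norm (monomial \<beta> (sgn x)))\<^sup>2) \<partial>lborel)
    = ennreal (pi ^ CARD('n) * (\<Prod>j\<in>UNIV. fact (\<beta> j)) /
        (real CARD('n) * fact (CARD('n) - 1 + (\<Sum>j\<in>UNIV. \<beta> j))))"
proof -
  let ?n = "CARD('n)"
  define d where "d = (\<Sum>j\<in>UNIV. \<beta> j)"
  define q where "q = (\<lambda>x::complex ^ 'n. ennreal ((norm (monomial \<beta> (sgn x)))\<^sup>2))"
  define K where "K = (\<integral>\<^sup>+x\<in>ball 0 1. q x \<partial>lborel)"
  have n: "0 < ?n" by simp
  have "K \<le> (\<integral>\<^sup>+x. indicator (ball (0::complex ^ 'n) 1) x \<partial>lborel)"
    unfolding K_def q_def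
    by (intro nn_integral_mono) (auto simp: indicator_def power_le_one norm_monomial_le_1 norm_sgn)
  also have "\<dots> < \<infinity>"
    using emeasure_lborel_ball_finite[of "0::complex ^ 'n" 1] by simp
  finally have fin: "K < \<infinity>" .
  \<comment> \<open>Homogeneity of degree \<open>d\<close> splits off the radial factor; what
    remains is homogeneous of degree 0, as the polar formula requires.\<close>
  have mon: "(norm (monomial \<beta> x))\<^sup>2 = norm x ^ (2 * d) * (norm (monomial \<beta> (sgn x)))\<^sup>2" for x :: "complex ^ 'n"
  proof -
    have "x = norm x *\<^sub>R sgn x" by (cases "x = 0") (simp_all add: sgn_div_norm)
    then have "monomial \<beta> x = of_real (norm x ^ d) * monomial \<beta> (sgn x)"
      unfolding d_def using monomial_scaleR by metis
    then show ?thesis by (simp add: norm_mult power_mult_distrib norm_power power_mult[symmetric] mult.commute)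
  qed
  have "ennreal (pi ^ ?n * (\<Prod>j\<in>UNIV. fact (\<beta> j))) =
    (\<integral>\<^sup>+x. ennreal (exp (- (norm x)\<^sup>2) * norm x ^ (2 * d)) * q x \<partial>lborel)"
    unfolding nn_integral_gaussian_monomial[symmetric] q_def
    by (intro nn_integral_cong, subst mon) (simp add: ennreal_mult[symmetric] mult.assoc)
  also have "\<dots> = K * (\<integral>\<^sup>+t\<in>{0..}. ennreal (exp (- t\<^sup>2) * t ^ (2 * d)) *
      ennreal (DIM(complex ^ 'n) * t ^ (DIM(complex ^ 'n) - 1)) \<partial>lborel)"
    unfolding K_def
  proof (rule nn_integral_polar)
    show "q (t *\<^sub>R x) = q x" if "0 < t" for t x
      using that by (simp add: q_def sgn_scaleR)
  qed (use fin in \<open>simp_all add: q_def K_def\<close>)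
  \<comment> \<open>The real dimension is 2n, so the density 2n t^(2n-1) times t^(2d) has the odd
    exponent 2(n-1+d)+1, and the moment is (n-1+d)!/2.\<close>
  also have "(\<integral>\<^sup>+t\<in>{0..}. ennreal (exp (- t\<^sup>2) * t ^ (2 * d)) *
      ennreal (DIM(complex ^ 'n) * t ^ (DIM(complex ^ 'n) - 1)) \<partial>lborel) =
    (\<integral>\<^sup>+t. ennreal (2 * real ?n) * (ennreal (exp (- t\<^sup>2) * t ^ (2 * (?n - 1 + d) + 1)) * indicator {0..} t) \<partial>lborel)"
  proof (intro nn_integral_cong)
    fix t :: real
    obtain m where m: "?n = Suc m" using n by (metis Suc_pred)
    define c where "c = 2 * real (Suc m)"
    have c: "0 \<le> c" "2 * real ?n = c" "real DIM(complex ^ 'n) = c" "DIM(complex ^ 'n) - 1 = 2 * m + 1"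
      by (simp_all add: c_def m)
    show "ennreal (exp (- t\<^sup>2) * t ^ (2 * d)) * ennreal (DIM(complex ^ 'n) * t ^ (DIM(complex ^ 'n) - 1)) * indicator {0..} t
      = ennreal (2 * real ?n) * (ennreal (exp (- t\<^sup>2) * t ^ (2 * (?n - 1 + d) + 1)) * indicator {0..} t)"
      unfolding c using c(1) by (cases "0 \<le> t") (simp_all add: m ennreal_mult[symmetric] power_add mult_ac)
  qed
  also have "\<dots> = ennreal (2 * real ?n) * ennreal (fact (?n - 1 + d) / 2)"
    unfolding nn_integral_gaussian_power[symmetric] by (rule nn_integral_cmult) measurable
  also have "\<dots> = ennreal (real ?n * fact (?n - 1 + d))"
    by (simp add: ennreal_mult[symmetric])
  finally have eq: "ennreal (pi ^ ?n * (\<Prod>j\<in>UNIV. fact (\<beta> j))) = K * ennreal (real ?n * fact (?n - 1 + d))" .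
  obtain k where k: "K = ennreal k" "0 \<le> k"
    using fin by (cases K) auto
  have "pi ^ ?n * (\<Prod>j\<in>UNIV. fact (\<beta> j)) = k * (real ?n * fact (?n - 1 + d))"
    using eq k by (simp add: ennreal_mult[symmetric] prod_nonneg)
  then have "k = pi ^ ?n * (\<Prod>j\<in>UNIV. fact (\<beta> j)) / (real ?n * fact (?n - 1 + d))"
    using n by (simp add: field_simps)
  then show ?thesis using k by (simp add: K_def q_def d_def)
qed

section \<open>Integration over the sphere, moments and orthogonality of monomials\<close>

lemma nn_integral_sphere_measure:
  fixes F :: "'a::euclidean_space \<Rightarrow> ennreal"
  assumes [measurable]: "F \<in> borel_measurable borel"
  shows "(\<integral>\<^sup>+\<zeta>. F \<zeta> \<partial>sphere_measure) =
    (\<integral>\<^sup>+x\<in>ball 0 1. F (sgn x) \<partial>lborel) / emeasure lborel (ball (0::'a) 1)"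
  unfolding sphere_measure_def
  by (subst nn_integral_distr) (auto simp: nn_integral_uniform_measure)

lemma sets_sphere_measure [simp, measurable_cong]: "sets sphere_measure = sets borel"
  by (simp add: sphere_measure_def)

lemma space_sphere_measure [simp]: "space sphere_measure = UNIV"
  by (simp add: sphere_measure_def)

text \<open>The origin, a null set, is the only point that \<open>sgn\<close> does not send to the
  sphere.\<close>

lemma AE_sphere_measure: "AE \<zeta> in sphere_measure. \<zeta> \<in> sphere (0::'a::euclidean_space) 1"
proof -
  have "AE x in uniform_measure lborel (ball (0::'a) 1). sgn x \<in> sphere 0 1"
  proof (rule AE_uniform_measureI)
    show "AE x in lborel. x \<in> ball (0::'a) 1 \<longrightarrow> sgn x \<in> sphere 0 1"
      using AE_lborel_singleton[of "0::'a"] by eventually_elim (simp add: norm_sgn)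
  qed simp
  then show ?thesis
    unfolding sphere_measure_def by (subst AE_distr_iff) auto
qed

lemma integrable_sphere_measure:
  fixes F :: "'a::euclidean_space \<Rightarrow> 'b::{banach, second_countable_topology}"
  assumes "continuous_on UNIV F"
  shows "integrable sphere_measure F"
proof -
  interpret prob_space "sphere_measure :: 'a measure" by (rule prob_space_sphere_measure)
  have "compact (F ` sphere 0 1)"
    using assms by (intro compact_continuous_image compact_sphere) (auto intro: continuous_on_subset)
  then obtain B where "\<forall>x\<in>sphere 0 1. norm (F x) \<le> B"
    by (auto simp: bounded_iff dest!: compact_imp_bounded)
  moreover have "F \<in> borel_measurable borel"
    using assms by (rule borel_measurable_continuous_onI)
  ultimately show ?thesis
    by (intro integrable_const_bound[of _ B] eventually_mono[OF AE_sphere_measure]) auto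
qed

lemma integral_sphere_norm_monomial:
  fixes \<beta> :: "'n::finite \<Rightarrow> nat"
  shows "(\<integral>\<zeta>. (norm (monomial \<beta> \<zeta>))\<^sup>2 \<partial>sphere_measure) =
    fact (CARD('n) - 1) * (\<Prod>j\<in>UNIV. fact (\<beta> j)) / fact (CARD('n) - 1 + (\<Sum>j\<in>UNIV. \<beta> j))"
proof -
  let ?n = "CARD('n)"
  \<comment> \<open>The volume of the ball is the case \<beta> = 0 of the same formula.\<close>
  have vol: "emeasure lborel (ball (0::complex ^ 'n) 1) = ennreal (pi ^ ?n / (real ?n * fact (?n - 1)))"
    using nn_integral_ball_monomial_sgn[of "\<lambda>_::'n. 0"] by simp
  have "(\<integral>\<^sup>+\<zeta>. ennreal ((norm (monomial \<beta> \<zeta>))\<^sup>2) \<partial>sphere_measure) =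
    ennreal (pi ^ ?n * (\<Prod>j\<in>UNIV. fact (\<beta> j)) / (real ?n * fact (?n - 1 + (\<Sum>j\<in>UNIV. \<beta> j))))
      / ennreal (pi ^ ?n / (real ?n * fact (?n - 1)))"
    by (subst nn_integral_sphere_measure) (simp_all add: nn_integral_ball_monomial_sgn vol)
  also have "\<dots> = ennreal (fact (?n - 1) * (\<Prod>j\<in>UNIV. fact (\<beta> j)) / fact (?n - 1 + (\<Sum>j\<in>UNIV. \<beta> j)))"
    by (subst divide_ennreal) (auto simp: prod_nonneg field_simps)
  finally show ?thesis
    by (intro integral_eq_nn_integral[THEN trans]) (auto simp: prod_nonneg)
qed

text \<open>In a coordinate \<open>i\<close> with different exponents, rotation by pi / (\<alpha> i
  - \<beta> i) changes the sign of the integrand but preserves the measure.\<close>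

lemma integral_sphere_monomial_cnj_eq_0:
  fixes \<alpha> \<beta> :: "'n::finite \<Rightarrow> nat"
  assumes "\<alpha> \<noteq> \<beta>"
  shows "(\<integral>\<zeta>. monomial \<alpha> \<zeta> * cnj (monomial \<beta> \<zeta>) \<partial>sphere_measure) = 0"
proof -
  obtain i where i: "\<alpha> i \<noteq> \<beta> i" using assms by auto
  define \<theta> where "\<theta> = pi / (real (\<alpha> i) - real (\<beta> i))"
  define c where "c = (\<lambda>j. if j = i then cis \<theta> else 1)"
  have c: "norm (c j) = 1" for j by (simp add: c_def)
  have mc: "monomial \<gamma> (coord_mult c z) = cis \<theta> ^ \<gamma> i * monomial \<gamma> z" for \<gamma> z
  proof -
    have "(\<Prod>j\<in>UNIV. c j ^ \<gamma> j) = cis \<theta> ^ \<gamma> i"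
      by (simp add: c_def if_distrib[of "\<lambda>x. x ^ _"] cong: if_cong)
    then show ?thesis by (simp add: monomial_def power_mult_distrib prod.distrib)
  qed
  have "cis \<theta> ^ \<alpha> i * cnj (cis \<theta> ^ \<beta> i) = cis (real (\<alpha> i) * \<theta> - real (\<beta> i) * \<theta>)"
    by (simp add: Complex.DeMoivre cis_cnj cis_mult)
  also have "real (\<alpha> i) * \<theta> - real (\<beta> i) * \<theta> = pi"
  proof -
    have "real (\<alpha> i) * \<theta> - real (\<beta> i) * \<theta> = (real (\<alpha> i) - real (\<beta> i)) * \<theta>"
      by (simp add: algebra_simps)
    then show ?thesis using i by (simp add: \<theta>_def)
  qed
  finally have m1: "cis \<theta> ^ \<alpha> i * cnj (cis \<theta> ^ \<beta> i) = - 1" by simp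
  let ?F = "\<lambda>\<zeta>. monomial \<alpha> \<zeta> * cnj (monomial \<beta> \<zeta>)"
  have Fc: "?F (coord_mult c \<zeta>) = - ?F \<zeta>" for \<zeta>
  proof -
    have "?F (coord_mult c \<zeta>) = (cis \<theta> ^ \<alpha> i * cnj (cis \<theta> ^ \<beta> i)) * ?F \<zeta>"
      unfolding mc by (simp add: mult_ac)
    then show ?thesis unfolding m1 by simp
  qed
  have [measurable]: "?F \<in> borel_measurable borel"
    by (intro borel_measurable_continuous_onI continuous_intros)
  have "(\<integral>\<zeta>. ?F \<zeta> \<partial>sphere_measure) = (\<integral>\<zeta>. ?F \<zeta> \<partial>distr sphere_measure borel (coord_mult c))"
    by (simp add: distr_sphere_measure_coord_mult[OF c])
  also have "\<dots> = (\<integral>\<zeta>. ?F (coord_mult c \<zeta>) \<partial>sphere_measure)"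
    by (rule integral_distr) auto
  also have "\<dots> = - (\<integral>\<zeta>. ?F \<zeta> \<partial>sphere_measure)"
    unfolding Fc by simp
  finally show ?thesis by (simp add: equal_neg_zero)
qed

section \<open>Pluriharmonic polynomials on the sphere\<close>

text \<open>Reading a tuple coordinate by coordinate gives for each \<open>j\<close> a list of
  length \<open>m\<close> with sum \<open>\<beta> j\<close>, and these are counted by stars and
  bars. Only an upper bound results, as the multi-indices must lie in \<open>A\<close>.\<close>

lemma card_compositions_le:
  fixes A :: "('n::finite \<Rightarrow> nat) set"
  assumes "finite A"
  shows "card {t \<in> {..<m} \<rightarrow>\<^sub>E A. (\<lambda>j. \<Sum>i<m. t i j) = \<beta>} \<le> (\<Prod>j\<in>UNIV. (\<beta> j + m - 1) choose \<beta> j)"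
proof -
  let ?T = "{t \<in> {..<m} \<rightarrow>\<^sub>E A. (\<lambda>j. \<Sum>i<m. t i j) = \<beta>}"
  let ?L = "\<lambda>j. {l::nat list. length l = m \<and> sum_list l = \<beta> j}"
  let ?f = "\<lambda>t j. map (\<lambda>i. t i j) [0..<m]"
  have fin: "finite (?L j)" for j
  proof (rule finite_subset)
    show "?L j \<subseteq> {l. set l \<subseteq> {..\<beta> j} \<and> length l = m}"
      using member_le_sum_list by fastforce
  qed (rule finite_lists_length_eq, simp)
  have "card ?T \<le> card (Pi\<^sub>E UNIV ?L)"
  proof (rule card_inj_on_le[where f = ?f])
    show "inj_on ?f ?T"
    proof (rule inj_onI)
      fix s t assume st: "s \<in> ?T" "t \<in> ?T" and eq: "?f s = ?f t"
      have "s i j = t i j" if "i < m" for i j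
        using fun_cong[OF eq, of j] that by auto
      then show "s = t"
        using st by (intro PiE_ext[of s "{..<m}" "\<lambda>_. A"]) auto
    qed
    show "?f ` ?T \<subseteq> Pi\<^sub>E UNIV ?L"
      by (auto simp: sum_list_sum_nth lessThan_atLeast0)
    show "finite (Pi\<^sub>E UNIV ?L)"
      using fin by (intro finite_PiE) auto
  qed
  also have "card (Pi\<^sub>E UNIV ?L) = (\<Prod>j\<in>UNIV. card (?L j))"
    by (rule card_PiE) simp
  finally show ?thesis by (simp add: card_length_sum_list)
qed

text \<open>After division: a product of \<open>b\<close> consecutive integers grows when its
  starting point moves from m + 1 to m + s + 1.\<close>

lemma fact_mult_fact_le: "fact (b + m) * fact (m + s) \<le> (fact m * fact (m + b + s) :: real)"
proof (induction b)
  case (Suc b)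
  have "fact (Suc b + m) * fact (m + s) = real (Suc (b + m)) * (fact (b + m) * fact (m + s))"
    by simp
  also have "\<dots> \<le> real (Suc (m + b + s)) * (fact m * fact (m + b + s))"
    by (rule mult_mono[OF _ Suc]) auto
  finally show ?case by (simp add: algebra_simps)
qed simp

lemma prod_fact_div_le:
  assumes "finite J"
  shows "(\<Prod>j\<in>J. fact (b j + m) / fact m) \<le> (fact (m + (\<Sum>j\<in>J. b j)) / fact m :: real)"
  using assms
proof (induction J)
  case (insert i J)
  have "(\<Prod>j\<in>insert i J. fact (b j + m) / fact m) \<le>
      fact (b i + m) / fact m * (fact (m + (\<Sum>j\<in>J. b j)) / fact m :: real)"
    using insert mult_left_mono[OF insert.IH, of "fact (b i + m) / fact m"] by simp
  also have "\<dots> = (fact (b i + m) * fact (m + (\<Sum>j\<in>J. b j))) / (fact m * fact m)"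
    by simp
  also have "\<dots> \<le> (fact m * fact (m + b i + (\<Sum>j\<in>J. b j))) / (fact m * fact m)"
    by (intro divide_right_mono fact_mult_fact_le) simp
  finally show ?case using insert by (simp add: add.assoc)
qed simp

text \<open>With m = n - 1, the factorials \<beta>_j! of the moment cancel against the binomials of
  the count, leaving m! times the product of the (\<beta>_j + m)!/m!, divided by (m + |\<beta>|)!.
  This is at most 1 because the same m, dimension minus one and number of factors minus one, occurs
  in both.\<close>

lemma sphere_weight_mult_card_le_1:
  fixes A :: "('n::finite \<Rightarrow> nat) set"
  assumes "finite A"
  shows "(\<integral>\<zeta>. (norm (monomial \<beta> \<zeta>))\<^sup>2 \<partial>sphere_measure) *
    card {t \<in> {..<CARD('n)} \<rightarrow>\<^sub>E A. (\<lambda>j. \<Sum>i<CARD('n). t i j) = \<beta>} \<le> 1"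
proof -
  let ?n = "CARD('n)"
  define m where "m = ?n - 1"
  have n: "?n = Suc m" by (simp add: m_def)
  have ch: "fact (\<beta> j) * real ((\<beta> j + ?n - 1) choose \<beta> j) = fact (\<beta> j + m) / fact m" for j
    using binomial_fact[of "\<beta> j" "\<beta> j + m", where 'a = real] by (simp add: n)
  let ?c = "\<Prod>j\<in>UNIV. real ((\<beta> j + ?n - 1) choose \<beta> j)"
  have "(\<integral>\<zeta>. (norm (monomial \<beta> \<zeta>))\<^sup>2 \<partial>sphere_measure) *
    card {t \<in> {..<CARD('n)} \<rightarrow>\<^sub>E A. (\<lambda>j. \<Sum>i<CARD('n). t i j) = \<beta>}
    \<le> (\<integral>\<zeta>. (norm (monomial \<beta> \<zeta>))\<^sup>2 \<partial>sphere_measure) * ?c"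
    using card_compositions_le[OF assms, of ?n \<beta>]
    by (intro mult_left_mono) (simp_all flip: of_nat_prod)
  also have "\<dots> = fact m * (\<Prod>j\<in>UNIV. fact (\<beta> j) * real ((\<beta> j + ?n - 1) choose \<beta> j)) / fact (m + (\<Sum>j\<in>UNIV. \<beta> j))"
    by (simp add: integral_sphere_norm_monomial m_def prod.distrib)
  also have "\<dots> = fact m * (\<Prod>j\<in>UNIV. fact (\<beta> j + m) / fact m) / fact (m + (\<Sum>j\<in>UNIV. \<beta> j))"
    unfolding ch ..
  also have "\<dots> \<le> fact m * (fact (m + (\<Sum>j\<in>UNIV. \<beta> j)) / fact m) / fact (m + (\<Sum>j\<in>UNIV. \<beta> j))"
    by (intro divide_right_mono mult_left_mono prod_fact_div_le) auto
  finally show ?thesis by simp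
qed

lemma prod_polynomials:
  fixes c :: "nat \<Rightarrow> ('n::finite \<Rightarrow> nat) \<Rightarrow> complex"
  assumes "finite A"
  shows "(\<Prod>i<m. \<Sum>\<alpha>\<in>A. c i \<alpha> * monomial \<alpha> \<zeta>) =
    (\<Sum>s\<in>{..<m} \<rightarrow>\<^sub>E A. (\<Prod>i<m. c i (s i)) * monomial (\<lambda>j. \<Sum>i<m. s i j) \<zeta>)"
  by (simp add: prod_sum_PiE assms prod.distrib monomial_sum)

text \<open>The product is expanded over choice functions \<open>s\<close>. Orthogonality leaves
  only pairs with equal total exponent, so each |C s|^2 receives at most the moment times the number
  of choice functions with that exponent, which is at most 1. The sum of the |C s|^2 factors
  again.\<close>

lemma integral_sphere_norm_prod_le:
  fixes c :: "nat \<Rightarrow> ('n::finite \<Rightarrow> nat) \<Rightarrow> complex"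
  assumes "finite A"
  shows "(\<integral>\<zeta>. (norm (\<Prod>i<CARD('n). \<Sum>\<alpha>\<in>A. c i \<alpha> * monomial \<alpha> \<zeta>))\<^sup>2 \<partial>sphere_measure)
    \<le> (\<Prod>i<CARD('n). \<Sum>\<alpha>\<in>A. (norm (c i \<alpha>))\<^sup>2)"
proof -
  let ?n = "CARD('n)"
  define S where "S = ({..<?n} \<rightarrow>\<^sub>E A)"
  define C where "C = (\<lambda>s. \<Prod>i<?n. c i (s i))"
  define \<beta> where "\<beta> = (\<lambda>s (j::'n). \<Sum>i<?n. s i j :: nat)"
  define w where "w = (\<lambda>\<beta>. \<integral>\<zeta>. (norm (monomial \<beta> (\<zeta>::complex^'n)))\<^sup>2 \<partial>sphere_measure)"
  define P where "P = (\<lambda>\<zeta>::complex^'n. \<Sum>s\<in>S. C s * monomial (\<beta> s) \<zeta>)"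
  have finS: "finite S" unfolding S_def using assms by (intro finite_PiE) auto
  have P: "(\<Prod>i<?n. \<Sum>\<alpha>\<in>A. c i \<alpha> * monomial \<alpha> \<zeta>) = P \<zeta>" for \<zeta>
    unfolding P_def S_def C_def \<beta>_def by (rule prod_polynomials[OF assms])
  have w0: "0 \<le> w \<gamma>" for \<gamma> unfolding w_def by (intro integral_nonneg_AE) simp
  have int: "integrable sphere_measure (\<lambda>\<zeta>. monomial \<alpha> \<zeta> * cnj (monomial \<gamma> \<zeta>))" for \<alpha> \<gamma> :: "'n \<Rightarrow> nat"
    by (intro integrable_sphere_measure continuous_intros)
  have orth: "(\<integral>\<zeta>. monomial \<alpha> \<zeta> * cnj (monomial \<gamma> \<zeta>) \<partial>sphere_measure) = (if \<alpha> = \<gamma> then of_real (w \<alpha>) else 0)" for \<alpha> \<gamma>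
    by (simp add: integral_sphere_monomial_cnj_eq_0 w_def complex_norm_square[symmetric] flip: of_real_power)
  have "of_real (\<integral>\<zeta>. (norm (P \<zeta>))\<^sup>2 \<partial>sphere_measure) = (\<integral>\<zeta>. P \<zeta> * cnj (P \<zeta>) \<partial>sphere_measure)"
    by (simp add: complex_norm_square[symmetric] flip: of_real_power)
  also have "\<dots> = (\<integral>\<zeta>. (\<Sum>s\<in>S. \<Sum>t\<in>S. (C s * cnj (C t)) * (monomial (\<beta> s) \<zeta> * cnj (monomial (\<beta> t) \<zeta>))) \<partial>sphere_measure)"
    by (simp add: P_def sum_product mult_ac)
  also have "\<dots> = (\<Sum>s\<in>S. \<integral>\<zeta>. (\<Sum>t\<in>S. (C s * cnj (C t)) * (monomial (\<beta> s) \<zeta> * cnj (monomial (\<beta> t) \<zeta>))) \<partial>sphere_measure)"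
    by (intro Bochner_Integration.integral_sum Bochner_Integration.integrable_sum integrable_mult_right int)
  also have "\<dots> = (\<Sum>s\<in>S. \<Sum>t\<in>S. \<integral>\<zeta>. (C s * cnj (C t)) * (monomial (\<beta> s) \<zeta> * cnj (monomial (\<beta> t) \<zeta>)) \<partial>sphere_measure)"
    by (intro sum.cong refl Bochner_Integration.integral_sum integrable_mult_right int)
  also have "\<dots> = (\<Sum>s\<in>S. \<Sum>t\<in>S. (C s * cnj (C t)) * (if \<beta> s = \<beta> t then of_real (w (\<beta> s)) else 0))"
    by (simp only: integral_mult_right_zero orth)
  finally have e: "of_real (\<integral>\<zeta>. (norm (P \<zeta>))\<^sup>2 \<partial>sphere_measure) =
    (\<Sum>s\<in>S. \<Sum>t\<in>S. (C s * cnj (C t)) * (if \<beta> s = \<beta> t then of_real (w (\<beta> s)) else 0))" .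
  have "(\<integral>\<zeta>. (norm (P \<zeta>))\<^sup>2 \<partial>sphere_measure) \<le> norm (of_real (\<integral>\<zeta>. (norm (P \<zeta>))\<^sup>2 \<partial>sphere_measure) :: complex)"
    by simp
  also have "\<dots> \<le> (\<Sum>s\<in>S. \<Sum>t\<in>S. (norm (C s) * norm (C t)) * (if \<beta> s = \<beta> t then w (\<beta> s) else 0))"
    unfolding e using w0
    by (intro order_trans[OF norm_sum] sum_mono) (auto simp: norm_mult intro!: order_trans[OF norm_sum] sum_mono)
  \<comment> \<open>AM-GM instead of Cauchy-Schwarz avoids grouping the products by their exponent.\<close>
  also have "\<dots> \<le> (\<Sum>s\<in>S. \<Sum>t\<in>S. (((norm (C s))\<^sup>2 + (norm (C t))\<^sup>2) / 2) * (if \<beta> s = \<beta> t then w (\<beta> s) else 0))"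
  proof (intro sum_mono mult_right_mono)
    show "norm (C s) * norm (C t) \<le> ((norm (C s))\<^sup>2 + (norm (C t))\<^sup>2) / 2" for s t
      using sum_squares_bound[of "norm (C s)" "norm (C t)"] by simp
  qed (use w0 in auto)
  also have "\<dots> = ((\<Sum>s\<in>S. \<Sum>t\<in>S. (norm (C s))\<^sup>2 * (if \<beta> s = \<beta> t then w (\<beta> s) else 0))
      + (\<Sum>s\<in>S. \<Sum>t\<in>S. (norm (C t))\<^sup>2 * (if \<beta> s = \<beta> t then w (\<beta> s) else 0))) / 2"
    by (simp add: sum.distrib sum_divide_distrib add_divide_distrib distrib_right)
  also have "(\<Sum>s\<in>S. \<Sum>t\<in>S. (norm (C t))\<^sup>2 * (if \<beta> s = \<beta> t then w (\<beta> s) else 0))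
    = (\<Sum>s\<in>S. \<Sum>t\<in>S. (norm (C s))\<^sup>2 * (if \<beta> s = \<beta> t then w (\<beta> s) else 0))"
    by (subst sum.swap) (intro sum.cong, auto)
  also have "((\<Sum>s\<in>S. \<Sum>t\<in>S. (norm (C s))\<^sup>2 * (if \<beta> s = \<beta> t then w (\<beta> s) else 0))
      + (\<Sum>s\<in>S. \<Sum>t\<in>S. (norm (C s))\<^sup>2 * (if \<beta> s = \<beta> t then w (\<beta> s) else 0))) / 2
     = (\<Sum>s\<in>S. (norm (C s))\<^sup>2 * (w (\<beta> s) * card {t\<in>S. \<beta> t = \<beta> s}))"
  proof -
    have "(\<Sum>t\<in>S. (norm (C s))\<^sup>2 * (if \<beta> s = \<beta> t then w (\<beta> s) else 0)) = (norm (C s))\<^sup>2 * (w (\<beta> s) * card {t\<in>S. \<beta> t = \<beta> s})" for s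
      using finS by (simp add: sum_distrib_left[symmetric] sum.If_cases Int_def eq_commute[of "\<beta> s"] mult_ac)
    then show ?thesis by simp
  qed
  also have "\<dots> \<le> (\<Sum>s\<in>S. (norm (C s))\<^sup>2 * 1)"
    unfolding w_def S_def \<beta>_def
    by (intro sum_mono mult_left_mono sphere_weight_mult_card_le_1 assms) simp
  also have "\<dots> = (\<Prod>i<?n. \<Sum>\<alpha>\<in>A. (norm (c i \<alpha>))\<^sup>2)"
    unfolding S_def C_def by (simp add: prod_sum_PiE assms prod_power_distrib flip: prod_norm)
  finally show ?thesis unfolding P .
qed

text \<open>Presents mixed powers as products indexed by an initial segment, the form in which the
  expansion over choice functions applies.\<close>

lemma prod_lessThan_If:
  fixes x y :: "'a::comm_monoid_mult"
  assumes "k \<le> n"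
  shows "(\<Prod>i<n. if i < k then x else y) = x ^ k * y ^ (n - k)"
proof -
  have "{..<n} \<inter> {i. i < k} = {..<k}" "{..<n} \<inter> - {i. i < k} = {k..<n}"
    using assms by auto
  then show ?thesis by (simp add: prod.If_cases)
qed

text \<open>A nonconstant monomial is orthogonal to 1. A constant one arises only if every factor
  contributes its constant term, and that of the second polynomial is 0.\<close>

lemma integral_sphere_power_mult_eq_0:
  fixes a b :: "('n::finite \<Rightarrow> nat) \<Rightarrow> complex"
  assumes A: "finite A" and b0: "b (\<lambda>_. 0) = 0" and n: "0 < n"
  shows "(\<integral>\<zeta>. ((\<Sum>\<alpha>\<in>A. a \<alpha> * monomial \<alpha> \<zeta>) * (\<Sum>\<alpha>\<in>A. b \<alpha> * monomial \<alpha> \<zeta>)) ^ n \<partial>sphere_measure) = 0"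
proof -
  define c where "c = (\<lambda>i. if i < n then a else b)"
  define S where "S = ({..<2 * n} \<rightarrow>\<^sub>E A)"
  have finS: "finite S" unfolding S_def using A by (intro finite_PiE) auto
  have exp: "((\<Sum>\<alpha>\<in>A. a \<alpha> * monomial \<alpha> \<zeta>) * (\<Sum>\<alpha>\<in>A. b \<alpha> * monomial \<alpha> \<zeta>)) ^ n
    = (\<Sum>s\<in>S. (\<Prod>i<2*n. c i (s i)) * monomial (\<lambda>j. \<Sum>i<2*n. s i j) \<zeta>)" for \<zeta>
  proof -
    have "((\<Sum>\<alpha>\<in>A. a \<alpha> * monomial \<alpha> \<zeta>) * (\<Sum>\<alpha>\<in>A. b \<alpha> * monomial \<alpha> \<zeta>)) ^ n
      = (\<Prod>i<2*n. if i < n then (\<Sum>\<alpha>\<in>A. a \<alpha> * monomial \<alpha> \<zeta>) else (\<Sum>\<alpha>\<in>A. b \<alpha> * monomial \<alpha> \<zeta>))"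
      by (subst prod_lessThan_If) (auto simp: power_mult_distrib)
    also have "\<dots> = (\<Prod>i<2*n. \<Sum>\<alpha>\<in>A. c i \<alpha> * monomial \<alpha> \<zeta>)"
      by (intro prod.cong) (auto simp: c_def)
    finally show ?thesis by (simp add: prod_polynomials[OF A] S_def)
  qed
  have int: "integrable sphere_measure (monomial \<alpha>)" for \<alpha> :: "'n \<Rightarrow> nat"
    by (intro integrable_sphere_measure continuous_intros)
  have "(\<integral>\<zeta>. (\<Sum>s\<in>S. (\<Prod>i<2*n. c i (s i)) * monomial (\<lambda>j. \<Sum>i<2*n. s i j) \<zeta>) \<partial>sphere_measure)
    = (\<Sum>s\<in>S. (\<Prod>i<2*n. c i (s i)) * (\<integral>\<zeta>. monomial (\<lambda>j. \<Sum>i<2*n. s i j) \<zeta> \<partial>sphere_measure))"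
    by (subst Bochner_Integration.integral_sum) (auto intro!: integrable_mult_right int)
  also have "\<dots> = 0"
  proof (rule sum.neutral, safe)
    fix s assume "s \<in> S"
    show "(\<Prod>i<2*n. c i (s i)) * (\<integral>\<zeta>. monomial (\<lambda>j. \<Sum>i<2*n. s i j) \<zeta> \<partial>sphere_measure) = 0"
    proof (cases "(\<lambda>j. \<Sum>i<2*n. s i j) = (\<lambda>_. 0)")
      case True
      \<comment> \<open>Position \<open>n\<close> is the first of the 2n factors that is taken from
        \<open>b\<close>; it exists because n > 0.\<close>
      have "s n j = 0" for j
        using fun_cong[OF True, of j] n by auto
      then have "s n = (\<lambda>_. 0)" by blast
      then have "c n (s n) = 0" by (simp add: c_def b0)
      then have "(\<Prod>i<2*n. c i (s i)) = 0" using n by (intro prod_zero) auto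
      then show ?thesis by simp
    next
      case False
      then show ?thesis using integral_sphere_monomial_cnj_eq_0[OF False] by simp
    qed
  qed
  finally show ?thesis unfolding exp .
qed

lemma integral_sphere_pluriharmonic_polynomial_le:
  fixes a b :: "('n::finite \<Rightarrow> nat) \<Rightarrow> complex"
  assumes A: "finite A" and b0: "b (\<lambda>_. 0) = 0"
  defines "n \<equiv> CARD('n)"
  shows "(\<integral>\<zeta>. norm ((\<Sum>\<alpha>\<in>A. a \<alpha> * monomial \<alpha> \<zeta>) + cnj (\<Sum>\<alpha>\<in>A. b \<alpha> * monomial \<alpha> \<zeta>)) ^ (2 * n) \<partial>sphere_measure)
    \<le> 2 ^ n * cos (pi / (4 * real n)) ^ (2 * n) * ((\<Sum>\<alpha>\<in>A. (norm (a \<alpha>))\<^sup>2) + (\<Sum>\<alpha>\<in>A. (norm (b \<alpha>))\<^sup>2)) ^ n"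
proof -
  define g where "g = (\<lambda>\<zeta>. \<Sum>\<alpha>\<in>A. a \<alpha> * monomial \<alpha> \<zeta>)"
  define h where "h = (\<lambda>\<zeta>. \<Sum>\<alpha>\<in>A. b \<alpha> * monomial \<alpha> \<zeta>)"
  define C where "C = 2 ^ n * cos (pi / (4 * real n)) ^ (2 * n)"
  define B where "B = 4 ^ n * (cos (pi / (4 * real n)) ^ (2 * n - 1) * sin (pi / (4 * real n)))"
  have n: "1 \<le> n" "0 < n" by (simp_all add: n_def Suc_le_eq)
  have C0: "0 \<le> C" by (simp add: C_def)
  have cont [continuous_intros]: "continuous_on X g" "continuous_on X h" for X
    unfolding g_def h_def by (intro continuous_intros)+
  have int: "integrable sphere_measure (\<lambda>\<zeta>. (g \<zeta> * h \<zeta>) ^ n)" 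
    by (intro integrable_sphere_measure continuous_intros)
  have "(\<integral>\<zeta>. norm (g \<zeta> + cnj (h \<zeta>)) ^ (2 * n) \<partial>sphere_measure)
    \<le> (\<integral>\<zeta>. C * ((norm (g \<zeta>))\<^sup>2 + (norm (h \<zeta>))\<^sup>2) ^ n + B * Re ((g \<zeta> * h \<zeta>) ^ n) \<partial>sphere_measure)"
    unfolding C_def B_def using n
    by (intro integral_mono integrable_sphere_measure continuous_intros norm_add_cnj_power_le)
  also have "\<dots> = C * (\<integral>\<zeta>. ((norm (g \<zeta>))\<^sup>2 + (norm (h \<zeta>))\<^sup>2) ^ n \<partial>sphere_measure) + B * (\<integral>\<zeta>. Re ((g \<zeta> * h \<zeta>) ^ n) \<partial>sphere_measure)"
    by (subst Bochner_Integration.integral_add) (auto intro!: integrable_sphere_measure continuous_intros)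
  also have "(\<integral>\<zeta>. Re ((g \<zeta> * h \<zeta>) ^ n) \<partial>sphere_measure) = 0"
    using integral_Re[OF int] integral_sphere_power_mult_eq_0[where a = a and b = b and n = n, OF A b0 n(2)]
    by (simp add: g_def h_def)
  also have "(\<integral>\<zeta>. ((norm (g \<zeta>))\<^sup>2 + (norm (h \<zeta>))\<^sup>2) ^ n \<partial>sphere_measure)
    = (\<integral>\<zeta>. (\<Sum>k\<le>n. real (n choose k) * (norm (g \<zeta> ^ k * h \<zeta> ^ (n - k)))\<^sup>2) \<partial>sphere_measure)"
    by (simp add: binomial_ring norm_mult norm_power power_mult_distrib power_mult[symmetric] mult.commute[of 2] mult.assoc)
  also have "\<dots> = (\<Sum>k\<le>n. real (n choose k) * (\<integral>\<zeta>. (norm (g \<zeta> ^ k * h \<zeta> ^ (n - k)))\<^sup>2 \<partial>sphere_measure))"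
    by (subst Bochner_Integration.integral_sum) (auto intro!: integrable_sphere_measure continuous_intros)
  also have "\<dots> \<le> (\<Sum>k\<le>n. real (n choose k) * ((\<Sum>\<alpha>\<in>A. (norm (a \<alpha>))\<^sup>2) ^ k * (\<Sum>\<alpha>\<in>A. (norm (b \<alpha>))\<^sup>2) ^ (n - k)))"
  proof (intro sum_mono mult_left_mono)
    fix k assume k: "k \<in> {..n}"
    \<comment> \<open>The k-th binomial term consists of k copies of \<open>g\<close> and n - k
      copies of \<open>h\<close>, altogether as many factors as the dimension, which is what
      \<open>integral_sphere_norm_prod_le\<close> demands.\<close>
    define c where "c = (\<lambda>i. if i < k then a else b)"
    have "g \<zeta> ^ k * h \<zeta> ^ (n - k) = (\<Prod>i<n. \<Sum>\<alpha>\<in>A. c i \<alpha> * monomial \<alpha> \<zeta>)" for \<zeta>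
      using k by (subst prod_lessThan_If[symmetric]) (auto simp: c_def g_def h_def intro!: prod.cong)
    moreover have "(\<Sum>\<alpha>\<in>A. (norm (a \<alpha>))\<^sup>2) ^ k * (\<Sum>\<alpha>\<in>A. (norm (b \<alpha>))\<^sup>2) ^ (n - k) = (\<Prod>i<n. \<Sum>\<alpha>\<in>A. (norm (c i \<alpha>))\<^sup>2)"
      using k by (subst prod_lessThan_If[symmetric]) (auto simp: c_def intro!: prod.cong)
    ultimately show "(\<integral>\<zeta>. (norm (g \<zeta> ^ k * h \<zeta> ^ (n - k)))\<^sup>2 \<partial>sphere_measure)
      \<le> (\<Sum>\<alpha>\<in>A. (norm (a \<alpha>))\<^sup>2) ^ k * (\<Sum>\<alpha>\<in>A. (norm (b \<alpha>))\<^sup>2) ^ (n - k)"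
      using integral_sphere_norm_prod_le[OF A, of c] by (simp add: n_def)
  qed simp
  also have "\<dots> = ((\<Sum>\<alpha>\<in>A. (norm (a \<alpha>))\<^sup>2) + (\<Sum>\<alpha>\<in>A. (norm (b \<alpha>))\<^sup>2)) ^ n"
    by (simp add: binomial_ring mult.assoc)
  finally show ?thesis using C0 by (simp add: C_def g_def h_def mult_left_mono)
qed

section \<open>Means over the circle and the torus\<close>

text \<open>The gauge integral only sees values on the circle, so that no measurability off the circle is needed.\<close>

definition has_circle_mean :: "(complex \<Rightarrow> complex) \<Rightarrow> complex \<Rightarrow> bool" where
  "has_circle_mean F I \<longleftrightarrow> ((\<lambda>t. F (cis t)) has_integral (of_real (2 * pi) * I)) {0..2 * pi}"

lemma has_circle_mean_cong:
  "(\<And>y. norm y = 1 \<Longrightarrow> F y = G y) \<Longrightarrow> has_circle_mean F I \<longleftrightarrow> has_circle_mean G I"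
  unfolding has_circle_mean_def by (intro has_integral_cong) simp

lemma has_circle_mean_add:
  "has_circle_mean F I \<Longrightarrow> has_circle_mean G J \<Longrightarrow> has_circle_mean (\<lambda>y. F y + G y) (I + J)"
  unfolding has_circle_mean_def distrib_left by (rule has_integral_add)

lemma has_circle_mean_diff:
  "has_circle_mean F I \<Longrightarrow> has_circle_mean G J \<Longrightarrow> has_circle_mean (\<lambda>y. F y - G y) (I - J)"
  unfolding has_circle_mean_def right_diff_distrib by (rule has_integral_diff)

lemma has_circle_mean_cmult:
  "has_circle_mean F I \<Longrightarrow> has_circle_mean (\<lambda>y. c * F y) (c * I)"
  unfolding has_circle_mean_def mult.left_commute[of _ c] by (rule has_integral_mult_right)

lemma has_circle_mean_cnj:
  "has_circle_mean F I \<Longrightarrow> has_circle_mean (\<lambda>y. cnj (F y)) (cnj I)"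
  unfolding has_circle_mean_def
  by (drule has_integral_linear[OF _ bounded_linear_cnj]) (simp add: o_def)

lemma AE_circle_measure: "AE y in circle_measure. norm y = 1"
  unfolding circle_measure_def by (subst AE_distr_iff) auto

text \<open>Measurability and boundedness on the circle give Lebesgue integrability, and then the
  Lebesgue and gauge integrals agree.\<close>

lemma integral_circle_measure_eq:
  assumes F[measurable]: "F \<in> borel_measurable borel"
    and B: "\<And>y. norm y = 1 \<Longrightarrow> norm (F y) \<le> B"
    and I: "has_circle_mean F I"
  shows "integral\<^sup>L circle_measure F = I"
proof -
  let ?S = "{0..2 * pi}"
  have m[measurable]: "(\<lambda>t. F (cis t)) \<in> borel_measurable borel" by measurable
  have "integrable lborel (\<lambda>t. indicator ?S t *\<^sub>R F (cis t))"
  proof (rule Bochner_Integration.integrable_bound)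
    show "integrable lborel (\<lambda>t. indicator ?S t * B)"
      using pi_gt_zero by (intro integrable_mult_left integrable_real_indicator) auto
    show "AE t in lborel. norm (indicator ?S t *\<^sub>R F (cis t)) \<le> norm (indicator ?S t * B)"
      using B[OF norm_cis] by (intro AE_I2) (auto simp: indicator_def intro: order_trans[OF _ abs_ge_self])
  qed measurable
  then have "set_integrable lborel ?S (\<lambda>t. F (cis t))"
    by (simp add: set_integrable_def)
  from set_borel_integral_eq_integral(2)[OF this]
  have L: "(\<integral>t. indicator ?S t *\<^sub>R F (cis t) \<partial>lborel) = 2 * pi * I"
    using I by (simp add: has_circle_mean_def integral_unique set_lebesgue_integral_def)
  have em: "emeasure lborel ?S = ennreal (2 * pi)" by simp
  have "integral\<^sup>L circle_measure F = (\<integral>t. F (cis t) \<partial>uniform_measure lborel ?S)"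
    unfolding circle_measure_def by (rule integral_distr) auto
  also have "\<dots> = (\<integral>t. (indicator ?S t / (2 * pi)) *\<^sub>R F (cis t) \<partial>lborel)"
  proof -
    have "uniform_measure lborel ?S = density lborel (\<lambda>t. ennreal (indicator ?S t / (2 * pi)))"
      unfolding uniform_measure_def em
      by (intro density_cong) (auto simp: indicator_def divide_ennreal[symmetric])
    then show ?thesis by (simp add: integral_density)
  qed
  also have "\<dots> = (\<integral>t. complex_of_real (1 / (2 * pi)) * (indicator ?S t *\<^sub>R F (cis t)) \<partial>lborel)"
    by (intro Bochner_Integration.integral_cong) (auto simp: scaleR_conv_of_real)
  also have "\<dots> = I"
    unfolding integral_mult_right_zero L by simp
  finally show ?thesis .
qed

text \<open>Cauchy's formula on the circle of radius r: for u = r y one has du / (u - w) = i dt / (1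
  - (w/r) cnj y), because 1/y = cnj y.\<close>

lemma has_circle_mean_Cauchy:
  fixes r R :: real and w :: complex
  assumes H: "H holomorphic_on ball 0 R" and r: "0 < r" "r < R" and w: "norm w < r"
  shows "has_circle_mean (\<lambda>y. H (r * y) / (1 - w / r * cnj y)) (H w)"
proof -
  have "((\<lambda>u. H u / (u - w)) has_contour_integral (2 * of_real pi * \<i> * H w)) (circlepath 0 r)"
    by (rule Cauchy_integral_circlepath_simple) (use H r w in \<open>auto intro: holomorphic_on_subset\<close>)
  then have "((\<lambda>t. H (r * cis t) / (r * cis t - w) * r * \<i> * cis t) has_integral (2 * of_real pi * \<i> * H w)) {0..2 * pi}"
    unfolding circlepath_def by (subst (asm) has_contour_integral_part_circlepath_iff) auto
  from has_integral_mult_right[OF this, of "- \<i>"]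
  have "((\<lambda>t. H (r * cis t) * (r * cis t / (r * cis t - w))) has_integral (2 * of_real pi * H w)) {0..2 * pi}"
    by (simp add: mult_ac)
  moreover have "H (r * cis t) * (r * cis t / (r * cis t - w)) = H (r * cis t) / (1 - w / r * cnj (cis t))"
    if "t \<in> {0..2 * pi}" for t
  proof -
    have "norm (r * cis t) = r" using r by (simp add: norm_mult)
    then have nz: "r * cis t - w \<noteq> 0" using w by auto
    have "(1 - w / r * cnj (cis t)) * (r * cis t) = r * cis t - w"
      using r by (simp add: left_diff_distrib cis_cnj cis_mult)
    moreover have "1 - w / r * cnj (cis t) \<noteq> 0" using calculation nz by (metis mult_zero_left)
    moreover have "r * cis t \<noteq> 0" using r by simp
    ultimately show ?thesis using nz by (metis (no_types, lifting) divide_divide_eq_right nonzero_mult_div_cancel_right times_divide_eq_right)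
  qed
  ultimately have "((\<lambda>t. H (r * cis t) / (1 - w / r * cnj (cis t))) has_integral (2 * of_real pi * H w)) {0..2 * pi}"
    by (rule has_integral_eq[rotated])
  then show ?thesis by (simp add: has_circle_mean_def)
qed

lemma has_circle_mean_holomorphic:
  fixes r R :: real
  assumes "H holomorphic_on ball 0 R" "0 < r" "r < R"
  shows "has_circle_mean (\<lambda>y. H (r * y)) (H 0)"
  using has_circle_mean_Cauchy[OF assms, of 0] assms by simp

text \<open>The conjugate kernel is holomorphic in u = r y beyond the circle, so the mean value
  property applies to the whole product and only the value at 0 survives.\<close>

lemma has_circle_mean_antiholomorphic_kernel:
  fixes r R :: real and w :: complex
  assumes H: "H holomorphic_on ball 0 R" and r: "0 < r" "r < R" and w: "norm w < r"
  shows "has_circle_mean (\<lambda>y. H (r * y) / (1 - cnj (w / r) * y)) (H 0)"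
proof (cases "w = 0")
  case True
  then show ?thesis using has_circle_mean_holomorphic[OF H r] by simp
next
  case False
  \<comment> \<open>The pole of the kernel lies at distance r^2/|w| > r from the origin.\<close>
  define R' where "R' = min R (r * r / norm w)"
  have R': "r < R'" using r w False by (simp add: R'_def field_simps)
  define K where "K = (\<lambda>u. H u / (1 - cnj w / r^2 * u))"
  have "K holomorphic_on ball 0 R'"
    unfolding K_def
  proof (intro holomorphic_intros holomorphic_on_subset[OF H])
    show "ball (0::complex) R' \<subseteq> ball 0 R" by (auto simp: R'_def)
    fix u :: complex assume "u \<in> ball 0 R'"
    then have "norm u * norm w < r * r" using False by (simp add: R'_def field_simps)
    then have "norm (cnj w / r^2 * u) < 1"
      using r by (simp add: norm_mult norm_divide norm_power power2_eq_square field_simps)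
    then show "1 - cnj w / r^2 * u \<noteq> 0" by auto
  qed
  from has_circle_mean_holomorphic[OF this r(1) R'] show ?thesis
    using r by (simp add: K_def power2_eq_square)
qed

text \<open>For |y| = 1 this is the usual (1 - |x|^2) / |1 - x cnj y|^2. The form chosen separates
  the Cauchy kernel from its conjugate.\<close>

definition poisson_kernel :: "complex \<Rightarrow> complex \<Rightarrow> complex" where
  "poisson_kernel x y = 1 / (1 - x * cnj y) + 1 / (1 - cnj x * y) - 1"

lemma cnj_poisson_kernel [simp]: "cnj (poisson_kernel x y) = poisson_kernel x y"
  by (simp add: poisson_kernel_def add.commute)

text \<open>The three summands of the kernel contribute H(w), H(0) and -H(0).\<close>

lemma has_circle_mean_Poisson:
  fixes r R :: real and w :: complex
  assumes H: "H holomorphic_on ball 0 R" and r: "0 < r" "r < R" and w: "norm w < r"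
  shows "has_circle_mean (\<lambda>y. H (r * y) * poisson_kernel (w / r) y) (H w)"
proof -
  have "has_circle_mean (\<lambda>y. H (r * y) / (1 - w / r * cnj y) + H (r * y) / (1 - cnj (w / r) * y) - H (r * y)) (H w + H 0 - H 0)"
    by (intro has_circle_mean_diff has_circle_mean_add has_circle_mean_Cauchy[OF H r w]
        has_circle_mean_antiholomorphic_kernel[OF H r w] has_circle_mean_holomorphic[OF H r])
  then show ?thesis by (simp add: poisson_kernel_def algebra_simps)
qed

lemma has_circle_mean_power:
  fixes r R :: real
  assumes H: "H holomorphic_on ball 0 R" and r: "0 < r" "r < R"
  shows "has_circle_mean (\<lambda>y. H (r * y) * y ^ Suc q) 0"
proof -
  have "(\<lambda>u. H u * (u / r) ^ Suc q) holomorphic_on ball 0 R"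
    using r by (intro holomorphic_intros H) auto
  from has_circle_mean_holomorphic[OF this r] show ?thesis using r by simp
qed

text \<open>The function H(r e^(it)) e^(-i(q+1)t) is 2 pi-periodic, so its derivative has integral
  0.\<close>

lemma has_circle_mean_by_parts:
  fixes r R :: real
  assumes H: "H holomorphic_on ball 0 R" and r: "0 < r" "r < R"
  shows "has_circle_mean (\<lambda>y. H (r * y) * cnj y ^ Suc q - r / Suc q * (deriv H (r * y) * cnj y ^ q)) 0"
proof -
  define G where "G = (\<lambda>u. H (r * exp (\<i> * u)) * exp (- (Suc q * (\<i> * u))))"
  define G' where "G' = (\<lambda>u. r * exp (\<i> * u) * \<i> * deriv H (r * exp (\<i> * u)) * exp (- (Suc q * (\<i> * u)))
     + H (r * exp (\<i> * u)) * (- (Suc q * \<i>) * exp (- (Suc q * (\<i> * u)))))"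
  have G': "(G has_field_derivative G' (of_real t)) (at (of_real t))" for t :: real
  proof -
    have "r * exp (\<i> * t) \<in> ball 0 R" using r by (simp add: norm_mult)
    then have D: "(H has_field_derivative deriv H (r * exp (\<i> * t))) (at (r * exp (\<i> * t)))"
      using H by (intro holomorphic_derivI) auto
    have D2: "((\<lambda>u. r * exp (\<i> * u)) has_field_derivative (r * exp (\<i> * t) * \<i>)) (at (of_real t))"
      by (auto intro!: derivative_eq_intros)
    have D3: "((\<lambda>u. exp (- (Suc q * (\<i> * u)))) has_field_derivative (- (Suc q * \<i>) * exp (- (Suc q * (\<i> * t))))) (at (of_real t))"
      by (auto intro!: derivative_eq_intros)
    show ?thesis unfolding G_def G'_def
      using DERIV_mult[OF DERIV_chain2[OF D D2] D3] by (simp add: mult_ac add.commute)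
  qed
  have "((\<lambda>t. G' (of_real t)) has_integral (G (of_real (2 * pi)) - G (of_real 0))) {0..2 * pi}"
  proof (rule fundamental_theorem_of_calculus)
    fix t :: real
    show "((\<lambda>t. G (of_real t)) has_vector_derivative G' (of_real t)) (at t within {0..2 * pi})"
      using has_vector_derivative_real_field[OF G'] by (simp add: o_def has_vector_derivative_at_within)
  qed simp
  also have "G (of_real (2 * pi)) - G (of_real 0) = 0"
  proof -
    have "exp (\<i> * of_real (2 * pi)) = 1" by (metis cis_2pi cis_conv_exp)
    moreover have "exp (- (Suc q * (\<i> * of_real (2 * pi)))) = 1"
      using calculation by (metis exp_minus exp_of_nat_mult inverse_1 power_one)
    ultimately show ?thesis by (simp add: G_def)
  qed
  \<comment> \<open>The factor cancels the -i(q+1) produced by differentiating the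
    exponential.\<close>
  finally have "((\<lambda>t. (\<i> / Suc q) * G' (of_real t)) has_integral (\<i> / Suc q) * 0) {0..2 * pi}"
    by (rule has_integral_mult_right)
  moreover have "(\<i> / Suc q) * G' (of_real t) = H (r * cis t) * cnj (cis t) ^ Suc q - r / Suc q * (deriv H (r * cis t) * cnj (cis t) ^ q)" for t :: real
  proof -
    have e1: "exp (\<i> * of_real t) = cis t" by (simp add: cis_conv_exp)
    have e2: "exp (- (of_nat m * (\<i> * of_real t))) = cnj (cis t) ^ m" for m
      using exp_of_nat_mult[of m "- (\<i> * of_real t)"] by (simp add: cis_conv_exp exp_cnj)
    have e3: "cis t * cnj (cis t) = 1" by (simp add: cis_cnj cis_mult)
    have "(\<i> / Suc q) * G' (of_real t) = (\<i> / Suc q) * (r * cis t * \<i> * deriv H (r * cis t) * (cnj (cis t) * cnj (cis t) ^ q)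
     - H (r * cis t) * (Suc q * \<i>) * cnj (cis t) ^ Suc q)"
      unfolding G'_def e1 e2 by (simp add: algebra_simps)
    also have "\<dots> = (\<i> * \<i> / Suc q) * (r * (cis t * cnj (cis t)) * deriv H (r * cis t) * cnj (cis t) ^ q)
     - (\<i> * \<i>) * H (r * cis t) * cnj (cis t) ^ Suc q"
      by (simp add: field_simps del: i_squared complex_i_mult_minus of_nat_Suc)
    also have "\<dots> = H (r * cis t) * cnj (cis t) ^ Suc q - r / Suc q * (deriv H (r * cis t) * cnj (cis t) ^ q)"
      unfolding e3 by simp
    finally show ?thesis .
  qed
  ultimately show ?thesis by (simp add: has_circle_mean_def del: of_nat_Suc)
qed

definition vec_upd :: "complex ^ 'n \<Rightarrow> 'n \<Rightarrow> complex \<Rightarrow> complex ^ 'n::finite" where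
  "vec_upd z i y = (\<chi> j. if j = i then y else z $ j)"

lemma vec_upd_nth: "vec_upd z i y $ j = (if j = i then y else z $ j)"
  by (simp add: vec_upd_def)

lemma vec_upd_nth_simps [simp]:
  "vec_upd z i y $ i = y" "j \<noteq> i \<Longrightarrow> vec_upd z i y $ j = z $ j"
  by (simp_all add: vec_upd_nth)

lemma vec_upd_triv [simp]: "vec_upd z i (z $ i) = z"
  by (simp add: vec_eq_iff vec_upd_nth)

lemma vec_upd_in_torus: "\<omega> \<in> unit_torus \<Longrightarrow> norm y = 1 \<Longrightarrow> vec_upd \<omega> i y \<in> unit_torus"
  by (auto simp: unit_torus_def vec_upd_nth)

lemma vec_upd_in_polydisc: "z \<in> unit_polydisc \<Longrightarrow> norm y < 1 \<Longrightarrow> vec_upd z i y \<in> unit_polydisc"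
  by (auto simp: unit_polydisc_def vec_upd_nth)

lemma measurable_vec_upd [measurable]: "vec_upd z i \<in> borel_measurable borel"
proof (rule borel_measurable_continuous_onI)
  have "continuous_on UNIV (\<lambda>y. if j = i then y else z $ j)" for j
    by (cases "j = i") (auto intro: continuous_intros)
  then show "continuous_on UNIV (vec_upd z i)"
    unfolding vec_upd_def by (intro continuous_on_vec_lambda)
qed

lemma sets_torus_measure [simp, measurable_cong]: "sets torus_measure = sets borel"
  by (simp add: torus_measure_def)

lemma space_torus_measure [simp]: "space torus_measure = UNIV"
  by (simp add: torus_measure_def)

lemma space_circle_measure [simp]: "space circle_measure = UNIV"
  by (simp add: circle_measure_def)

lemma integrable_torus_measure:
  fixes F :: "complex ^ 'n::finite \<Rightarrow> 'b::{banach, second_countable_topology}"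
  assumes F: "F \<in> borel_measurable borel" and B: "\<And>\<omega>. \<omega> \<in> unit_torus \<Longrightarrow> norm (F \<omega>) \<le> B"
  shows "integrable torus_measure F"
proof -
  interpret prob_space "torus_measure :: (complex ^ 'n) measure" by (rule prob_space_torus_measure)
  show ?thesis
    using F B by (intro integrable_const_bound[of _ B] eventually_mono[OF AE_torus_measure]) auto
qed

text \<open>Fubini with coordinate \<open>i\<close> integrated innermost. Bound and means are asked
  for only at points of the torus, which carries the measure.\<close>

lemma integral_torus_eq_0I:
  fixes F :: "complex ^ 'n::finite \<Rightarrow> complex"
  assumes F[measurable]: "F \<in> borel_measurable borel" and B: "\<And>\<omega>. \<omega> \<in> unit_torus \<Longrightarrow> norm (F \<omega>) \<le> B"
    and mean: "\<And>\<omega>. \<omega> \<in> unit_torus \<Longrightarrow> has_circle_mean (\<lambda>y. F (vec_upd \<omega> i y)) 0"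
  shows "(\<integral>\<omega>. F \<omega> \<partial>torus_measure) = 0"
proof -
  interpret product_sigma_finite "\<lambda>_::'n. circle_measure"
    by (simp add: product_sigma_finite_def prob_space_circle_measure prob_space_imp_sigma_finite)
  interpret P: product_prob_space "\<lambda>_. circle_measure" "UNIV - {i}"
    by (simp add: product_prob_space_def product_sigma_finite_def product_prob_space_axioms_def
        prob_space_circle_measure prob_space_imp_sigma_finite)
  interpret C: prob_space circle_measure by (rule prob_space_circle_measure)
  note m = measurable_vec_lambda_circle[where 'n = 'n]
  have U: "(UNIV :: 'n set) = insert i (UNIV - {i})" by auto
  let ?P = "\<Pi>\<^sub>M j\<in>UNIV - {i}. circle_measure"
  have int: "integrable (\<Pi>\<^sub>M j\<in>UNIV. circle_measure) (\<lambda>x. F (vec_lambda x))"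
  proof -
    have "integrable torus_measure F" by (rule integrable_torus_measure[OF F]) (rule B)
    then show ?thesis unfolding torus_measure_def by (subst (asm) integrable_distr_eq[OF m]) auto
  qed
  have "(\<integral>\<omega>. F \<omega> \<partial>torus_measure) = (\<integral>x. F (vec_lambda x) \<partial>(\<Pi>\<^sub>M j\<in>UNIV. circle_measure))"
    unfolding torus_measure_def by (rule integral_distr[OF m]) simp
  also have "\<dots> = (\<integral>x. F (vec_lambda x) \<partial>(\<Pi>\<^sub>M j\<in>insert i (UNIV - {i}). circle_measure))"
    using U by simp
  also have "\<dots> = (\<integral>x. (\<integral>y. F (vec_lambda (x(i := y))) \<partial>circle_measure) \<partial>?P)"
    using int U by (intro product_integral_insert) auto
  also have "\<dots> = 0"
  proof (rule integral_eq_zero_AE)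
    have "AE x in ?P. \<forall>j\<in>UNIV - {i}. norm (x j) = 1"
      by (intro AE_finite_allI P.AE_component AE_circle_measure) auto
    then show "AE x in ?P. (\<integral>y. F (vec_lambda (x(i := y))) \<partial>circle_measure) = 0"
    proof eventually_elim
      case (elim x)
      \<comment> \<open>Coordinate \<open>i\<close> is about to be overwritten by \<open>y\<close>;
        the value 1 merely puts \<omega> on the torus.\<close>
      define \<omega> where "\<omega> = vec_lambda (x(i := 1))"
      have \<omega>: "\<omega> \<in> unit_torus" using elim by (auto simp: \<omega>_def unit_torus_def)
      have eq: "vec_lambda (x(i := y)) = vec_upd \<omega> i y" for y
        by (simp add: vec_eq_iff \<omega>_def vec_upd_nth)
      show ?case
        unfolding eq using mean[OF \<omega>]
        by (intro integral_circle_measure_eq[where B = B]) (auto intro!: B vec_upd_in_torus \<omega>)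
    qed
  qed
  finally show ?thesis .
qed

lemma has_derivative_vec_upd:
  fixes z :: "complex ^ 'n::finite"
  shows "(vec_upd z i has_derivative axis i) (at y)"
proof -
  have "bounded_linear (axis i :: complex \<Rightarrow> complex ^ 'n)"
    by (intro linear_conv_bounded_linear[THEN iffD1] linearI) (auto simp: vec_eq_iff axis_def)
  then have "((\<lambda>y. axis i y + vec_upd z i 0) has_derivative axis i) (at y)"
    using bounded_linear_imp_has_derivative by (auto intro!: derivative_eq_intros)
  also have "(\<lambda>y. axis i y + vec_upd z i 0) = vec_upd z i"
    by (auto simp: fun_eq_iff vec_eq_iff axis_def vec_upd_nth)
  finally show ?thesis .
qed

section \<open>One-dimensional slices of pluriharmonic functions\<close>

text \<open>The Cauchy-Riemann criterion: the condition at \<open>\<i>\<close> makes the real-linear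
  derivative complex-linear.\<close>

lemma complex_linear_has_field_derivative:
  fixes f :: "complex \<Rightarrow> complex"
  assumes "(f has_derivative f') (at x)" "f' \<i> = \<i> * f' 1"
  shows "(f has_field_derivative f' 1) (at x)"
proof -
  have lin: "linear f'" using assms(1) has_derivative_linear by blast
  have "f' h = f' 1 * h" for h
  proof -
    have "f' h = f' (Re h *\<^sub>R 1 + Im h *\<^sub>R \<i>)"
      by (metis complex_eq mult.commute mult.right_neutral scaleR_conv_of_real)
    also have "\<dots> = Re h *\<^sub>R f' 1 + Im h *\<^sub>R f' \<i>"
      using lin by (simp add: linear_add linear_scale)
    also have "\<dots> = f' 1 * (Re h + \<i> * Im h)"
      by (simp add: assms(2) scaleR_conv_of_real algebra_simps)
    also have "Re h + \<i> * Im h = h" by (rule complex_eq[symmetric])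
    finally show ?thesis .
  qed
  then have "f' = (*) (f' 1)" by (rule ext)
  then show ?thesis unfolding has_field_derivative_def using assms(1) by metis
qed

lemma open_unit_polydisc: "open (unit_polydisc :: (complex ^ 'n::finite) set)"
proof -
  have "unit_polydisc = (\<Inter>j. (\<lambda>z::complex ^ 'n. z $ j) -` ball 0 1)"
    by (auto simp: unit_polydisc_def)
  moreover have "open (\<Inter>j. (\<lambda>z::complex ^ 'n. z $ j) -` ball 0 1)"
  proof (intro open_INT ballI)
    show "open ((\<lambda>z::complex ^ 'n. z $ j) -` ball 0 1)" for j
      by (intro open_vimage open_ball continuous_on_component continuous_on_id)
  qed simp
  ultimately show ?thesis by simp
qed

text \<open>Uniqueness of derivatives identifies \<open>frechet_derivative\<close> with the witness
  of \<open>C2_on\<close> on the polydisc. There \<open>wirtinger_dbar\<close> is a fixed linear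
  expression in a differentiable map, and openness transfers its differentiability.\<close>

lemma pluriharmonic_polydisc_derivatives:
  fixes f :: "complex ^ 'n::finite \<Rightarrow> complex"
  assumes "pluriharmonic_on unit_polydisc f"
  shows "z \<in> unit_polydisc \<Longrightarrow> (f has_derivative frechet_derivative f (at z)) (at z)"
    and "z \<in> unit_polydisc \<Longrightarrow> wirtinger_dbar k f differentiable (at z)"
    and "continuous_on unit_polydisc f" "continuous_on unit_polydisc (wirtinger_dbar k f)"
proof -
  obtain f' :: "complex ^ 'n \<Rightarrow> (complex ^ 'n) \<Rightarrow>\<^sub>L complex"
    and f'' :: "complex ^ 'n \<Rightarrow> (complex ^ 'n) \<Rightarrow>\<^sub>L ((complex ^ 'n) \<Rightarrow>\<^sub>L complex)"
    where f': "\<And>x. x \<in> unit_polydisc \<Longrightarrow> (f has_derivative blinfun_apply (f' x)) (at x)"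
      and f'': "\<And>x. x \<in> unit_polydisc \<Longrightarrow> (f' has_derivative blinfun_apply (f'' x)) (at x)"
    using assms unfolding pluriharmonic_on_def C2_on_def by blast
  have w: "wirtinger_dbar k f z = (f' z (axis k 1) + \<i> * f' z (axis k \<i>)) / 2" if "z \<in> unit_polydisc" for z
    using frechet_derivative_at[OF f'[OF that]] by (simp add: wirtinger_dbar_def)
  have d: "wirtinger_dbar k f differentiable (at z)" if z: "z \<in> unit_polydisc" for z
  proof -
    have *: "((\<lambda>z. f' z v) has_derivative (\<lambda>h. f'' z h v)) (at z)" for v
      using bounded_linear.has_derivative[OF blinfun.bounded_linear_left f''[OF z]] .
    let ?D = "\<lambda>h. (f'' z h (axis k 1) + \<i> * f'' z h (axis k \<i>)) / 2"
    have "((\<lambda>z. (f' z (axis k 1) + \<i> * f' z (axis k \<i>)) / 2) has_derivative ?D) (at z)"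
      using bounded_linear.has_derivative[OF bounded_linear_divide
          has_derivative_add[OF * bounded_linear.has_derivative[OF bounded_linear_mult_right *]]] .
    then have "(wirtinger_dbar k f has_derivative ?D) (at z)"
      by (rule has_derivative_transform_within_open[OF _ open_unit_polydisc z]) (simp add: w)
    then show ?thesis by (rule differentiableI)
  qed
  show "(f has_derivative frechet_derivative f (at z)) (at z)" if "z \<in> unit_polydisc"
    using f'[OF that] frechet_derivative_at[OF f'[OF that]] by simp
  show "wirtinger_dbar k f differentiable (at z)" if "z \<in> unit_polydisc"
    using d that .
  show "continuous_on unit_polydisc f"
    using f' by (intro has_derivative_continuous_on[where f' = "\<lambda>x. blinfun_apply (f' x)"]) (auto intro: has_derivative_at_withinI)
  show "continuous_on unit_polydisc (wirtinger_dbar k f)"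
    using d by (auto simp: continuous_on_eq_continuous_at[OF open_unit_polydisc] intro: differentiable_imp_continuous_within)
qed

text \<open>The vanishing mixed derivative for \<open>i\<close> and \<open>k\<close> is the
  Cauchy-Riemann equation in the variable \<open>i\<close> for the conjugate of
  \<open>wirtinger_dbar k f\<close>.\<close>

lemma wirtinger_dbar_slice:
  fixes f :: "complex ^ 'n::finite \<Rightarrow> complex"
  assumes f: "pluriharmonic_on unit_polydisc f" and z: "z \<in> unit_polydisc"
  shows "\<exists>L. L holomorphic_on ball 0 1 \<and>
    (\<forall>y. norm y < 1 \<longrightarrow> wirtinger_dbar k f (vec_upd z i y) = cnj (L y))"
proof -
  note d = pluriharmonic_polydisc_derivatives(2)[OF f]
  define L where "L = (\<lambda>y. cnj (wirtinger_dbar k f (vec_upd z i y)))"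
  have "L field_differentiable at y" if y: "norm y < 1" for y
  proof -
    let ?x = "vec_upd z i y"
    have x: "?x \<in> unit_polydisc" using vec_upd_in_polydisc[OF z y] .
    define D where "D = frechet_derivative (wirtinger_dbar k f) (at ?x)"
    have D: "(wirtinger_dbar k f has_derivative D) (at ?x)"
      using d[OF x] by (simp add: D_def frechet_derivative_works)
    have "wirtinger_d i (wirtinger_dbar k f) ?x = 0"
      using f x by (simp add: pluriharmonic_on_def)
    then have Di: "D (axis i 1) = \<i> * D (axis i \<i>)"
      by (simp add: wirtinger_d_def D_def)
    have "(L has_derivative (\<lambda>h. cnj (D (axis i h)))) (at y)"
      unfolding L_def
      using bounded_linear.has_derivative[OF bounded_linear_cnj has_derivative_compose[OF has_derivative_vec_upd D]] .
    moreover have "cnj (D (axis i \<i>)) = \<i> * cnj (D (axis i 1))"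
      unfolding Di by simp
    ultimately have "(L has_field_derivative cnj (D (axis i 1))) (at y)"
      by (rule complex_linear_has_field_derivative)
    then show ?thesis by (auto simp: field_differentiable_def)
  qed
  then have "L holomorphic_on ball 0 1"
    by (auto simp: holomorphic_on_def intro: field_differentiable_at_within)
  then show ?thesis by (intro exI[of _ L]) (simp add: L_def)
qed

text \<open>\<open>K\<close> is a primitive of the holomorphic function whose conjugate is
  \<open>wirtinger_dbar i f\<close> along the slice. Subtracting the conjugate of \<open>K\<close>
  from \<open>f\<close> removes the antiholomorphic derivative and leaves a holomorphic
  \<open>H\<close>.\<close>

lemma pluriharmonic_slice:
  fixes f :: "complex ^ 'n::finite \<Rightarrow> complex"
  assumes f: "pluriharmonic_on unit_polydisc f" and z: "z \<in> unit_polydisc"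
  shows "\<exists>H K. H holomorphic_on ball 0 1 \<and> K holomorphic_on ball 0 1 \<and>
    (\<forall>y. norm y < 1 \<longrightarrow> f (vec_upd z i y) = H y + cnj (K y) \<and>
      wirtinger_dbar i f (vec_upd z i y) = cnj (deriv K y))"
proof -
  let ?f' = "\<lambda>z. frechet_derivative f (at z)"
  note f' = pluriharmonic_polydisc_derivatives(1)[OF f]
  from wirtinger_dbar_slice[OF f z, of i i] obtain L where L': "L holomorphic_on ball 0 1 \<and>
    (\<forall>y. norm y < 1 \<longrightarrow> wirtinger_dbar i f (vec_upd z i y) = cnj (L y))" ..
  then have L: "L holomorphic_on ball 0 1" ..
  have dbar: "wirtinger_dbar i f (vec_upd z i y) = cnj (L y)" if "norm y < 1" for y
    using L' that by simp
  obtain K where K: "\<And>y. y \<in> ball 0 1 \<Longrightarrow> (K has_field_derivative L y) (at y within ball 0 1)"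
    using holomorphic_convex_primitive'[OF convex_ball open_ball L] by blast
  then have K': "(K has_field_derivative L y) (at y)" if "norm y < 1" for y
    using K[of y] that at_within_open[of y "ball (0::complex) 1"] by simp
  define H where "H = (\<lambda>y. f (vec_upd z i y) - cnj (K y))"
  have "H field_differentiable at y" if y: "norm y < 1" for y
  proof -
    let ?x = "vec_upd z i y"
    have x: "?x \<in> unit_polydisc" using vec_upd_in_polydisc[OF z y] .
    define a b where "a = ?f' ?x (axis i 1)" and "b = ?f' ?x (axis i \<i>)"
    have Ly: "cnj (L y) = (a + \<i> * b) / 2"
      using dbar[OF y] by (simp add: a_def b_def wirtinger_dbar_def)
    let ?D = "\<lambda>h. ?f' ?x (axis i h) - cnj (L y * h)"
    have "(H has_derivative ?D) (at y)"
      unfolding H_def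
      by (intro has_derivative_diff has_derivative_compose[OF has_derivative_vec_upd f'[OF x]]
          bounded_linear.has_derivative[OF bounded_linear_cnj] has_field_derivative_imp_has_derivative K' y)
    moreover have "?D \<i> = \<i> * ?D 1"
      by (simp add: Ly a_def[symmetric] b_def[symmetric] field_simps)
    ultimately have "(H has_field_derivative ?D 1) (at y)"
      by (rule complex_linear_has_field_derivative)
    then show ?thesis by (auto simp: field_differentiable_def)
  qed
  then have "H holomorphic_on ball 0 1"
    by (auto simp: holomorphic_on_def intro: field_differentiable_at_within)
  moreover have "K holomorphic_on ball 0 1"
    unfolding holomorphic_on_def field_differentiable_def by (intro ballI) (rule exI, erule K)
  moreover have "deriv K y = L y" if "norm y < 1" for y
    using K'[OF that] by (rule DERIV_imp_deriv)
  ultimately show ?thesis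
    using dbar by (intro exI[of _ H] exI[of _ K]) (auto simp: H_def)
qed

section \<open>Poisson integrals and Fourier coefficients\<close>

lemma has_circle_mean_const: "has_circle_mean (\<lambda>_. c) c"
  using has_circle_mean_holomorphic[of "\<lambda>_. c" 2 1] by simp

definition closed_polydisc :: "real \<Rightarrow> (complex ^ 'n::finite) set" where
  "closed_polydisc r = {z. \<forall>j. norm (z $ j) \<le> r}"

lemma closed_closed_polydisc: "closed (closed_polydisc r)"
  unfolding closed_polydisc_def by (intro closed_Collect_all closed_Collect_le continuous_intros)

lemma compact_closed_polydisc: "compact (closed_polydisc r :: (complex ^ 'n::finite) set)"
proof -
  have "norm z \<le> (\<Sum>j\<in>(UNIV::'n set). r)" if "z \<in> closed_polydisc r" for z :: "complex ^ 'n"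
    using that unfolding norm_vec_def closed_polydisc_def
    by (intro order_trans[OF L2_set_le_sum] sum_mono) auto
  then show ?thesis
    unfolding compact_eq_bounded_closed using closed_closed_polydisc by (auto simp: bounded_iff)
qed

lemma closed_polydisc_subset: "r < 1 \<Longrightarrow> closed_polydisc r \<subseteq> unit_polydisc"
  unfolding closed_polydisc_def unit_polydisc_def mem_ball dist_0_norm
  using le_less_trans by blast

text \<open>Since nothing is known about \<open>f\<close> outside the polydisc, truncation is needed for Borel measurability.\<close>

definition cut_off :: "real \<Rightarrow> (complex ^ 'n::finite \<Rightarrow> complex) \<Rightarrow> complex ^ 'n \<Rightarrow> complex" where
  "cut_off r u z = indicator (closed_polydisc r) z *\<^sub>R u z"

lemma cut_off_eq: "z \<in> closed_polydisc r \<Longrightarrow> cut_off r u z = u z"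
  by (simp add: cut_off_def)

lemma measurable_cut_off:
  assumes "continuous_on unit_polydisc u" "r < 1"
  shows "cut_off r u \<in> borel_measurable borel"
  unfolding cut_off_def
  using assms
  by (intro borel_measurable_continuous_on_indicator borel_closed closed_closed_polydisc
      continuous_on_subset[OF _ closed_polydisc_subset])

lemma cut_off_bounded:
  assumes "continuous_on unit_polydisc u" "r < 1"
  obtains M where "0 \<le> M" "\<And>z. norm (cut_off r u z) \<le> M"
proof -
  have "compact (u ` closed_polydisc r)"
    using assms by (intro compact_continuous_image compact_closed_polydisc continuous_on_subset[OF _ closed_polydisc_subset])
  then obtain M where "0 < M" "\<And>z. z \<in> closed_polydisc r \<Longrightarrow> norm (u z) \<le> M"
    using compact_imp_bounded bounded_pos by (metis image_eqI)
  then show ?thesis by (intro that[of M]) (auto simp: cut_off_def indicator_def)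
qed

lemma scaleR_torus_in_closed_polydisc: "\<omega> \<in> unit_torus \<Longrightarrow> 0 \<le> r \<Longrightarrow> r *\<^sub>R \<omega> \<in> closed_polydisc r"
  by (simp add: unit_torus_def closed_polydisc_def)

lemma measurable_vec_nth_complex [measurable]: "(\<lambda>z :: complex ^ 'n::finite. z $ j) \<in> borel_measurable borel"
  by (intro borel_measurable_continuous_onI continuous_intros)

lemma measurable_cnj [measurable]: "cnj \<in> borel_measurable borel"
  by (intro borel_measurable_continuous_onI continuous_intros)

lemma measurable_poisson_kernel [measurable]: "poisson_kernel x \<in> borel_measurable borel"
  unfolding poisson_kernel_def by measurable

lemma norm_poisson_kernel_le:
  assumes "norm x < 1" "norm y = 1"
  shows "norm (poisson_kernel x y) \<le> 2 / (1 - norm x) + 1"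
proof -
  have *: "norm (1 / (1 - w)) \<le> 1 / (1 - norm x)" if "norm w = norm x" for w :: complex
  proof -
    have "1 - norm x \<le> norm (1 - w)"
      using norm_triangle_ineq2[of 1 w] that by simp
    then show ?thesis using assms by (simp add: norm_divide frac_le)
  qed
  have "norm (poisson_kernel x y) \<le> norm (1 / (1 - x * cnj y)) + norm (1 / (1 - cnj x * y)) + norm (1::complex)"
    unfolding poisson_kernel_def by (rule order_trans[OF norm_triangle_ineq4 add_right_mono[OF norm_triangle_ineq]])
  also have "\<dots> \<le> 1 / (1 - norm x) + 1 / (1 - norm x) + 1"
    using assms by (intro add_mono *) (auto simp: norm_mult)
  finally show ?thesis by simp
qed

text \<open>Induction over the set \<open>J\<close> of coordinates that have been moved to the
  torus. Moving one more coordinate leaves the integral unchanged by the one-variable Poisson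
  formula on a slice.\<close>

lemma poisson_representation:
  fixes f :: "complex ^ 'n::finite \<Rightarrow> complex" and z :: "complex ^ 'n"
  assumes f: "pluriharmonic_on unit_polydisc f" and r: "0 < r" "r < 1" and z: "\<And>j. norm (z $ j) < r"
  shows "(\<integral>\<omega>. cut_off r f (r *\<^sub>R \<omega>) * (\<Prod>j\<in>UNIV. poisson_kernel (z $ j / r) (\<omega> $ j)) \<partial>torus_measure) = f z"
proof -
  note cont = pluriharmonic_polydisc_derivatives(3)[OF f]
  note [measurable] = measurable_cut_off[OF cont r(2)]
  obtain M where M: "0 \<le> M" "\<And>z. norm (cut_off r f z) \<le> M"
    using cut_off_bounded[OF cont r(2)] by auto
  \<comment> \<open>Interpolates between the point \<open>z\<close> (J empty) and the point
    \<open>r *\<^sub>R \<omega>\<close> (J everything).\<close>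
  define mix where "mix = (\<lambda>J (\<omega>::complex^'n). \<chi> j. if j \<in> J then r * \<omega> $ j else z $ j)"
  define Q where "Q = (\<lambda>J (\<omega>::complex^'n). \<Prod>j\<in>J. poisson_kernel (z $ j / r) (\<omega> $ j))"
  define F where "F = (\<lambda>J \<omega>. cut_off r f (mix J \<omega>) * Q J \<omega>)"
  have mix_meas [measurable]: "mix J \<in> borel_measurable borel" for J
  proof (rule borel_measurable_continuous_onI)
    have "continuous_on UNIV (\<lambda>\<omega>::complex^'n. if j \<in> J then r * \<omega> $ j else z $ j)" for j
      by (cases "j \<in> J") (auto intro!: continuous_intros)
    then show "continuous_on UNIV (mix J)"
      unfolding mix_def by (intro continuous_on_vec_lambda)
  qed
  have Q_meas [measurable]: "Q J \<in> borel_measurable borel" for J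
    unfolding Q_def by measurable
  have F_meas: "F J \<in> borel_measurable borel" for J
    unfolding F_def by measurable
  define B where "B = (\<lambda>J. M * (\<Prod>j\<in>J. 2 / (1 - norm (z $ j / r)) + 1))"
  have zr: "norm (z $ j / r) < 1" for j using z[of j] r by (simp add: norm_divide)
  have F_bound: "norm (F J \<omega>) \<le> B J" if "\<omega> \<in> unit_torus" for J \<omega>
    unfolding F_def B_def norm_mult Q_def prod_norm[symmetric]
    using that M by (intro mult_mono prod_mono prod_nonneg) (auto intro!: norm_poisson_kernel_le zr simp: unit_torus_def)
  have F_int: "integrable torus_measure (F J)" for J
    by (rule integrable_torus_measure[OF F_meas F_bound])
  have mix_polydisc: "mix J \<omega> \<in> closed_polydisc r" if "\<omega> \<in> unit_torus" for J \<omega>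
    using that z r by (auto simp: mix_def closed_polydisc_def unit_torus_def norm_mult intro: less_imp_le)
  interpret T: prob_space "torus_measure :: (complex ^ 'n) measure" by (rule prob_space_torus_measure)
  have "(\<integral>\<omega>. F J \<omega> \<partial>torus_measure) = f z" for J
  proof -
    have "finite J" by simp
    then show ?thesis
    proof (induction J)
      case empty
      have "mix {} \<omega> = z" for \<omega> by (simp add: mix_def vec_eq_iff)
      moreover have "z \<in> closed_polydisc r" using z by (auto simp: closed_polydisc_def intro: less_imp_le)
      ultimately show ?case by (simp add: F_def Q_def cut_off_eq T.prob_space[simplified])
    next
      case (insert i J)
      have "(\<integral>\<omega>. F (insert i J) \<omega> - F J \<omega> \<partial>torus_measure) = 0"
      proof (rule integral_torus_eq_0I)
        show "(\<lambda>\<omega>. F (insert i J) \<omega> - F J \<omega>) \<in> borel_measurable borel"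
          using F_meas by (intro borel_measurable_diff)
        show "norm (F (insert i J) \<omega> - F J \<omega>) \<le> B (insert i J) + B J" if "\<omega> \<in> unit_torus" for \<omega>
          using that by (intro order_trans[OF norm_triangle_ineq4] add_mono F_bound)
        fix \<omega> :: "complex ^ 'n" assume \<omega>: "\<omega> \<in> unit_torus"
        define w where "w = mix J \<omega>"
        have w: "w \<in> unit_polydisc"
          unfolding w_def using mix_polydisc[OF \<omega>] closed_polydisc_subset[OF r(2)] by blast
        have wi: "w $ i = z $ i" using insert by (simp add: w_def mix_def)
        from pluriharmonic_slice[OF f w, of i] obtain H K where
          H: "H holomorphic_on ball 0 1" and K: "K holomorphic_on ball 0 1"
          and fHK: "\<forall>y. norm y < 1 \<longrightarrow> f (vec_upd w i y) = H y + cnj (K y)"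
          by blast
        \<comment> \<open>As \<open>i\<close> is not in \<open>J\<close>, this integrand is constant
          along the slice; it is the value that the Poisson mean of the other integrand has to
          reproduce.\<close>
        have FJ: "F J (vec_upd \<omega> i y) = (H (z $ i) + cnj (K (z $ i))) * Q J \<omega>" for y
        proof -
          have "mix J (vec_upd \<omega> i y) = w"
            using insert by (auto simp: mix_def w_def vec_eq_iff vec_upd_nth)
          moreover have "Q J (vec_upd \<omega> i y) = Q J \<omega>"
            using insert unfolding Q_def by (intro prod.cong) (auto simp: vec_upd_nth)
          moreover have "cut_off r f w = f (vec_upd w i (z $ i))"
            using mix_polydisc[OF \<omega>] wi vec_upd_triv[of w i] by (simp add: cut_off_eq w_def)
          moreover have "norm (z $ i) < 1" using z[of i] r by simp
          ultimately show ?thesis using fHK by (simp add: F_def)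
        qed
        have FiJ: "F (insert i J) (vec_upd \<omega> i y) = Q J \<omega> * (H (r * y) * poisson_kernel (z $ i / r) y
            + cnj (K (r * y) * poisson_kernel (z $ i / r) y))" if y: "norm y = 1" for y :: complex
        proof -
          have m: "mix (insert i J) (vec_upd \<omega> i y) = vec_upd w i (r * y)"
            using insert by (auto simp: mix_def w_def vec_eq_iff vec_upd_nth)
          have "Q (insert i J) (vec_upd \<omega> i y) = poisson_kernel (z $ i / r) y * Q J \<omega>"
            using insert unfolding Q_def by (auto simp: vec_upd_nth intro!: prod.cong)
          moreover have "cut_off r f (vec_upd w i (r * y)) = f (vec_upd w i (r * y))"
            unfolding m[symmetric] by (intro cut_off_eq mix_polydisc vec_upd_in_torus \<omega> y)
          moreover have "norm (r * y) < 1" using y r by (simp add: norm_mult)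
          ultimately show ?thesis using fHK m by (simp add: F_def algebra_simps)
        qed
        have "has_circle_mean (\<lambda>y. Q J \<omega> * (H (r * y) * poisson_kernel (z $ i / r) y
            + cnj (K (r * y) * poisson_kernel (z $ i / r) y)) - (H (z $ i) + cnj (K (z $ i))) * Q J \<omega>)
          (Q J \<omega> * (H (z $ i) + cnj (K (z $ i))) - (H (z $ i) + cnj (K (z $ i))) * Q J \<omega>)"
          by (intro has_circle_mean_diff has_circle_mean_cmult has_circle_mean_add has_circle_mean_cnj
              has_circle_mean_const has_circle_mean_Poisson[OF H r z] has_circle_mean_Poisson[OF K r z])
        also have "Q J \<omega> * (H (z $ i) + cnj (K (z $ i))) - (H (z $ i) + cnj (K (z $ i))) * Q J \<omega> = 0"
          by (simp add: mult.commute)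
        finally show "has_circle_mean (\<lambda>y. F (insert i J) (vec_upd \<omega> i y) - F J (vec_upd \<omega> i y)) 0"
          by (subst has_circle_mean_cong) (auto simp: FJ FiJ)
      qed
      then show ?case using F_int insert.IH by simp
    qed
  qed
  from this[of UNIV] show ?thesis
    by (simp add: F_def Q_def mix_def scaleR_vec_def scaleR_conv_of_real[symmetric] del: scaleR_conv_of_real)
qed

text \<open>The harmonic extension of the \<open>k\<close>-th character of the circle to the disc.\<close>

definition zpow :: "int \<Rightarrow> complex \<Rightarrow> complex" where
  "zpow k z = (if 0 \<le> k then z ^ nat k else cnj z ^ nat (- k))"

text \<open>The Fourier series of the Poisson kernel on |y| = 1, cut off beyond frequency
  \<open>N\<close>.\<close>

definition trunc_poisson :: "nat \<Rightarrow> complex \<Rightarrow> complex \<Rightarrow> complex" where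
  "trunc_poisson N x y = (\<Sum>k\<in>{- int N..int N}. zpow k x * y powi (- k))"

lemma powi_on_circle:
  assumes "norm y = 1"
  shows "y powi (- int k) = cnj y ^ k" "cnj (y powi m) = y powi (- m)" "norm (y powi m) = 1"
proof -
  have y: "cnj y = inverse y"
    using assms by (metis complex_norm_square inverse_unique of_real_1 power_one)
  then show "y powi (- int k) = cnj y ^ k"
    by (simp add: power_int_minus power_inverse)
  show "cnj (y powi m) = y powi (- m)"
    by (simp add: y power_int_minus power_int_inverse)
  show "norm (y powi m) = 1" using assms by (simp add: norm_power_int)
qed

lemma trunc_poisson_eq:
  assumes "norm y = 1"
  shows "trunc_poisson N x y = (\<Sum>k\<le>N. (x * cnj y) ^ k) + (\<Sum>k\<le>N. (cnj x * y) ^ k) - 1"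
proof -
  have split: "{- int N..int N} = int ` {..N} \<union> (\<lambda>k. - int k) ` {1..N}"
  proof (intro equalityI subsetI)
    fix k assume k: "k \<in> {- int N..int N}"
    show "k \<in> int ` {..N} \<union> (\<lambda>k. - int k) ` {1..N}"
    proof (cases "0 \<le> k")
      case True
      then have "k = int (nat k)" "nat k \<le> N" using k by auto
      then show ?thesis by blast
    next
      case False
      then have "k = - int (nat (- k))" "nat (- k) \<in> {1..N}" using k by auto
      then show ?thesis by blast
    qed
  qed auto
  have "trunc_poisson N x y = (\<Sum>k\<in>int ` {..N}. zpow k x * y powi (- k)) + (\<Sum>k\<in>(\<lambda>k. - int k) ` {1..N}. zpow k x * y powi (- k))"
    unfolding trunc_poisson_def split by (rule sum.union_disjoint) auto
  also have "(\<Sum>k\<in>int ` {..N}. zpow k x * y powi (- k)) = (\<Sum>k\<le>N. (x * cnj y) ^ k)"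
    by (subst sum.reindex) (auto simp: zpow_def powi_on_circle[OF assms] power_mult_distrib intro!: sum.cong)
  also have "(\<Sum>k\<in>(\<lambda>k. - int k) ` {1..N}. zpow k x * y powi (- k)) = (\<Sum>k\<in>{1..N}. (cnj x * y) ^ k)"
    by (subst sum.reindex) (auto simp: zpow_def power_mult_distrib inj_on_def intro!: sum.cong)
  \<comment> \<open>Frequency 0 belongs to the other sum; starting this geometric sum at 0 as well
    costs the 1.\<close>
  also have "(\<Sum>k\<in>{1..N}. (cnj x * y) ^ k) = (\<Sum>k\<le>N. (cnj x * y) ^ k) - 1"
    by (simp add: atMost_atLeast0 sum.atLeast_Suc_atMost)
  finally show ?thesis by (simp add: algebra_simps)
qed

lemma trunc_poisson_tendsto:
  assumes "norm x < 1" "norm y = 1"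
  shows "(\<lambda>N. trunc_poisson N x y) \<longlonglongrightarrow> poisson_kernel x y"
proof -
  have *: "(\<lambda>N. \<Sum>k\<le>N. w ^ k) \<longlonglongrightarrow> 1 / (1 - w)" if "norm w < 1" for w :: complex
    using geometric_sums[OF that] by (simp add: sums_def_le)
  show ?thesis
    unfolding trunc_poisson_eq[OF assms(2)] poisson_kernel_def
    using assms by (intro tendsto_intros *) (auto simp: norm_mult)
qed

text \<open>The bound does not depend on \<open>N\<close>; it supplies the majorant for dominated
  convergence.\<close>

lemma norm_trunc_poisson_le:
  assumes "norm x \<le> \<rho>" "\<rho> < 1" "norm y = 1"
  shows "norm (trunc_poisson N x y) \<le> 2 / (1 - \<rho>) + 1"
proof -
  have \<rho>: "0 \<le> \<rho>" using assms(1) norm_ge_zero order_trans by blast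
  have *: "norm (\<Sum>k\<le>N. w ^ k) \<le> 1 / (1 - \<rho>)" if "norm w = norm x" for w :: complex
  proof -
    have "norm (\<Sum>k\<le>N. w ^ k) \<le> (\<Sum>k\<le>N. \<rho> ^ k)"
      using that assms by (intro sum_norm_le) (auto simp: norm_power intro: power_mono)
    also have "\<dots> \<le> (\<Sum>k. \<rho> ^ k)"
      using \<rho> assms by (intro sum_le_suminf summable_geometric) auto
    also have "\<dots> = 1 / (1 - \<rho>)"
      using \<rho> assms by (intro suminf_geometric) auto
    finally show ?thesis .
  qed
  have "norm (trunc_poisson N x y) \<le> norm (\<Sum>k\<le>N. (x * cnj y) ^ k) + norm (\<Sum>k\<le>N. (cnj x * y) ^ k) + norm (1::complex)"
    unfolding trunc_poisson_eq[OF assms(3)]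
    by (rule order_trans[OF norm_triangle_ineq4 add_right_mono[OF norm_triangle_ineq]])
  also have "\<dots> \<le> 1 / (1 - \<rho>) + 1 / (1 - \<rho>) + 1"
    using assms by (intro add_mono *) (auto simp: norm_mult)
  finally show ?thesis by simp
qed

lemma measurable_power_int [measurable]: "(\<lambda>y::complex. y powi k) \<in> borel_measurable borel"
  unfolding power_int_def by (cases "0 \<le> k") auto

lemma measurable_trunc_poisson [measurable]: "trunc_poisson N x \<in> borel_measurable borel"
  unfolding trunc_poisson_def by measurable

definition character :: "('n::finite \<Rightarrow> int) \<Rightarrow> complex ^ 'n \<Rightarrow> complex" where
  "character \<kappa> \<omega> = (\<Prod>j\<in>UNIV. \<omega> $ j powi \<kappa> j)"

lemma measurable_character [measurable]: "character \<kappa> \<in> borel_measurable borel"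
  unfolding character_def by measurable

lemma norm_character: "\<omega> \<in> unit_torus \<Longrightarrow> norm (character \<kappa> \<omega>) = 1"
  unfolding character_def prod_norm[symmetric]
  by (intro prod.neutral) (auto simp: unit_torus_def powi_on_circle)

lemma cnj_character: "\<omega> \<in> unit_torus \<Longrightarrow> cnj (character \<kappa> \<omega>) = character (\<lambda>j. - \<kappa> j) \<omega>"
  unfolding character_def cnj_prod by (intro prod.cong refl powi_on_circle(2)) (simp add: unit_torus_def)

lemma character_add:
  "\<omega> \<in> unit_torus \<Longrightarrow> character (\<lambda>j. \<kappa> j + \<mu> j) \<omega> = character \<kappa> \<omega> * character \<mu> \<omega>"
  unfolding character_def prod.distrib[symmetric]
proof (intro prod.cong refl power_int_add disjI1)
  fix j assume "\<omega> \<in> unit_torus"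
  then have "norm (\<omega> $ j) = 1" by (simp add: unit_torus_def)
  then show "\<omega> $ j \<noteq> 0" by auto
qed

lemma character_vec_upd:
  "character \<kappa> (vec_upd \<omega> i y) = y powi \<kappa> i * (\<Prod>j\<in>UNIV - {i}. \<omega> $ j powi \<kappa> j)"
proof -
  have "character \<kappa> (vec_upd \<omega> i y) = y powi \<kappa> i * (\<Prod>j\<in>UNIV - {i}. vec_upd \<omega> i y $ j powi \<kappa> j)"
    unfolding character_def by (subst prod.remove[of UNIV i]) auto
  also have "(\<Prod>j\<in>UNIV - {i}. vec_upd \<omega> i y $ j powi \<kappa> j) = (\<Prod>j\<in>UNIV - {i}. \<omega> $ j powi \<kappa> j)"
    by (intro prod.cong) (auto simp: vec_upd_nth)
  finally show ?thesis .
qed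

lemma has_circle_mean_powi:
  assumes "k \<noteq> 0"
  shows "has_circle_mean (\<lambda>y. y powi k) 0"
proof -
  have pos: "has_circle_mean (\<lambda>y. y ^ Suc q) 0" for q
    using has_circle_mean_power[of "\<lambda>_. 1" 2 1 q] by simp
  show ?thesis
  proof (cases "0 < k")
    case True
    then obtain q where "k = int (Suc q)" by (metis zero_less_imp_eq_int not0_implies_Suc less_irrefl)
    then show ?thesis using pos[of q] by (simp only: power_int_of_nat)
  next
    case False
    then have "0 < - k" using assms by simp
    then obtain q where "- k = int (Suc q)" by (metis zero_less_imp_eq_int not0_implies_Suc less_irrefl)
    then have k: "k = - int (Suc q)" by simp
    have "has_circle_mean (\<lambda>y. cnj (y ^ Suc q)) 0" using has_circle_mean_cnj[OF pos[of q]] by simp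
    then show ?thesis
      unfolding k by (subst has_circle_mean_cong) (simp_all only: powi_on_circle complex_cnj_power)
  qed
qed

lemma integral_character_eq_0:
  fixes \<kappa> :: "'n::finite \<Rightarrow> int"
  assumes "\<kappa> i \<noteq> 0"
  shows "(\<integral>\<omega>. character \<kappa> \<omega> \<partial>torus_measure) = 0"
proof (rule integral_torus_eq_0I[where B = 1])
  show "character \<kappa> \<in> borel_measurable borel" by measurable
  show "norm (character \<kappa> \<omega>) \<le> 1" if "\<omega> \<in> unit_torus" for \<omega>
    using norm_character[OF that, of \<kappa>] by simp
  show "has_circle_mean (\<lambda>y. character \<kappa> (vec_upd \<omega> i y)) 0" for \<omega>
    using has_circle_mean_cmult[OF has_circle_mean_powi[OF assms], of "\<Prod>j\<in>UNIV - {i}. \<omega> $ j powi \<kappa> j"]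
    unfolding character_vec_upd by (simp add: mult.commute)
qed

section \<open>Bessel's inequality and Fourier coefficients on the torus\<close>

text \<open>A class of integrable functions closed under sums, products and conjugation, so that
  integrability can be derived by rules. Boundedness is asked for only on the torus because
  characters with negative frequencies are unbounded elsewhere.\<close>

definition torus_bounded :: "(complex ^ 'n::finite \<Rightarrow> complex) \<Rightarrow> bool" where
  "torus_bounded F \<longleftrightarrow> F \<in> borel_measurable borel \<and> (\<exists>B. \<forall>\<omega>\<in>unit_torus. norm (F \<omega>) \<le> B)"

lemma torus_boundedI:
  "F \<in> borel_measurable borel \<Longrightarrow> (\<And>\<omega>. \<omega> \<in> unit_torus \<Longrightarrow> norm (F \<omega>) \<le> B) \<Longrightarrow> torus_bounded F"
  unfolding torus_bounded_def by blast

lemma torus_bounded_measurable: "torus_bounded F \<Longrightarrow> F \<in> borel_measurable borel"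
  by (simp add: torus_bounded_def)

lemma torus_bounded_integrable:
  assumes "torus_bounded F"
  shows "integrable torus_measure F"
proof -
  obtain B where "\<forall>\<omega>\<in>unit_torus. norm (F \<omega>) \<le> B"
    using assms unfolding torus_bounded_def by blast
  then show ?thesis
    using torus_bounded_measurable[OF assms] by (intro integrable_torus_measure[of F B]) auto
qed

lemma torus_bounded_const: "torus_bounded (\<lambda>_. c)"
  by (rule torus_boundedI[of _ "norm c"]) auto

lemma torus_bounded_add:
  assumes "torus_bounded F" "torus_bounded G"
  shows "torus_bounded (\<lambda>\<omega>. F \<omega> + G \<omega>)"
proof -
  obtain A B where "\<And>\<omega>. \<omega> \<in> unit_torus \<Longrightarrow> norm (F \<omega>) \<le> A" "\<And>\<omega>. \<omega> \<in> unit_torus \<Longrightarrow> norm (G \<omega>) \<le> B"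
    using assms by (auto simp: torus_bounded_def)
  then show ?thesis
    using assms[THEN torus_bounded_measurable]
    by (intro torus_boundedI[of _ "A + B"]) (auto intro!: norm_triangle_mono)
qed

lemma torus_bounded_mult:
  assumes "torus_bounded F" "torus_bounded G"
  shows "torus_bounded (\<lambda>\<omega>. F \<omega> * G \<omega>)"
proof -
  obtain A B where A: "\<And>\<omega>. \<omega> \<in> unit_torus \<Longrightarrow> norm (F \<omega>) \<le> A"
    and B: "\<And>\<omega>. \<omega> \<in> unit_torus \<Longrightarrow> norm (G \<omega>) \<le> B"
    using assms by (auto simp: torus_bounded_def)
  show ?thesis
    using assms[THEN torus_bounded_measurable]
    by (intro torus_boundedI[of _ "A * B"])
      (auto simp: norm_mult intro!: mult_mono A B order_trans[OF norm_ge_zero A])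
qed

lemma torus_bounded_cnj: "torus_bounded F \<Longrightarrow> torus_bounded (\<lambda>\<omega>. cnj (F \<omega>))"
  unfolding torus_bounded_def using measurable_compose[OF _ measurable_cnj] by auto

lemma torus_bounded_sum: "finite S \<Longrightarrow> (\<And>\<kappa>. \<kappa> \<in> S \<Longrightarrow> torus_bounded (F \<kappa>)) \<Longrightarrow> torus_bounded (\<lambda>\<omega>. \<Sum>\<kappa>\<in>S. F \<kappa> \<omega>)"
  by (induction S rule: finite_induct) (auto intro: torus_bounded_add torus_bounded_const)

lemma torus_bounded_character: "torus_bounded (character \<kappa>)"
  by (rule torus_boundedI[of _ 1]) (auto simp: norm_character)

lemma torus_bounded_cut_off:
  assumes "continuous_on unit_polydisc u" "r < 1"
  shows "torus_bounded (\<lambda>\<omega>. cut_off r u (r *\<^sub>R \<omega>))"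
proof -
  obtain M where "\<And>z. norm (cut_off r u z) \<le> M" using cut_off_bounded[OF assms] by auto
  moreover note [measurable] = measurable_cut_off[OF assms]
  have "(\<lambda>\<omega>. cut_off r u (r *\<^sub>R \<omega>)) \<in> borel_measurable borel" by measurable
  ultimately show ?thesis by (intro torus_boundedI[of _ M])
qed

lemmas torus_bounded_intros = torus_bounded_const torus_bounded_add torus_bounded_mult
  torus_bounded_cnj torus_bounded_sum torus_bounded_character torus_bounded_cut_off

text \<open>Expand the nonnegative square integral of \<open>F - T\<close>, where \<open>T\<close>
  is the projection onto the chosen characters. Both the inner product of \<open>F\<close> with
  \<open>T\<close> and the square norm of \<open>T\<close> equal the sum \<open>N\<close> of squared
  coefficients.\<close>

lemma bessel_inequality_torus:
  fixes F :: "complex ^ 'n::finite \<Rightarrow> complex"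
  assumes F: "torus_bounded F" and S: "finite S"
  shows "(\<Sum>\<kappa>\<in>S. (norm (\<integral>\<omega>. F \<omega> * character (\<lambda>j. - \<kappa> j) \<omega> \<partial>torus_measure))\<^sup>2)
    \<le> (\<integral>\<omega>. (norm (F \<omega>))\<^sup>2 \<partial>torus_measure)"
proof -
  interpret T: prob_space "torus_measure :: (complex ^ 'n) measure" by (rule prob_space_torus_measure)
  define c where "c = (\<lambda>\<kappa>. \<integral>\<omega>. F \<omega> * character (\<lambda>j. - \<kappa> j) \<omega> \<partial>torus_measure)"
  define T where "T = (\<lambda>\<omega>. \<Sum>\<kappa>\<in>S. c \<kappa> * character \<kappa> \<omega>)"
  have T: "torus_bounded T" unfolding T_def by (intro torus_bounded_intros S)
  have inner: "(\<integral>\<omega>. G \<omega> * cnj (T \<omega>) \<partial>torus_measure) =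
    (\<Sum>\<kappa>\<in>S. cnj (c \<kappa>) * (\<integral>\<omega>. G \<omega> * character (\<lambda>j. - \<kappa> j) \<omega> \<partial>torus_measure))"
    if G: "torus_bounded G" for G
  proof -
    have "(\<integral>\<omega>. G \<omega> * cnj (T \<omega>) \<partial>torus_measure) =
      (\<integral>\<omega>. (\<Sum>\<kappa>\<in>S. cnj (c \<kappa>) * (G \<omega> * character (\<lambda>j. - \<kappa> j) \<omega>)) \<partial>torus_measure)"
    \<comment> \<open>Conjugation negates the frequencies of a character only on the torus, so the
      integrands agree almost everywhere.\<close>
    proof (rule integral_cong_AE)
      show "AE \<omega> in torus_measure. G \<omega> * cnj (T \<omega>) = (\<Sum>\<kappa>\<in>S. cnj (c \<kappa>) * (G \<omega> * character (\<lambda>j. - \<kappa> j) \<omega>))"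
        using AE_torus_measure
        by eventually_elim (simp add: T_def cnj_character sum_distrib_left mult_ac)
    qed (auto intro!: borel_measurable_integrable torus_bounded_integrable torus_bounded_intros G T S)
    also have "\<dots> = (\<Sum>\<kappa>\<in>S. \<integral>\<omega>. cnj (c \<kappa>) * (G \<omega> * character (\<lambda>j. - \<kappa> j) \<omega>) \<partial>torus_measure)"
      by (intro Bochner_Integration.integral_sum torus_bounded_integrable torus_bounded_intros G)
    finally show ?thesis by simp
  qed
  have orth: "(\<integral>\<omega>. T \<omega> * character (\<lambda>j. - \<mu> j) \<omega> \<partial>torus_measure) = c \<mu>" if \<mu>: "\<mu> \<in> S" for \<mu>
  proof -
    have ch: "(\<integral>\<omega>. character \<kappa> \<omega> * character (\<lambda>j. - \<mu> j) \<omega> \<partial>torus_measure) = (if \<kappa> = \<mu> then 1 else 0)" for \<kappa>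
    proof -
      have "(\<integral>\<omega>. character \<kappa> \<omega> * character (\<lambda>j. - \<mu> j) \<omega> \<partial>torus_measure)
        = (\<integral>\<omega>. character (\<lambda>j. \<kappa> j + - \<mu> j) \<omega> \<partial>torus_measure)"
      proof (rule integral_cong_AE)
        show "AE \<omega> in torus_measure. character \<kappa> \<omega> * character (\<lambda>j. - \<mu> j) \<omega> = character (\<lambda>j. \<kappa> j + - \<mu> j) \<omega>"
          using AE_torus_measure by eventually_elim (simp only: character_add)
      qed (auto intro!: borel_measurable_integrable torus_bounded_integrable torus_bounded_intros)
      also have "\<dots> = (if \<kappa> = \<mu> then 1 else 0)"
      proof (cases "\<kappa> = \<mu>")
        case True
        then show ?thesis by (simp add: character_def T.prob_space[simplified])
      next
        case False
        then obtain i where "\<kappa> i + - \<mu> i \<noteq> 0" by auto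
        from integral_character_eq_0[where \<kappa> = "\<lambda>j. \<kappa> j + - \<mu> j", OF this] show ?thesis
          using False by simp
      qed
      finally show ?thesis .
    qed
    have "(\<integral>\<omega>. T \<omega> * character (\<lambda>j. - \<mu> j) \<omega> \<partial>torus_measure)
      = (\<integral>\<omega>. (\<Sum>\<kappa>\<in>S. c \<kappa> * (character \<kappa> \<omega> * character (\<lambda>j. - \<mu> j) \<omega>)) \<partial>torus_measure)"
      by (simp add: T_def sum_distrib_right mult.assoc)
    also have "\<dots> = (\<Sum>\<kappa>\<in>S. \<integral>\<omega>. c \<kappa> * (character \<kappa> \<omega> * character (\<lambda>j. - \<mu> j) \<omega>) \<partial>torus_measure)"
      by (intro Bochner_Integration.integral_sum torus_bounded_integrable torus_bounded_intros)
    also have "\<dots> = (\<Sum>\<kappa>\<in>S. c \<kappa> * (if \<kappa> = \<mu> then 1 else 0))"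
      by (simp only: integral_mult_right_zero ch)
    also have "\<dots> = c \<mu>" using S \<mu> by (simp add: if_distrib cong: if_cong)
    finally show ?thesis .
  qed
  define N where "N = (\<Sum>\<kappa>\<in>S. (norm (c \<kappa>))\<^sup>2)"
  have cc: "(\<Sum>\<kappa>\<in>S. cnj (c \<kappa>) * c \<kappa>) = of_real N"
    by (simp add: N_def complex_norm_square mult.commute del: of_real_power)
  have FT: "(\<integral>\<omega>. F \<omega> * cnj (T \<omega>) \<partial>torus_measure) = of_real N"
    unfolding inner[OF F] cc[symmetric] by (simp add: c_def)
  have TT: "(\<integral>\<omega>. T \<omega> * cnj (T \<omega>) \<partial>torus_measure) = of_real N"
    unfolding inner[OF T] cc[symmetric] by (intro sum.cong refl) (simp only: orth)
  have iF: "integrable torus_measure (\<lambda>\<omega>. (norm (F \<omega>))\<^sup>2)"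
    using torus_bounded_integrable[OF torus_bounded_mult[OF F torus_bounded_cnj[OF F]], THEN integrable_Re]
    by (simp add: complex_norm_square[symmetric] flip: of_real_power)
  have iFT: "integrable torus_measure (\<lambda>\<omega>. F \<omega> * cnj (T \<omega>))" "integrable torus_measure (\<lambda>\<omega>. T \<omega> * cnj (T \<omega>))"
    by (intro torus_bounded_integrable torus_bounded_intros F T)+
  have "0 \<le> (\<integral>\<omega>. (norm (F \<omega> - T \<omega>))\<^sup>2 \<partial>torus_measure)"
    by (intro integral_nonneg_AE) simp
  also have "\<dots> = (\<integral>\<omega>. (norm (F \<omega>))\<^sup>2 - 2 * Re (F \<omega> * cnj (T \<omega>)) + Re (T \<omega> * cnj (T \<omega>)) \<partial>torus_measure)"
    unfolding cmod_power2
    by (intro Bochner_Integration.integral_cong refl) (simp add: power2_eq_square algebra_simps)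
  also have "\<dots> = (\<integral>\<omega>. (norm (F \<omega>))\<^sup>2 \<partial>torus_measure) - 2 * Re (\<integral>\<omega>. F \<omega> * cnj (T \<omega>) \<partial>torus_measure)
      + Re (\<integral>\<omega>. T \<omega> * cnj (T \<omega>) \<partial>torus_measure)"
    using iF iFT[THEN integrable_Re] iFT[THEN integral_Re]
    by (simp del: times_complex.sel)
  also have "\<dots> = (\<integral>\<omega>. (norm (F \<omega>))\<^sup>2 \<partial>torus_measure) - N"
    unfolding FT TT by simp
  finally show ?thesis by (simp add: N_def c_def)
qed

text \<open>The coefficient refers to the rescaled function on the unit torus, so powers of
  \<open>r\<close> stay inside it; this is why the series is evaluated at z/r.\<close>

definition fourier :: "real \<Rightarrow> (complex ^ 'n::finite \<Rightarrow> complex) \<Rightarrow> ('n \<Rightarrow> int) \<Rightarrow> complex" where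
  "fourier r f \<kappa> = (\<integral>\<omega>. cut_off r f (r *\<^sub>R \<omega>) * character (\<lambda>j. - \<kappa> j) \<omega> \<partial>torus_measure)"

text \<open>Integration by parts in the variable \<open>l\<close> replaces \<open>f\<close> by its derivative with respect to the conjugate of
  \<open>z_l\<close>, which is antiholomorphic in \<open>z_k\<close>.\<close>

lemma fourier_mixed_eq_0:
  fixes f :: "complex ^ 'n::finite \<Rightarrow> complex"
  assumes f: "pluriharmonic_on unit_polydisc f" and r: "0 < r" "r < 1"
    and l: "\<kappa> l < 0" and k: "0 < \<kappa> k"
  shows "fourier r f \<kappa> = 0"
proof -
  note cont = pluriharmonic_polydisc_derivatives(3)[OF f] pluriharmonic_polydisc_derivatives(4)[OF f, of l]
  obtain q where q: "- \<kappa> l = int (Suc q)"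
    using l by (metis neg_0_less_iff_less zero_less_imp_eq_int not0_implies_Suc less_irrefl)
  obtain p where p: "\<kappa> k = int (Suc p)" using k by (metis zero_less_imp_eq_int not0_implies_Suc less_irrefl)
  have kl: "k \<noteq> l" using k l by auto
  \<comment> \<open>The frequencies after integration by parts: the exponent at \<open>l\<close> has
    dropped from \<open>Suc q\<close> to \<open>q\<close>.\<close>
  define \<mu> where "\<mu> = (\<lambda>j. if j = l then int q else - \<kappa> j)"
  define d where "d = wirtinger_dbar l f"
  define F where "F = (\<lambda>\<omega>. cut_off r f (r *\<^sub>R \<omega>) * character (\<lambda>j. - \<kappa> j) \<omega>)"
  define G where "G = (\<lambda>\<omega>. (r / Suc q) * (cut_off r d (r *\<^sub>R \<omega>) * character \<mu> \<omega>))"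
  have F: "torus_bounded F" unfolding F_def by (intro torus_bounded_intros cont r)
  have G: "torus_bounded G" unfolding G_def d_def by (intro torus_bounded_intros cont r)
  have mG: "torus_bounded (\<lambda>\<omega>. - 1 * G \<omega>)" by (intro torus_bounded_intros G)
  have poly: "r *\<^sub>R \<omega> \<in> unit_polydisc" if "\<omega> \<in> unit_torus" for \<omega> :: "complex ^ 'n"
    using scaleR_torus_in_closed_polydisc[OF that] closed_polydisc_subset[OF r(2)] r by (meson less_imp_le subsetD)
  have upd: "r *\<^sub>R vec_upd \<omega> i y = vec_upd (r *\<^sub>R \<omega>) i (r * y)" for \<omega> :: "complex ^ 'n" and i and y :: complex
    by (simp add: vec_eq_iff vec_upd_nth) (simp add: scaleR_conv_of_real)
  have cut: "cut_off r u (r *\<^sub>R vec_upd \<omega> i y) = u (vec_upd (r *\<^sub>R \<omega>) i (r * y))"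
    if "\<omega> \<in> unit_torus" "norm y = 1" for \<omega> :: "complex ^ 'n" and i u and y :: complex
    using scaleR_torus_in_closed_polydisc[OF vec_upd_in_torus[OF that], of r i] r
    by (subst cut_off_eq) (simp_all add: upd)
  have ry: "norm (r * y) < 1" if "norm y = 1" for y :: complex using that r by (simp add: norm_mult)
  have "(\<integral>\<omega>. F \<omega> + - 1 * G \<omega> \<partial>torus_measure) = 0"
  proof -
    have FG: "torus_bounded (\<lambda>\<omega>. F \<omega> + - 1 * G \<omega>)" by (intro torus_bounded_add F mG)
    then obtain B where B: "\<And>\<omega>. \<omega> \<in> unit_torus \<Longrightarrow> norm (F \<omega> + - 1 * G \<omega>) \<le> B"
      unfolding torus_bounded_def by blast
    show ?thesis
    proof (rule integral_torus_eq_0I[OF torus_bounded_measurable[OF FG] B])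
      fix \<omega> :: "complex ^ 'n" assume \<omega>: "\<omega> \<in> unit_torus"
      from pluriharmonic_slice[OF f poly[OF \<omega>], of l] obtain H K where
        H: "H holomorphic_on ball 0 1" and K: "K holomorphic_on ball 0 1"
        and fHK: "\<forall>y. norm y < 1 \<longrightarrow> f (vec_upd (r *\<^sub>R \<omega>) l y) = H y + cnj (K y) \<and>
          wirtinger_dbar l f (vec_upd (r *\<^sub>R \<omega>) l y) = cnj (deriv K y)"
        by blast
      define R where "R = (\<Prod>j\<in>UNIV - {l}. \<omega> $ j powi (- \<kappa> j))"
      have R': "(\<Prod>j\<in>UNIV - {l}. \<omega> $ j powi \<mu> j) = R"
        unfolding R_def by (intro prod.cong) (auto simp: \<mu>_def)
      have eq: "F (vec_upd \<omega> l y) + - 1 * G (vec_upd \<omega> l y) =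
        R * (H (r * y) * y ^ Suc q + cnj (K (r * y) * cnj y ^ Suc q - r / Suc q * (deriv K (r * y) * cnj y ^ q)))"
        if y: "norm y = 1" for y :: complex
      proof -
        have "F (vec_upd \<omega> l y) = (H (r * y) + cnj (K (r * y))) * (y ^ Suc q * R)"
          using fHK ry[OF y] unfolding F_def cut[OF \<omega> y] character_vec_upd q R_def[symmetric]
          by (simp only: power_int_of_nat)
        moreover have "G (vec_upd \<omega> l y) = r / Suc q * (cnj (deriv K (r * y)) * (y ^ q * R))"
          using fHK ry[OF y] unfolding G_def cut[OF \<omega> y] character_vec_upd R' d_def
          by (simp add: \<mu>_def del: of_nat_Suc)
        ultimately show ?thesis by (simp add: algebra_simps del: of_nat_Suc)
      qed
      have "has_circle_mean (\<lambda>y. R * (H (r * y) * y ^ Suc q +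
          cnj (K (r * y) * cnj y ^ Suc q - r / Suc q * (deriv K (r * y) * cnj y ^ q)))) (R * (0 + cnj 0))"
        by (intro has_circle_mean_cmult has_circle_mean_add has_circle_mean_cnj
            has_circle_mean_power[OF H r] has_circle_mean_by_parts[OF K r])
      then show "has_circle_mean (\<lambda>y. F (vec_upd \<omega> l y) + - 1 * G (vec_upd \<omega> l y)) 0"
        by (subst has_circle_mean_cong[OF eq]) simp_all
    qed
  qed
  then have "(\<integral>\<omega>. F \<omega> \<partial>torus_measure) = (\<integral>\<omega>. G \<omega> \<partial>torus_measure)"
    using Bochner_Integration.integral_diff[OF torus_bounded_integrable[OF F] torus_bounded_integrable[OF G]]
    by simp
  also have "\<dots> = 0"
  proof -
    obtain B where B: "\<And>\<omega>. \<omega> \<in> unit_torus \<Longrightarrow> norm (G \<omega>) \<le> B"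
      using G unfolding torus_bounded_def by blast
    show ?thesis
    proof (rule integral_torus_eq_0I[OF torus_bounded_measurable[OF G] B])
      fix \<omega> :: "complex ^ 'n" assume \<omega>: "\<omega> \<in> unit_torus"
      from wirtinger_dbar_slice[OF f poly[OF \<omega>], of l k] obtain L where
        L: "L holomorphic_on ball 0 1"
        and dL: "\<forall>y. norm y < 1 \<longrightarrow> wirtinger_dbar l f (vec_upd (r *\<^sub>R \<omega>) k y) = cnj (L y)"
        by blast
      define R where "R = (\<Prod>j\<in>UNIV - {k}. \<omega> $ j powi \<mu> j)"
      \<comment> \<open>Since \<open>k\<close> differs from \<open>l\<close>, the frequency at
        \<open>k\<close> is still \<open>- Suc p\<close>. The slice is therefore the conjugate of a
        holomorphic function times a positive power of \<open>y\<close>, whose mean is 0.\<close>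
      have eq: "G (vec_upd \<omega> k y) = (r / Suc q * R) * cnj (L (r * y) * y ^ Suc p)"
        if y: "norm y = 1" for y :: complex
        using dL ry[OF y] kl unfolding G_def cut[OF \<omega> y] character_vec_upd R_def[symmetric] d_def
        by (simp add: \<mu>_def p powi_on_circle[OF y] mult_ac del: of_nat_Suc power_Suc)
      have "has_circle_mean (\<lambda>y. (r / Suc q * R) * cnj (L (r * y) * y ^ Suc p)) ((r / Suc q * R) * cnj 0)"
        by (intro has_circle_mean_cmult has_circle_mean_cnj has_circle_mean_power[OF L r])
      then show "has_circle_mean (\<lambda>y. G (vec_upd \<omega> k y)) 0"
        by (subst has_circle_mean_cong[OF eq]) simp_all
    qed
  qed
  finally show ?thesis by (simp add: fourier_def F_def)
qed

section \<open>Fourier partial sums: convergence and splitting\<close>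

text \<open>Truncation to a cube of frequencies makes the summation kernel a product of the kernels
  \<open>trunc_poisson\<close> in the single coordinates.\<close>

definition partial_sum :: "real \<Rightarrow> (complex ^ 'n::finite \<Rightarrow> complex) \<Rightarrow> nat \<Rightarrow> complex ^ 'n \<Rightarrow> complex" where
  "partial_sum r f N z = (\<Sum>\<kappa>\<in>PiE UNIV (\<lambda>_. {- int N..int N}). fourier r f \<kappa> * (\<Prod>j\<in>UNIV. zpow (\<kappa> j) (z $ j / r)))"

lemma partial_sum_eq:
  fixes f :: "complex ^ 'n::finite \<Rightarrow> complex" and z :: "complex ^ 'n"
  assumes "continuous_on unit_polydisc f" "r < 1"
  shows "partial_sum r f N z =
    (\<integral>\<omega>. cut_off r f (r *\<^sub>R \<omega>) * (\<Prod>j\<in>UNIV. trunc_poisson N (z $ j / r) (\<omega> $ j)) \<partial>torus_measure)"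
proof -
  let ?S = "PiE (UNIV::'n set) (\<lambda>_. {- int N..int N})"
  let ?Z = "\<lambda>\<kappa>. \<Prod>j\<in>UNIV. zpow (\<kappa> j) (z $ j / r)"
  have "(\<Prod>j\<in>UNIV. trunc_poisson N (z $ j / r) (\<omega> $ j)) = (\<Sum>\<kappa>\<in>?S. ?Z \<kappa> * character (\<lambda>j. - \<kappa> j) \<omega>)" for \<omega>
    unfolding trunc_poisson_def character_def by (subst prod_sum_PiE) (auto simp: prod.distrib)
  then have "(\<integral>\<omega>. cut_off r f (r *\<^sub>R \<omega>) * (\<Prod>j\<in>UNIV. trunc_poisson N (z $ j / r) (\<omega> $ j)) \<partial>torus_measure)
    = (\<integral>\<omega>. (\<Sum>\<kappa>\<in>?S. ?Z \<kappa> * (cut_off r f (r *\<^sub>R \<omega>) * character (\<lambda>j. - \<kappa> j) \<omega>)) \<partial>torus_measure)"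
    by (simp add: sum_distrib_left mult.left_commute)
  also have "\<dots> = (\<Sum>\<kappa>\<in>?S. \<integral>\<omega>. ?Z \<kappa> * (cut_off r f (r *\<^sub>R \<omega>) * character (\<lambda>j. - \<kappa> j) \<omega>) \<partial>torus_measure)"
    by (intro Bochner_Integration.integral_sum torus_bounded_integrable torus_bounded_intros assms)
  also have "\<dots> = partial_sum r f N z"
    by (simp add: partial_sum_def fourier_def mult.commute)
  finally show ?thesis ..
qed

text \<open>One constant for all \<open>N\<close> and all \<open>z\<close> in the smaller polydisc.
  It yields the convergence at each point and the uniform bound needed to integrate the limit over
  the sphere.\<close>

lemma trunc_poisson_product_bound:
  fixes f :: "complex ^ 'n::finite \<Rightarrow> complex"
  assumes "continuous_on unit_polydisc f" and r: "0 < r" "r < 1" and \<rho>: "\<rho> < r"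
  obtains C where "\<And>N (z::complex ^ 'n) \<omega>. z \<in> closed_polydisc \<rho> \<Longrightarrow> \<omega> \<in> unit_torus \<Longrightarrow>
    norm (cut_off r f (r *\<^sub>R \<omega>) * (\<Prod>j\<in>UNIV. trunc_poisson N (z $ j / r) (\<omega> $ j))) \<le> C"
proof -
  obtain M where M: "0 \<le> M" "\<And>z. norm (cut_off r f z) \<le> M"
    using cut_off_bounded[OF assms(1) r(2)] by auto
  show ?thesis
  proof (rule that)
    fix N and z \<omega> :: "complex ^ 'n" assume z: "z \<in> closed_polydisc \<rho>" and \<omega>: "\<omega> \<in> unit_torus"
    have "norm (trunc_poisson N (z $ j / r) (\<omega> $ j)) \<le> 2 / (1 - \<rho> / r) + 1" for j
      using z \<omega> r \<rho> by (intro norm_trunc_poisson_le)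
        (auto simp: closed_polydisc_def unit_torus_def norm_divide divide_right_mono)
    then show "norm (cut_off r f (r *\<^sub>R \<omega>) * (\<Prod>j\<in>UNIV. trunc_poisson N (z $ j / r) (\<omega> $ j)))
      \<le> M * (\<Prod>j\<in>(UNIV::'n set). 2 / (1 - \<rho> / r) + 1)"
      unfolding norm_mult prod_norm[symmetric]
      using M by (intro mult_mono prod_mono prod_nonneg) auto
  qed
qed

lemma measurable_cut_off_product:
  fixes f :: "complex ^ 'n::finite \<Rightarrow> complex"
  assumes "continuous_on unit_polydisc f" "r < 1" and [measurable]: "\<And>j. k j \<in> borel_measurable borel"
  shows "(\<lambda>\<omega>. cut_off r f (r *\<^sub>R \<omega>) * (\<Prod>j\<in>UNIV. k j (\<omega> $ j))) \<in> borel_measurable borel"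
proof -
  note [measurable] = measurable_cut_off[OF assms(1,2)]
  show ?thesis by measurable
qed

lemma partial_sum_bounded:
  fixes f :: "complex ^ 'n::finite \<Rightarrow> complex"
  assumes f: "continuous_on unit_polydisc f" and r: "0 < r" "r < 1" and \<rho>: "\<rho> < r"
  obtains C where "\<And>N z. z \<in> closed_polydisc \<rho> \<Longrightarrow> norm (partial_sum r f N z) \<le> C"
proof -
  interpret T: prob_space "torus_measure :: (complex ^ 'n) measure" by (rule prob_space_torus_measure)
  obtain C where C: "\<And>N (z::complex ^ 'n) \<omega>. z \<in> closed_polydisc \<rho> \<Longrightarrow> \<omega> \<in> unit_torus \<Longrightarrow>
    norm (cut_off r f (r *\<^sub>R \<omega>) * (\<Prod>j\<in>UNIV. trunc_poisson N (z $ j / r) (\<omega> $ j))) \<le> C"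
    using trunc_poisson_product_bound[OF assms] by blast
  show ?thesis
  proof (rule that)
    fix N and z :: "complex ^ 'n" assume z: "z \<in> closed_polydisc \<rho>"
    let ?F = "\<lambda>\<omega>. cut_off r f (r *\<^sub>R \<omega>) * (\<Prod>j\<in>UNIV. trunc_poisson N (z $ j / r) (\<omega> $ j))"
    have int: "integrable torus_measure ?F"
      using f r by (intro integrable_torus_measure[of _ C] measurable_cut_off_product C z) auto
    have "norm (partial_sum r f N z) \<le> (\<integral>\<omega>. norm (?F \<omega>) \<partial>torus_measure)"
      unfolding partial_sum_eq[OF f r(2)] by (rule integral_norm_bound)
    also have "\<dots> \<le> (\<integral>\<omega>. C \<partial>(torus_measure :: (complex ^ 'n) measure))"
      by (intro integral_mono_AE integrable_norm int T.integrable_const eventually_mono[OF AE_torus_measure] C z)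
    finally show "norm (partial_sum r f N z) \<le> C"
      by (simp add: T.prob_space[simplified])
  qed
qed

text \<open>The truncated kernels converge to the Poisson kernels pointwise and boundedly on the
  torus, and the limit integral is \<open>f z\<close> by
  \<open>poisson_representation\<close>.\<close>

lemma partial_sum_tendsto:
  fixes f :: "complex ^ 'n::finite \<Rightarrow> complex"
  assumes f: "pluriharmonic_on unit_polydisc f" and r: "0 < r" "r < 1" and \<rho>: "\<rho> < r"
    and z: "z \<in> closed_polydisc \<rho>"
  shows "(\<lambda>N. partial_sum r f N z) \<longlonglongrightarrow> f z"
proof -
  interpret T: prob_space "torus_measure :: (complex ^ 'n) measure" by (rule prob_space_torus_measure)
  note cont = pluriharmonic_polydisc_derivatives(3)[OF f]
  obtain C where C: "\<And>N (z::complex ^ 'n) \<omega>. z \<in> closed_polydisc \<rho> \<Longrightarrow> \<omega> \<in> unit_torus \<Longrightarrow>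
    norm (cut_off r f (r *\<^sub>R \<omega>) * (\<Prod>j\<in>UNIV. trunc_poisson N (z $ j / r) (\<omega> $ j))) \<le> C"
    using trunc_poisson_product_bound[OF cont r \<rho>] by blast
  have zr: "norm (z $ j) < r" for j
    using z \<rho> by (auto simp: closed_polydisc_def intro: le_less_trans)
  have zr': "norm (z $ j / r) < 1" for j
    using zr[of j] r by (simp add: norm_divide)
  have "(\<lambda>N. \<integral>\<omega>. cut_off r f (r *\<^sub>R \<omega>) * (\<Prod>j\<in>UNIV. trunc_poisson N (z $ j / r) (\<omega> $ j)) \<partial>torus_measure)
    \<longlonglongrightarrow> (\<integral>\<omega>. cut_off r f (r *\<^sub>R \<omega>) * (\<Prod>j\<in>UNIV. poisson_kernel (z $ j / r) (\<omega> $ j)) \<partial>torus_measure)"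
  proof (rule integral_dominated_convergence[where w = "\<lambda>_. C"])
    show "AE \<omega> in torus_measure. (\<lambda>N. cut_off r f (r *\<^sub>R \<omega>) * (\<Prod>j\<in>UNIV. trunc_poisson N (z $ j / r) (\<omega> $ j)))
      \<longlonglongrightarrow> cut_off r f (r *\<^sub>R \<omega>) * (\<Prod>j\<in>UNIV. poisson_kernel (z $ j / r) (\<omega> $ j))"
      using AE_torus_measure
    proof eventually_elim
      case (elim \<omega>)
      then show ?case
        by (intro tendsto_intros trunc_poisson_tendsto zr') (simp add: unit_torus_def)
    qed
    show "AE \<omega> in torus_measure. norm (cut_off r f (r *\<^sub>R \<omega>) * (\<Prod>j\<in>UNIV. trunc_poisson N (z $ j / r) (\<omega> $ j))) \<le> C" for N
      by (intro eventually_mono[OF AE_torus_measure] C z)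
  qed (use measurable_cut_off_product[OF cont r(2)] in auto)
  then show ?thesis
    unfolding poisson_representation[OF f r zr] partial_sum_eq[OF cont r(2)] .
qed

text \<open>Frequencies with entries of both signs have coefficient 0. The remaining ones are all
  nonnegative, giving monomials, or all nonpositive, giving conjugate monomials. The two families
  are disjoint, so Bessel's inequality bounds both together.\<close>

lemma partial_sum_decomposition:
  fixes f :: "complex ^ 'n::finite \<Rightarrow> complex"
  assumes f: "pluriharmonic_on unit_polydisc f" and r: "0 < r" "r < 1" and \<rho>: "0 < \<rho>" "\<rho> < r"
  obtains A and a b :: "('n \<Rightarrow> nat) \<Rightarrow> complex" where "finite A" "b (\<lambda>_. 0) = 0"
    "\<And>\<zeta>. partial_sum r f N (\<rho> *\<^sub>R \<zeta>) = (\<Sum>\<alpha>\<in>A. a \<alpha> * monomial \<alpha> \<zeta>) + cnj (\<Sum>\<alpha>\<in>A. b \<alpha> * monomial \<alpha> \<zeta>)"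
    "(\<Sum>\<alpha>\<in>A. (norm (a \<alpha>))\<^sup>2) + (\<Sum>\<alpha>\<in>A. (norm (b \<alpha>))\<^sup>2) \<le> (\<integral>\<omega>. (norm (cut_off r f (r *\<^sub>R \<omega>)))\<^sup>2 \<partial>torus_measure)"
proof -
  note cont = pluriharmonic_polydisc_derivatives(3)[OF f]
  define t where "t = \<rho> / r"
  have t: "0 \<le> t" "t \<le> 1" using r \<rho> by (auto simp: t_def)
  define A where "A = PiE (UNIV::'n set) (\<lambda>_. {..N})"
  define S where "S = PiE (UNIV::'n set) (\<lambda>_. {- int N..int N})"
  define p where "p = (\<lambda>\<alpha> (j::'n). int (\<alpha> j))"
  define m where "m = (\<lambda>\<alpha> (j::'n). - int (\<alpha> j))"
  \<comment> \<open>The zero frequency has both signs; it is assigned to the holomorphic part, which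
    gives \<open>b\<close> its vanishing constant term and prevents double counting.\<close>
  define A' where "A' = A - {\<lambda>_. 0}"
  define s where "s = (\<lambda>\<alpha>::'n \<Rightarrow> nat. \<Sum>j\<in>UNIV. \<alpha> j)"
  define a where "a = (\<lambda>\<alpha>. fourier r f (p \<alpha>) * of_real (t ^ s \<alpha>))"
  define b where "b = (\<lambda>\<alpha>. if \<alpha> = (\<lambda>_. 0) then 0 else cnj (fourier r f (m \<alpha>)) * of_real (t ^ s \<alpha>))"
  have fin: "finite A" "finite A'" "finite S"
    unfolding A_def A'_def S_def by (auto intro!: finite_PiE)
  have inj: "inj_on p A" "inj_on m A'"
    by (auto simp: inj_on_def p_def m_def fun_eq_iff)
  have sub: "p ` A \<union> m ` A' \<subseteq> S"
    by (auto simp: A_def A'_def S_def p_def m_def PiE_iff)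
  have disj: "p ` A \<inter> m ` A' = {}"
  proof (rule ccontr)
    assume "p ` A \<inter> m ` A' \<noteq> {}"
    then obtain \<alpha> \<beta> where ab: "\<beta> \<in> A'" "p \<alpha> = m \<beta>" by auto
    have "\<beta> j = 0" for j using fun_cong[OF ab(2), of j] by (simp add: p_def m_def)
    then have "\<beta> = (\<lambda>_. 0)" by (rule ext)
    then show False using ab(1) by (simp add: A'_def)
  qed
  have zero: "fourier r f \<kappa> = 0" if \<kappa>: "\<kappa> \<in> S - (p ` A \<union> m ` A')" for \<kappa>
  proof -
    have "\<exists>l. \<kappa> l < 0"
    proof (rule ccontr)
      assume "\<not> (\<exists>l. \<kappa> l < 0)"
      then have "\<kappa> = p (\<lambda>j. nat (\<kappa> j))" by (auto simp: p_def fun_eq_iff not_less)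
      moreover have "(\<lambda>j. nat (\<kappa> j)) \<in> A" using \<kappa> by (auto simp: A_def S_def PiE_iff nat_le_iff)
      ultimately show False using \<kappa> by blast
    qed
    then obtain l where l: "\<kappa> l < 0" ..
    have "\<exists>k. 0 < \<kappa> k"
    proof (rule ccontr)
      assume "\<not> (\<exists>k. 0 < \<kappa> k)"
      then have "\<kappa> = m (\<lambda>j. nat (- \<kappa> j))" by (auto simp: m_def fun_eq_iff not_less)
      moreover have "(\<lambda>j. nat (- \<kappa> j)) \<in> A"
        using \<kappa> by (auto simp: A_def S_def PiE_iff nat_le_iff minus_le_iff)
      moreover have "(\<lambda>j. nat (- \<kappa> j)) \<noteq> (\<lambda>_. 0)" using l by (auto simp: fun_eq_iff intro!: exI[of _ l])
      ultimately show False using \<kappa> unfolding A'_def by blast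
    qed
    then obtain k where k: "0 < \<kappa> k" ..
    show ?thesis by (rule fourier_mixed_eq_0[where \<kappa> = \<kappa> and l = l and k = k, OF f r l k])
  qed
  have coord: "(\<rho> *\<^sub>R \<zeta>) $ j / r = t * \<zeta> $ j" for \<zeta> :: "complex ^ 'n" and j
    unfolding t_def vector_scaleR_component by (simp add: scaleR_conv_of_real)
  have Zp: "(\<Prod>j\<in>UNIV. zpow (p \<alpha> j) ((\<rho> *\<^sub>R \<zeta>) $ j / r)) = of_real (t ^ s \<alpha>) * monomial \<alpha> \<zeta>" for \<alpha> \<zeta>
    unfolding coord by (simp add: zpow_def p_def s_def monomial_def power_mult_distrib prod.distrib power_sum)
  have Zm: "(\<Prod>j\<in>UNIV. zpow (m \<alpha> j) ((\<rho> *\<^sub>R \<zeta>) $ j / r)) = of_real (t ^ s \<alpha>) * cnj (monomial \<alpha> \<zeta>)" for \<alpha> \<zeta>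
  proof -
    have "zpow (- int k) x = cnj x ^ k" for k x by (cases "k = 0") (auto simp: zpow_def)
    then show ?thesis
      unfolding coord by (simp add: m_def s_def monomial_def power_mult_distrib prod.distrib power_sum)
  qed
  have b_sum: "(\<Sum>\<alpha>\<in>A. g (b \<alpha>) \<alpha>) = (\<Sum>\<alpha>\<in>A'. g (cnj (fourier r f (m \<alpha>)) * of_real (t ^ s \<alpha>)) \<alpha>)"
    if "\<And>\<alpha>. g 0 \<alpha> = 0" for g :: "complex \<Rightarrow> ('n \<Rightarrow> nat) \<Rightarrow> 'b::comm_monoid_add"
    using fin that by (intro sum.mono_neutral_cong_right) (auto simp: A'_def b_def)
  have dec: "partial_sum r f N (\<rho> *\<^sub>R \<zeta>) = (\<Sum>\<alpha>\<in>A. a \<alpha> * monomial \<alpha> \<zeta>) + cnj (\<Sum>\<alpha>\<in>A. b \<alpha> * monomial \<alpha> \<zeta>)" for \<zeta>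
  proof -
    let ?T = "\<lambda>\<kappa>. fourier r f \<kappa> * (\<Prod>j\<in>UNIV. zpow (\<kappa> j) ((\<rho> *\<^sub>R \<zeta>) $ j / r))"
    have "partial_sum r f N (\<rho> *\<^sub>R \<zeta>) = (\<Sum>\<kappa>\<in>p ` A \<union> m ` A'. ?T \<kappa>)"
      unfolding partial_sum_def S_def[symmetric]
      using fin sub zero by (intro sum.mono_neutral_right) auto
    also have "\<dots> = (\<Sum>\<kappa>\<in>p ` A. ?T \<kappa>) + (\<Sum>\<kappa>\<in>m ` A'. ?T \<kappa>)"
      using fin disj by (intro sum.union_disjoint) auto
    also have "(\<Sum>\<kappa>\<in>p ` A. ?T \<kappa>) = (\<Sum>\<alpha>\<in>A. a \<alpha> * monomial \<alpha> \<zeta>)"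
      unfolding sum.reindex[OF inj(1)] o_def Zp a_def by (simp add: mult.assoc)
    also have "(\<Sum>\<kappa>\<in>m ` A'. ?T \<kappa>) = cnj (\<Sum>\<alpha>\<in>A'. cnj (fourier r f (m \<alpha>)) * of_real (t ^ s \<alpha>) * monomial \<alpha> \<zeta>)"
      unfolding sum.reindex[OF inj(2)] o_def Zm by (simp add: mult.assoc)
    also have "(\<Sum>\<alpha>\<in>A'. cnj (fourier r f (m \<alpha>)) * of_real (t ^ s \<alpha>) * monomial \<alpha> \<zeta>) = (\<Sum>\<alpha>\<in>A. b \<alpha> * monomial \<alpha> \<zeta>)"
      by (rule b_sum[symmetric]) simp
    finally show ?thesis .
  qed
  \<comment> \<open>Passing from radius \<open>r\<close> to \<rho> multiplies coefficients by powers
    of \<rho>/r <= 1, which are dropped to reach the coefficients in Bessel's inequality.\<close>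
  have le: "(norm (c * of_real (t ^ k)))\<^sup>2 \<le> (norm c)\<^sup>2" for c :: complex and k
  proof -
    have "norm c * t ^ k \<le> norm c * 1"
      using t by (intro mult_left_mono power_le_one) auto
    then show ?thesis using t by (intro power_mono) (auto simp: norm_mult norm_power)
  qed
  have "(\<Sum>\<alpha>\<in>A. (norm (a \<alpha>))\<^sup>2) + (\<Sum>\<alpha>\<in>A. (norm (b \<alpha>))\<^sup>2)
    \<le> (\<Sum>\<alpha>\<in>A. (norm (fourier r f (p \<alpha>)))\<^sup>2) + (\<Sum>\<alpha>\<in>A'. (norm (fourier r f (m \<alpha>)))\<^sup>2)"
  proof (rule add_mono)
    show "(\<Sum>\<alpha>\<in>A. (norm (a \<alpha>))\<^sup>2) \<le> (\<Sum>\<alpha>\<in>A. (norm (fourier r f (p \<alpha>)))\<^sup>2)"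
      unfolding a_def by (intro sum_mono le)
    have "(\<Sum>\<alpha>\<in>A. (norm (b \<alpha>))\<^sup>2) = (\<Sum>\<alpha>\<in>A'. (norm (cnj (fourier r f (m \<alpha>)) * of_real (t ^ s \<alpha>)))\<^sup>2)"
      by (rule b_sum) simp
    also have "\<dots> \<le> (\<Sum>\<alpha>\<in>A'. (norm (cnj (fourier r f (m \<alpha>))))\<^sup>2)"
      by (intro sum_mono le)
    finally show "(\<Sum>\<alpha>\<in>A. (norm (b \<alpha>))\<^sup>2) \<le> (\<Sum>\<alpha>\<in>A'. (norm (fourier r f (m \<alpha>)))\<^sup>2)" by simp
  qed
  also have "\<dots> = (\<Sum>\<kappa>\<in>p ` A \<union> m ` A'. (norm (fourier r f \<kappa>))\<^sup>2)"
    using fin disj by (simp add: sum.union_disjoint sum.reindex inj)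
  also have "\<dots> \<le> (\<integral>\<omega>. (norm (cut_off r f (r *\<^sub>R \<omega>)))\<^sup>2 \<partial>torus_measure)"
    unfolding fourier_def using fin
    by (intro bessel_inequality_torus torus_bounded_intros cont r) auto
  finally show ?thesis
    using fin dec by (intro that[of A b a]) (auto simp: b_def)
qed

section \<open>Sphere means against torus means\<close>

text \<open>Every partial sum satisfies the estimate with a right side independent of
  \<open>N\<close>. The uniform bound on the polydisc of radius \<rho>, which contains the sphere of
  that radius, permits passage to the limit under the integral.\<close>

lemma integral_sphere_le_integral_torus:
  fixes f :: "complex ^ 'n::finite \<Rightarrow> complex"
  assumes f: "pluriharmonic_on unit_polydisc f" and r: "0 < r" "r < 1" and \<rho>: "0 < \<rho>" "\<rho> < r"
  defines "n \<equiv> CARD('n)"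
  shows "(\<integral>\<zeta>. norm (cut_off \<rho> f (\<rho> *\<^sub>R \<zeta>)) ^ (2 * n) \<partial>sphere_measure)
    \<le> 2 ^ n * cos (pi / (4 * real n)) ^ (2 * n) * (\<integral>\<omega>. (norm (cut_off r f (r *\<^sub>R \<omega>)))\<^sup>2 \<partial>torus_measure) ^ n"
proof -
  interpret S: prob_space "sphere_measure :: (complex ^ 'n) measure" by (rule prob_space_sphere_measure)
  note cont = pluriharmonic_polydisc_derivatives(3)[OF f]
  define I where "I = (\<integral>\<omega>. (norm (cut_off r f (r *\<^sub>R \<omega>)))\<^sup>2 \<partial>torus_measure)"
  have \<rho>1: "\<rho> < 1" using r \<rho> by simp
  have ball: "\<rho> *\<^sub>R \<zeta> \<in> closed_polydisc \<rho>" if "\<zeta> \<in> sphere 0 1" for \<zeta> :: "complex ^ 'n"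
    using that \<rho> Finite_Cartesian_Product.norm_nth_le[of \<zeta>]
    by (auto simp: closed_polydisc_def mult_left_le)
  obtain C where C: "\<And>N z. z \<in> closed_polydisc \<rho> \<Longrightarrow> norm (partial_sum r f N z) \<le> C"
    using partial_sum_bounded[OF cont r \<rho>(2)] by blast
  have pc: "continuous_on UNIV (\<lambda>\<zeta>. partial_sum r f N (\<rho> *\<^sub>R \<zeta>))" for N
  proof -
    obtain A and a b :: "('n \<Rightarrow> nat) \<Rightarrow> complex" where
      "\<And>\<zeta>. partial_sum r f N (\<rho> *\<^sub>R \<zeta>) = (\<Sum>\<alpha>\<in>A. a \<alpha> * monomial \<alpha> \<zeta>) + cnj (\<Sum>\<alpha>\<in>A. b \<alpha> * monomial \<alpha> \<zeta>)"
      by (rule partial_sum_decomposition[OF f r \<rho>]) blast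
    then show ?thesis by (simp only:) (intro continuous_intros)
  qed
  have "(\<lambda>N. \<integral>\<zeta>. norm (partial_sum r f N (\<rho> *\<^sub>R \<zeta>)) ^ (2 * n) \<partial>sphere_measure)
    \<longlonglongrightarrow> (\<integral>\<zeta>. norm (cut_off \<rho> f (\<rho> *\<^sub>R \<zeta>)) ^ (2 * n) \<partial>sphere_measure)"
  proof (rule integral_dominated_convergence[where w = "\<lambda>_. C ^ (2 * n)"])
    note [measurable] = measurable_cut_off[OF cont \<rho>1]
    show "(\<lambda>\<zeta>. norm (cut_off \<rho> f (\<rho> *\<^sub>R \<zeta>)) ^ (2 * n)) \<in> borel_measurable sphere_measure"
      by measurable
    show "(\<lambda>\<zeta>. norm (partial_sum r f N (\<rho> *\<^sub>R \<zeta>)) ^ (2 * n)) \<in> borel_measurable sphere_measure" for N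
      using borel_measurable_continuous_onI[OF pc[of N]] by simp
    show "AE \<zeta> in sphere_measure. (\<lambda>N. norm (partial_sum r f N (\<rho> *\<^sub>R \<zeta>)) ^ (2 * n))
      \<longlonglongrightarrow> norm (cut_off \<rho> f (\<rho> *\<^sub>R \<zeta>)) ^ (2 * n)"
      using AE_sphere_measure
    proof eventually_elim
      case (elim \<zeta>)
      show ?case
        unfolding cut_off_eq[OF ball[OF elim]]
        by (intro tendsto_intros partial_sum_tendsto[OF f r \<rho>(2)] ball elim)
    qed
    show "AE \<zeta> in sphere_measure. norm (norm (partial_sum r f N (\<rho> *\<^sub>R \<zeta>)) ^ (2 * n)) \<le> C ^ (2 * n)" for N
      using AE_sphere_measure
    proof eventually_elim
      case (elim \<zeta>)
      then show ?case using C[OF ball[OF elim]] by (simp add: power_mono)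
    qed
  qed simp
  moreover have "(\<integral>\<zeta>. norm (partial_sum r f N (\<rho> *\<^sub>R \<zeta>)) ^ (2 * n) \<partial>sphere_measure)
    \<le> 2 ^ n * cos (pi / (4 * real n)) ^ (2 * n) * I ^ n" for N
  proof -
    obtain A and a b :: "('n \<Rightarrow> nat) \<Rightarrow> complex" where A: "finite A" and b: "b (\<lambda>_. 0) = 0" and
      dec: "\<And>\<zeta>. partial_sum r f N (\<rho> *\<^sub>R \<zeta>) = (\<Sum>\<alpha>\<in>A. a \<alpha> * monomial \<alpha> \<zeta>) + cnj (\<Sum>\<alpha>\<in>A. b \<alpha> * monomial \<alpha> \<zeta>)" and
      le: "(\<Sum>\<alpha>\<in>A. (norm (a \<alpha>))\<^sup>2) + (\<Sum>\<alpha>\<in>A. (norm (b \<alpha>))\<^sup>2) \<le> I"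
      unfolding I_def by (rule partial_sum_decomposition[OF f r \<rho>]) blast
    have "(\<integral>\<zeta>. norm (partial_sum r f N (\<rho> *\<^sub>R \<zeta>)) ^ (2 * n) \<partial>sphere_measure)
      \<le> 2 ^ n * cos (pi / (4 * real n)) ^ (2 * n) * ((\<Sum>\<alpha>\<in>A. (norm (a \<alpha>))\<^sup>2) + (\<Sum>\<alpha>\<in>A. (norm (b \<alpha>))\<^sup>2)) ^ n"
      unfolding dec n_def by (rule integral_sphere_pluriharmonic_polynomial_le[where b = b, OF A b])
    also have "\<dots> \<le> 2 ^ n * cos (pi / (4 * real n)) ^ (2 * n) * I ^ n"
      using le by (intro mult_left_mono power_mono add_nonneg_nonneg sum_nonneg) auto
    finally show ?thesis .
  qed
  ultimately show ?thesis
    unfolding I_def by (intro LIMSEQ_le_const2) auto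
qed

theorem theorem1p3:
  fixes f :: "complex ^ 'n::finite \<Rightarrow> complex"
  assumes "f \<in> h2_polydisc"
  shows "hp_norm_ball (2 * real CARD('n)) f
    \<le> ennreal (sqrt 2 * cos (pi / (4 * real CARD('n)))) * h2_norm_polydisc f"
proof -
  define n where "n = CARD('n)"
  define D where "D = sqrt 2 * cos (pi / (4 * real n))"
  have n: "0 < n" "1 \<le> real n" by (simp_all add: n_def Suc_le_eq)
  have "0 \<le> cos (pi / (4 * real n))"
  proof (rule cos_ge_zero)
    show "pi / (4 * real n) \<le> pi / 2" using n by (intro divide_left_mono) auto
    have "0 \<le> pi / (4 * real n)" by simp
    then show "- (pi / 2) \<le> pi / (4 * real n)" using pi_gt_zero by linarith
  qed
  then have D: "0 \<le> D" by (simp add: D_def)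
  have D2: "D ^ (2 * n) = 2 ^ n * cos (pi / (4 * real n)) ^ (2 * n)"
    by (simp add: D_def power_mult_distrib power_mult)
  have f: "pluriharmonic_on unit_polydisc f" using assms by (simp add: h2_polydisc_def)
  note cont = pluriharmonic_polydisc_derivatives(3)[OF f]
  have "ennreal ((LINT \<zeta>:sphere 0 1|sphere_measure. norm (f (\<rho> *\<^sub>R \<zeta>)) powr (2 * real n)) powr (1 / (2 * real n)))
    \<le> ennreal D * h2_norm_polydisc f" if \<rho>: "\<rho> \<in> {0<..<1}" for \<rho>
  proof -
    \<comment> \<open>Any radius strictly between \<rho> and 1 would do: every torus mean is bounded
      by the supremum.\<close>
    define r where "r = (1 + \<rho>) / 2"
    have r: "0 < r" "r < 1" "0 < \<rho>" "\<rho> < r" "\<rho> < 1" using \<rho> by (auto simp: r_def)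
    note [measurable] = measurable_cut_off[OF cont r(5)] measurable_cut_off[OF cont r(2)]
    have "(LINT \<zeta>:sphere 0 1|sphere_measure. norm (f (\<rho> *\<^sub>R \<zeta>)) powr (2 * real n))
      = (\<integral>\<zeta>. indicator (sphere 0 1) \<zeta> *\<^sub>R norm (cut_off \<rho> f (\<rho> *\<^sub>R \<zeta>)) ^ (2 * n) \<partial>sphere_measure)"
      unfolding set_lebesgue_integral_def
    proof (intro Bochner_Integration.integral_cong refl)
      fix \<zeta> :: "complex ^ 'n"
      have "norm (f (\<rho> *\<^sub>R \<zeta>)) powr (2 * real n) = norm (cut_off \<rho> f (\<rho> *\<^sub>R \<zeta>)) ^ (2 * n)" if "\<zeta> \<in> sphere 0 1"
      proof -
        have "\<rho> *\<^sub>R \<zeta> \<in> closed_polydisc \<rho>"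
          using that r Finite_Cartesian_Product.norm_nth_le[of \<zeta>]
          by (auto simp: closed_polydisc_def mult_left_le)
        \<comment> \<open>At a zero of \<open>f\<close> both kinds of power are 0, the natural one
          because n > 0; elsewhere they agree for a positive base.\<close>
        then show ?thesis
          using n by (cases "f (\<rho> *\<^sub>R \<zeta>) = 0") (simp_all add: cut_off_eq powr_realpow[symmetric])
      qed
      then show "indicator (sphere 0 1) \<zeta> *\<^sub>R norm (f (\<rho> *\<^sub>R \<zeta>)) powr (2 * real n) =
        indicator (sphere 0 1) \<zeta> *\<^sub>R norm (cut_off \<rho> f (\<rho> *\<^sub>R \<zeta>)) ^ (2 * n)"
        by (auto simp: indicator_def)
    qed
    also have "\<dots> = (\<integral>\<zeta>. norm (cut_off \<rho> f (\<rho> *\<^sub>R \<zeta>)) ^ (2 * n) \<partial>sphere_measure)"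
    proof (rule integral_cong_AE)
      have [measurable]: "sphere (0::complex ^ 'n) 1 \<in> sets borel" by (intro borel_closed closed_sphere)
      show "(\<lambda>\<zeta>. indicator (sphere 0 1) \<zeta> *\<^sub>R norm (cut_off \<rho> f (\<rho> *\<^sub>R \<zeta>)) ^ (2 * n)) \<in> borel_measurable sphere_measure"
        by measurable
      show "AE \<zeta> in sphere_measure. indicator (sphere 0 1) \<zeta> *\<^sub>R norm (cut_off \<rho> f (\<rho> *\<^sub>R \<zeta>)) ^ (2 * n)
        = norm (cut_off \<rho> f (\<rho> *\<^sub>R \<zeta>)) ^ (2 * n)"
        using AE_sphere_measure by eventually_elim simp
    qed measurable
    finally have X: "(LINT \<zeta>:sphere 0 1|sphere_measure. norm (f (\<rho> *\<^sub>R \<zeta>)) powr (2 * real n))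
      = (\<integral>\<zeta>. norm (cut_off \<rho> f (\<rho> *\<^sub>R \<zeta>)) ^ (2 * n) \<partial>sphere_measure)" (is "?X = ?X'") .
    have "(LINT \<omega>:unit_torus|torus_measure. (norm (f (r *\<^sub>R \<omega>)))\<^sup>2)
      = (\<integral>\<omega>. indicator unit_torus \<omega> *\<^sub>R (norm (cut_off r f (r *\<^sub>R \<omega>)))\<^sup>2 \<partial>torus_measure)"
      unfolding set_lebesgue_integral_def
    proof (intro Bochner_Integration.integral_cong refl)
      fix \<omega> :: "complex ^ 'n"
      show "indicator unit_torus \<omega> *\<^sub>R (norm (f (r *\<^sub>R \<omega>)))\<^sup>2 = indicator unit_torus \<omega> *\<^sub>R (norm (cut_off r f (r *\<^sub>R \<omega>)))\<^sup>2"
        using scaleR_torus_in_closed_polydisc[of \<omega> r] r by (cases "\<omega> \<in> unit_torus") (simp_all add: cut_off_eq)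
    qed
    also have "\<dots> = (\<integral>\<omega>. (norm (cut_off r f (r *\<^sub>R \<omega>)))\<^sup>2 \<partial>torus_measure)"
    proof (rule integral_cong_AE)
      have "closed (unit_torus :: (complex ^ 'n) set)"
        unfolding unit_torus_def mem_sphere dist_norm
        by (intro closed_Collect_all closed_Collect_eq continuous_intros)
      then have [measurable]: "(unit_torus :: (complex ^ 'n) set) \<in> sets borel" by (rule borel_closed)
      show "(\<lambda>\<omega>. indicator unit_torus \<omega> *\<^sub>R (norm (cut_off r f (r *\<^sub>R \<omega>)))\<^sup>2) \<in> borel_measurable torus_measure"
        by measurable
      show "AE \<omega> in torus_measure. indicator unit_torus \<omega> *\<^sub>R (norm (cut_off r f (r *\<^sub>R \<omega>)))\<^sup>2 = (norm (cut_off r f (r *\<^sub>R \<omega>)))\<^sup>2"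
        using AE_torus_measure by eventually_elim simp
    qed measurable
    finally have Y: "(LINT \<omega>:unit_torus|torus_measure. (norm (f (r *\<^sub>R \<omega>)))\<^sup>2)
      = (\<integral>\<omega>. (norm (cut_off r f (r *\<^sub>R \<omega>)))\<^sup>2 \<partial>torus_measure)" (is "?Y = ?Y'") .
    have Y0: "0 \<le> ?Y'" by (intro integral_nonneg_AE) simp
    have X0: "0 \<le> ?X'" by (intro integral_nonneg_AE) simp
    have "?X' \<le> D ^ (2 * n) * ?Y' ^ n"
      using integral_sphere_le_integral_torus[OF f r(1-4)] unfolding D2 n_def[symmetric] .
    also have "\<dots> = (D * sqrt ?Y') ^ (2 * n)"
      using Y0 by (simp add: power_mult_distrib power_mult)
    finally have "?X' powr (1 / (2 * real n)) \<le> ((D * sqrt ?Y') ^ (2 * n)) powr (1 / (2 * real n))"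
      using X0 n by (intro powr_mono2) auto
    also have "\<dots> = D * sqrt ?Y'"
    proof (cases "D * sqrt ?Y' = 0")
      case False
      then have "0 < D * sqrt ?Y'" using D Y0 by (simp add: zero_less_mult_iff less_le)
      then show ?thesis using n by (simp add: powr_realpow[symmetric] powr_powr)
    qed (use n in auto)
    finally have "ennreal (?X powr (1 / (2 * real n))) \<le> ennreal D * ennreal (sqrt ?Y)"
      unfolding X Y using D Y0 by (simp add: ennreal_mult[symmetric] ennreal_leI)
    also have "ennreal (sqrt ?Y) \<le> h2_norm_polydisc f"
      unfolding h2_norm_polydisc_def using r by (intro SUP_upper) auto
    finally show ?thesis by (simp add: mult_left_mono)
  qed
  then show ?thesis
    unfolding hp_norm_ball_def n_def[symmetric] D_def[symmetric] by (intro SUP_least) auto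
qed

end
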